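(* Let $\Pi$ be a self-contained $k$-witness problem, and suppose that $0 < \delta \leq \frac{1}{2}$ and $M \in \mathbb{N}$. Then there exists a randomised algorithm which, on an instance of $\Pi$ with universe of size $n$, makes at most $2^{O(k)} \log^2 n \cdot M \log(\delta^{-1})$ calls to a deterministic decision oracle for $\Pi$, and (1) if the number of witnesses in the instance is at most $M$, outputs with probability at least $1 - \delta$ the exact number of witnesses in the instance; (2) if the number of witnesses in the instance is strictly greater than $M$, always outputs ``More than $M$''. Moreover, if there is an algorithm solving the decision version of $\Pi$ in time $g(k)\cdot n^{O(1)}$ for some computable function $g$, then the expected running time of the randomised algorithm is bounded by $2^{O(k)}\cdot g(k)\cdot n^{O(1)} \cdot M \cdot \log(\delta^{-1})$.
   Context: A self-contained $k$-witness problem is one in which an instance consists of a universe $U$ of $n$ elements and a parameter $k$, together with a collection of $k$-element subsets of $U$ called witnesses, such that a decision procedure may be called on any subset $X \subseteq U$ to determine whether some witness of the original instance is contained in $X$. The deterministic decision oracle takes $X \subseteq U$ and returns $1$ if some witness $W \subseteq X$ exists and $0$ otherwise. *)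

theory Defs
  imports "HOL-Probability.Probability"
begin

section \<open>Witness problems\<close>

text \<open>
  The universe of an instance with \<open>n\<close> elements is \<open>{0..<n}\<close>.  Everything else describing
  the instance (for example the edges of a graph) is in \<open>data\<close>, in whatever encoding
  the problem prescribes.
\<close>

record inst =
  usize :: nat
  param :: nat
  data  :: "nat list"

record problem =
  instances :: "inst set"
  witnesses :: "inst \<Rightarrow> nat set set"

definition universe :: "inst \<Rightarrow> nat set" where
  "universe I = {..<usize I}"

definition decision :: "problem \<Rightarrow> inst \<Rightarrow> nat set \<Rightarrow> bool" where
  "decision P I X \<longleftrightarrow> (\<exists>W\<in>witnesses P I. W \<subseteq> X)"

text \<open>
  That the decision procedure can be called on every subset \<open>X\<close> of the universe of the
  original instance is built into the notions of oracle and of decision algorithm below: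
  both take a pair of an instance and a subset.
\<close>

definition self_contained :: "problem \<Rightarrow> bool" where
  "self_contained P \<longleftrightarrow>
     (\<forall>I\<in>instances P. \<forall>W\<in>witnesses P I. W \<subseteq> universe I \<and> card W = param I)"


section \<open>Randomised oracle programs\<close>

text \<open>
  The machine model is a unit-cost random access machine with addition and truncated
  subtraction (no multiplication, so that unit cost is polynomially related to Turing
  machine time), given by while programs over named arrays of natural numbers.  A scalar
  variable is cell \<open>0\<close> of an array.  The list \<open>data\<close> is read-only random access input.
  \<open>Flip x\<close> stores a fair random bit in \<open>x\<close>.  \<open>Query x a\<close> calls the oracle on the subset of
  the universe whose characteristic array is \<open>a\<close> and stores the answer in \<open>x\<close>.
\<close>

type_synonym mem = "string \<Rightarrow> nat \<Rightarrow> nat"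

datatype expr =
    Const nat
  | Cell string expr
  | Input expr
  | Plus expr expr
  | Minus expr expr

datatype com =
    Skip
  | Assign string expr expr
  | Flip string
  | Query string string
  | Seq com com
  | If expr com com
  | While expr com

primrec aval :: "inst \<Rightarrow> mem \<Rightarrow> expr \<Rightarrow> nat" where
  "aval I m (Const v) = v"
| "aval I m (Cell a e) = m a (aval I m e)"
| "aval I m (Input e) =
     (if aval I m e < length (data I) then data I ! aval I m e else 0)"
| "aval I m (Plus e1 e2) = aval I m e1 + aval I m e2"
| "aval I m (Minus e1 e2) = aval I m e1 - aval I m e2"

primrec ecost :: "expr \<Rightarrow> nat" where
  "ecost (Const v) = 1"
| "ecost (Cell a e) = 1 + ecost e"
| "ecost (Input e) = 1 + ecost e"
| "ecost (Plus e1 e2) = 1 + ecost e1 + ecost e2"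
| "ecost (Minus e1 e2) = 1 + ecost e1 + ecost e2"

definition upd :: "mem \<Rightarrow> string \<Rightarrow> nat \<Rightarrow> nat \<Rightarrow> mem" where
  "upd m a i v = m(a := (m a)(i := v))"

text \<open>An oracle returns its answer together with the time charged for the call.\<close>

type_synonym oracle_fun = "nat set \<Rightarrow> bool \<times> nat"

text \<open>
  A configuration consists of the commands still to be executed, the memory, the time
  used so far and the number of oracle calls made so far.
\<close>

datatype config = Config (todo: "com list") (memory: mem) (clock: nat) (calls: nat)

text \<open>
  The time of an oracle call includes the time \<open>usize I\<close> for passing the characteristic
  array.
\<close>

fun step :: "oracle_fun \<Rightarrow> inst \<Rightarrow> config \<Rightarrow> config pmf" where
  "step orc I (Config [] m t q) = return_pmf (Config [] m t q)"
| "step orc I (Config (Skip # cs) m t q) = return_pmf (Config cs m (t + 1) q)"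
| "step orc I (Config (Assign a e1 e2 # cs) m t q) =
     return_pmf (Config cs (upd m a (aval I m e1) (aval I m e2))
                   (t + 1 + ecost e1 + ecost e2) q)"
| "step orc I (Config (Flip x # cs) m t q) =
     map_pmf (\<lambda>b. Config cs (upd m x 0 (of_bool b)) (t + 1) q) (bernoulli_pmf (1 / 2))"
| "step orc I (Config (Query x a # cs) m t q) =
     (let (b, s) = orc {i \<in> universe I. m a i \<noteq> 0}
      in return_pmf (Config cs (upd m x 0 (of_bool b)) (t + 1 + usize I + s) (q + 1)))"
| "step orc I (Config (Seq c1 c2 # cs) m t q) =
     return_pmf (Config (c1 # c2 # cs) m (t + 1) q)"
| "step orc I (Config (If e c1 c2 # cs) m t q) =
     return_pmf (Config ((if aval I m e \<noteq> 0 then c1 else c2) # cs) m (t + 1 + ecost e) q)"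
| "step orc I (Config (While e c # cs) m t q) =
     return_pmf (Config (if aval I m e \<noteq> 0 then c # While e c # cs else cs) m
                   (t + 1 + ecost e) q)"

primrec steps :: "oracle_fun \<Rightarrow> inst \<Rightarrow> nat \<Rightarrow> config \<Rightarrow> config pmf" where
  "steps orc I 0 c = return_pmf c"
| "steps orc I (Suc r) c = bind_pmf (step orc I c) (steps orc I r)"

definition init :: "inst \<Rightarrow> nat set \<Rightarrow> mem" where
  "init I X = (\<lambda>a i.
     if a = ''n'' \<and> i = 0 then usize I
     else if a = ''k'' \<and> i = 0 then param I
     else if a = ''X'' \<and> i \<in> X then 1
     else 0)"

definition run :: "oracle_fun \<Rightarrow> inst \<Rightarrow> nat set \<Rightarrow> com \<Rightarrow> nat \<Rightarrow> config pmf" where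
  "run orc I X c r = steps orc I r (Config [c] (init I X) 0 0)"


section \<open>Deterministic algorithms\<close>

primrec deterministic :: "com \<Rightarrow> bool" where
  "deterministic Skip = True"
| "deterministic (Assign a e1 e2) = True"
| "deterministic (Flip x) = False"
| "deterministic (Query x a) = False"
| "deterministic (Seq c1 c2) = (deterministic c1 \<and> deterministic c2)"
| "deterministic (If e c1 c2) = (deterministic c1 \<and> deterministic c2)"
| "deterministic (While e c) = deterministic c"

text \<open>
  On input \<open>(I, X)\<close> the program \<open>c\<close> halts with output \<open>v\<close> after time \<open>t\<close>.  It is used for
  deterministic (hence query-free) programs only, so the oracle is irrelevant.
\<close>

definition computes :: "com \<Rightarrow> inst \<Rightarrow> nat set \<Rightarrow> nat \<Rightarrow> nat \<Rightarrow> bool" where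
  "computes c I X v t \<longleftrightarrow>
     (\<exists>r m q. run (\<lambda>_. (False, 0)) I X c r = return_pmf (Config [] m t q) \<and> m ''out'' 0 = v)"

definition computable :: "(nat \<Rightarrow> nat) \<Rightarrow> bool" where
  "computable g \<longleftrightarrow>
     (\<exists>c. deterministic c \<and>
        (\<forall>k. \<exists>t. computes c \<lparr>usize = 0, param = k, data = []\<rparr> {} (g k) t))"

text \<open>
  \<open>D\<close> solves the decision version of \<open>P\<close> in time \<open>g k * n ^ d\<close>.  For \<open>n \<ge> 2\<close> a constant
  factor can be absorbed into the exponent, so ranging over \<open>d\<close> expresses a bound
  \<open>g(k) n^O(1)\<close>.
\<close>

definition solves_decision :: "problem \<Rightarrow> com \<Rightarrow> (nat \<Rightarrow> nat) \<Rightarrow> nat \<Rightarrow> bool" where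
  "solves_decision P D g d \<longleftrightarrow>
     deterministic D \<and>
     (\<forall>I\<in>instances P. \<forall>X. X \<subseteq> universe I \<longrightarrow>
        (\<exists>t. computes D I X (of_bool (decision P I X)) t \<and>
             (2 \<le> usize I \<longrightarrow> t \<le> g (param I) * usize I ^ d)))"


section \<open>Oracles\<close>

definition decision_oracle :: "problem \<Rightarrow> inst \<Rightarrow> oracle_fun" where
  "decision_oracle P I = (\<lambda>X. (decision P I X, 0))"

text \<open>
  Oracle calls carried out by running the deterministic program \<open>D\<close> as a subroutine with
  its own memory: each call returns the answer of \<open>D\<close> and is charged the running time of
  \<open>D\<close> on that call.
\<close>

definition subroutine :: "com \<Rightarrow> inst \<Rightarrow> oracle_fun" where
  "subroutine D I = (\<lambda>X. THE p. \<exists>v t. computes D I X v t \<and> p = (v \<noteq> 0, t))"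


section \<open>Outputs, oracle calls and expected time of randomised algorithms\<close>

datatype answer = Exactly nat | MoreThanM

definition answer_of :: "mem \<Rightarrow> answer" where
  "answer_of m = (if m ''more'' 0 \<noteq> 0 then MoreThanM else Exactly (m ''out'' 0))"

definition halted_with :: "answer \<Rightarrow> config set" where
  "halted_with v = {c. todo c = [] \<and> answer_of (memory c) = v}"

definition calls_at_most :: "oracle_fun \<Rightarrow> inst \<Rightarrow> com \<Rightarrow> real \<Rightarrow> bool" where
  "calls_at_most orc I c B \<longleftrightarrow>
     (\<forall>r. \<forall>s\<in>set_pmf (run orc I (universe I) c r). real (calls s) \<le> B)"

text \<open>
  Halted configurations do not change any more and the clock never decreases, so the
  suprema in the following definitions are limits of increasing sequences.  In
  particular \<open>expected_time\<close> is the expectation of the total running time, which is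
  infinite on diverging runs.
\<close>

definition output_prob :: "oracle_fun \<Rightarrow> inst \<Rightarrow> com \<Rightarrow> answer \<Rightarrow> real" where
  "output_prob orc I c v =
     (SUP r. measure_pmf.prob (run orc I (universe I) c r) (halted_with v))"

definition expected_time :: "oracle_fun \<Rightarrow> inst \<Rightarrow> com \<Rightarrow> ennreal" where
  "expected_time orc I c =
     (SUP r. \<integral>\<^sup>+ s. of_nat (clock s) \<partial>measure_pmf (run orc I (universe I) c r))"

text \<open>
  Every run halts with output \<open>v\<close>, whatever the outcomes of the coin flips.  As the tree
  of runs is binary branching, this is the same as a common bound \<open>r\<close> on their lengths.
\<close>

definition always_outputs :: "oracle_fun \<Rightarrow> inst \<Rightarrow> com \<Rightarrow> answer \<Rightarrow> bool" where
  "always_outputs orc I c v \<longleftrightarrow>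
     (\<exists>r. set_pmf (run orc I (universe I) c r) \<subseteq> halted_with v)"

end

theory Submission
  imports Defs
begin

text \<open>
  Give every element an independent uniform code of \<open>T = 2 l + 2\<close> bits, where \<open>2 ^ l \<ge> n\<close>.  A
  candidate at level \<open>t\<close> is a nondecreasing \<open>k\<close>-tuple of \<open>t\<close>-bit strings; it is kept if some witness is
  contained in the set of elements whose code prefix occurs in the tuple, which is one oracle call.
  Refining all coordinates by one bit at a time leads, if the codes are distinct, to exactly one
  surviving candidate per witness at level \<open>T\<close>, so a completed search gives the exact number.
  The prefixes of a witness are uniform, so it keeps a given tuple over \<open>N = 2 ^ t\<close> strings alive with
  probability at most \<open>(min k N / N) ^ k\<close>.  As there are at most \<open>(N + k) choose k\<close> tuples, the expected
  number of survivors per witness and level is at most \<open>8 ^ k\<close>.  By Markov's inequality a search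
  with a budget of \<open>O(T 16 ^ k M)\<close> calls succeeds with probability at least \<open>1/2\<close> when there are at most
  \<open>M\<close> witnesses; it is repeated about \<open>log 2 (1 / \<delta>)\<close> times.  A search that completes
  is never wrong, and if none does, the answer is ``More than M'', which is why
  that answer is certain when there are more than \<open>M\<close> witnesses.
\<close>

section \<open>Program logic\<close>

text \<open>The nondecreasing order is what keeps the base of the exponential constant. For
  \<open>N \<ge> k\<close> there are at most \<open>(2 * N) ^ k / fact k\<close> such tuples, and
  each covers a fixed witness with probability at most \<open>(k / N) ^ k\<close>; the division by
  \<open>fact k\<close> cancels \<open>k ^ k\<close> up to \<open>4 ^ k\<close>. Over all ordered
  tuples a factor \<open>k ^ k\<close> would remain, and each witness would be found
  \<open>fact k\<close> times. The oracle is consulted only when all coordinates have equal length.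
  The fewer than \<open>2 ^ k\<close> nodes from one such level up to the next turn
  \<open>8 ^ k\<close> into \<open>16 ^ k\<close>. A tree may be much larger than expected. Hence
  every search has a fixed budget, four times the bound on its expected length: all bounds on calls
  and time are worst-case bounds, and chance only decides whether an attempt completes. The failure
  probability splits into 1/4 for an exhausted budget and \<open>n * n / 2 ^ T \<le> 1/4\<close> for
  colliding codes, whence \<open>T = 2 * l + 2\<close>. The program detects both failures itself, so
  a wrong count is never accepted.\<close>

primrec mods :: "com \<Rightarrow> string set" where
  "mods Skip = {}"
| "mods (Assign a e1 e2) = {a}"
| "mods (Flip x) = {x}"
| "mods (Query x a) = {x}"
| "mods (Seq c1 c2) = mods c1 \<union> mods c2"
| "mods (If e c1 c2) = mods c1 \<union> mods c2"
| "mods (While e c) = mods c"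

context
  fixes orc :: oracle_fun and I :: inst
begin

text \<open>Unlike \<open>steps\<close>, this lets each branch of coin flips stop after its own
  number of steps, so that runs compose without a common length. \<open>leads_halted\<close> returns
  to a common length at the end.\<close>

inductive leads :: "config \<Rightarrow> config pmf \<Rightarrow> bool" where
  leads_refl: "leads C (return_pmf C)"
| leads_step: "(\<And>C'. C' \<in> set_pmf (step orc I C) \<Longrightarrow> leads C' (F C')) \<Longrightarrow>
    leads C (bind_pmf (step orc I C) F)"

lemma leads_trans:
  assumes "leads C p" "\<And>C'. C' \<in> set_pmf p \<Longrightarrow> leads C' (G C')"
  shows "leads C (bind_pmf p G)"
  using assms
proof (induction rule: leads.induct)
  case (leads_refl C)
  then show ?case by (simp add: bind_return_pmf)
next
  case (leads_step C F)
  then show ?case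
    by (auto simp: bind_assoc_pmf intro!: leads.leads_step)
qed

lemma leads_det_step:
  assumes "step orc I C = return_pmf C'" "leads C' p"
  shows "leads C p"
  using leads_step[of C "\<lambda>_. p"] assms by (simp add: bind_return_pmf)

lemma finite_set_pmf_step: "finite (set_pmf (step orc I C))"
  by (cases "(orc, I, C)" rule: step.cases) (auto split: prod.splits)

lemma steps_add: "steps orc I (r + s) C = bind_pmf (steps orc I r C) (steps orc I s)"
  by (induction r arbitrary: C) (auto simp: bind_return_pmf bind_assoc_pmf intro!: bind_pmf_cong)

lemma steps_halted:
  assumes "todo C = []"
  shows "steps orc I r C = return_pmf C"
proof -
  have "step orc I C = return_pmf C" using assms by (cases C) auto
  then show ?thesis by (induction r) (auto simp: bind_return_pmf)
qed

text \<open>A step has finitely many outcomes, so the branch lengths have a maximum; shorter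
  branches are padded with idle steps, which leave halted configurations unchanged.\<close>

lemma leads_halted:
  assumes "leads C p" "\<And>C'. C' \<in> set_pmf p \<Longrightarrow> todo C' = []"
  shows "\<exists>r. steps orc I r C = p"
  using assms
proof (induction rule: leads.induct)
  case (leads_refl C)
  then show ?case by (intro exI[of _ 0]) simp
next
  case (leads_step C F)
  have "\<forall>C'\<in>set_pmf (step orc I C). \<exists>r. steps orc I r C' = F C'"
    using leads_step by (simp add: set_bind_pmf) blast
  then obtain r where r: "\<And>C'. C' \<in> set_pmf (step orc I C) \<Longrightarrow> steps orc I (r C') C' = F C'"
    by metis
  define R where "R = Max (r ` set_pmf (step orc I C))"
  have "steps orc I R C' = F C'" if C': "C' \<in> set_pmf (step orc I C)" for C'
  proof -
    have "r C' \<le> R" unfolding R_def using C' finite_set_pmf_step by auto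
    then have "steps orc I R C' = bind_pmf (F C') (steps orc I (R - r C'))"
      using steps_add[of "r C'" "R - r C'" C'] r[OF C'] by simp
    also have "\<dots> = bind_pmf (F C') return_pmf"
      using leads_step.prems C' by (intro bind_pmf_cong refl steps_halted) (auto simp: set_bind_pmf)
    finally show ?thesis by (simp add: bind_return_pmf')
  qed
  then have "steps orc I (Suc R) C = bind_pmf (step orc I C) F"
    by (auto intro!: bind_pmf_cong)
  then show ?case by blast
qed

lemma step_mono:
  assumes "C' \<in> set_pmf (step orc I C)"
  shows "clock C \<le> clock C' \<and> calls C \<le> calls C'"
  using assms by (cases "(orc, I, C)" rule: step.cases) (auto split: prod.splits)

lemma steps_mono:
  assumes "C' \<in> set_pmf (steps orc I r C)"
  shows "clock C \<le> clock C' \<and> calls C \<le> calls C'"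
  using assms
proof (induction r arbitrary: C)
  case (Suc r)
  then obtain C1 where "C1 \<in> set_pmf (step orc I C)" "C' \<in> set_pmf (steps orc I r C1)"
    by auto
  with Suc.IH step_mono show ?case by (meson le_trans)
qed auto

text \<open>Every intermediate configuration can be continued to one in the support of
  \<open>p\<close>, and clock and call counter only grow on the way.\<close>

lemma steps_bounded:
  assumes "steps orc I R C = p" "\<And>C'. C' \<in> set_pmf p \<Longrightarrow> todo C' = []"
    and "\<And>C'. C' \<in> set_pmf p \<Longrightarrow> clock C' \<le> T \<and> calls C' \<le> Q"
    and "C' \<in> set_pmf (steps orc I r C)"
  shows "clock C' \<le> T \<and> calls C' \<le> Q"
proof -
  have "steps orc I (R + r) C = bind_pmf p (steps orc I r)"
    using assms(1) by (simp add: steps_add)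
  also have "\<dots> = bind_pmf p return_pmf"
    using assms(2) by (intro bind_pmf_cong refl steps_halted) auto
  finally have "steps orc I (r + R) C = p" by (simp add: bind_return_pmf' add.commute)
  moreover obtain C'' where C'': "C'' \<in> set_pmf (steps orc I R C')"
    using set_pmf_not_empty by fast
  ultimately have "C'' \<in> set_pmf p" using assms(4) by (auto simp: steps_add)
  then show ?thesis using assms(3)[of C''] steps_mono[OF C''] by linarith
qed

text \<open>
  \<open>runs c m T Q p\<close>: executed in memory \<open>m\<close>, the command \<open>c\<close> terminates on all coin flips within time
  \<open>T\<close> and \<open>Q\<close> oracle calls, and \<open>p\<close> is the distribution of the final memory.
\<close>

definition runs :: "com \<Rightarrow> mem \<Rightarrow> nat \<Rightarrow> nat \<Rightarrow> mem pmf \<Rightarrow> bool" where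
  "runs c m T Q p \<longleftrightarrow>
     (\<forall>m'\<in>set_pmf p. \<forall>a. a \<notin> mods c \<longrightarrow> m' a = m a) \<and>
     (\<forall>cs t q. \<exists>p'. leads (Config (c # cs) m t q) p' \<and> map_pmf memory p' = p \<and>
        (\<forall>C\<in>set_pmf p'. todo C = cs \<and> clock C \<le> t + T \<and> calls C \<le> q + Q))"

lemma runs_weaken: "runs c m T Q p \<Longrightarrow> T \<le> T' \<Longrightarrow> Q \<le> Q' \<Longrightarrow> runs c m T' Q' p"
  unfolding runs_def by (meson add_left_mono le_trans)

lemma runs_frame: "runs c m T Q p \<Longrightarrow> m' \<in> set_pmf p \<Longrightarrow> a \<notin> mods c \<Longrightarrow> m' a = m a"
  unfolding runs_def by blast

lemma runs_det:
  assumes "\<And>cs t q. \<exists>t'\<le>t + T. \<exists>q'\<le>q + Q.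
      step orc I (Config (c # cs) m t q) = return_pmf (Config cs m' t' q')"
    and "\<And>a. a \<notin> mods c \<Longrightarrow> m' a = m a"
  shows "runs c m T Q (return_pmf m')"
  unfolding runs_def
proof (intro conjI allI ballI impI)
  fix cs t q
  obtain t' q' where "t' \<le> t + T" "q' \<le> q + Q"
    "step orc I (Config (c # cs) m t q) = return_pmf (Config cs m' t' q')"
    using assms(1) by blast
  then show "\<exists>p'. leads (Config (c # cs) m t q) p' \<and> map_pmf memory p' = return_pmf m' \<and>
      (\<forall>C\<in>set_pmf p'. todo C = cs \<and> clock C \<le> t + T \<and> calls C \<le> q + Q)"
    by (intro exI[of _ "return_pmf (Config cs m' t' q')"]) (auto intro: leads_det_step leads_refl)
qed (use assms(2) in auto)

lemma runs_skip: "runs Skip m 1 0 (return_pmf m)"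
  by (rule runs_det) auto

lemma runs_assign:
  "runs (Assign a e1 e2) m (1 + ecost e1 + ecost e2) 0
     (return_pmf (upd m a (aval I m e1) (aval I m e2)))"
  by (rule runs_det) (auto simp: upd_def)

lemma runs_query:
  assumes "orc {i \<in> universe I. m a i \<noteq> 0} = (b, s)"
  shows "runs (Query x a) m (1 + usize I + s) 1 (return_pmf (upd m x 0 (of_bool b)))"
  using assms by (intro runs_det) (auto simp: upd_def)

lemma runs_flip:
  "runs (Flip x) m 1 0 (map_pmf (\<lambda>b. upd m x 0 (of_bool b)) (bernoulli_pmf (1/2)))"
  unfolding runs_def
proof (intro conjI allI ballI impI)
  fix cs t q
  let ?p = "map_pmf (\<lambda>b. Config cs (upd m x 0 (of_bool b)) (t + 1) q) (bernoulli_pmf (1/2))"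
  have "leads (Config (Flip x # cs) m t q) (bind_pmf ?p return_pmf)"
    using leads_step[of "Config (Flip x # cs) m t q" return_pmf] leads_refl by simp
  then show "\<exists>p'. leads (Config (Flip x # cs) m t q) p' \<and>
      map_pmf memory p' = map_pmf (\<lambda>b. upd m x 0 (of_bool b)) (bernoulli_pmf (1/2)) \<and>
      (\<forall>C\<in>set_pmf p'. todo C = cs \<and> clock C \<le> t + 1 \<and> calls C \<le> q + 0)"
    by (intro exI[of _ ?p]) (auto simp: bind_return_pmf' map_pmf_comp)
qed (auto simp: upd_def)

text \<open>The common core of sequence, conditional and loop iteration: one bookkeeping step, then
  \<open>c1\<close>, then what remains of \<open>c\<close>. The remainder \<open>c2\<close> is a
  list because it is empty for a conditional and a single command otherwise.\<close>

lemma runs_compose: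
  assumes step: "\<And>cs t q. \<exists>t'\<le>t + T0.
      step orc I (Config (c # cs) m t q) = return_pmf (Config (c1 # c2 @ cs) m t' q)"
    and 1: "runs c1 m T1 Q1 p"
    and 2: "\<And>m1 cs t q. m1 \<in> set_pmf p \<Longrightarrow>
       \<exists>p'. leads (Config (c2 @ cs) m1 t q) p' \<and> map_pmf memory p' = F m1 \<and>
        (\<forall>C\<in>set_pmf p'. todo C = cs \<and> clock C \<le> t + T2 \<and> calls C \<le> q + Q2)"
    and mods: "mods c1 \<subseteq> mods c"
      "\<And>m1 m2 a. m1 \<in> set_pmf p \<Longrightarrow> m2 \<in> set_pmf (F m1) \<Longrightarrow> a \<notin> mods c \<Longrightarrow> m2 a = m1 a"
  shows "runs c m (T0 + T1 + T2) (Q1 + Q2) (bind_pmf p F)"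
  unfolding runs_def
proof (intro conjI allI ballI impI)
  fix m2 a assume "m2 \<in> set_pmf (bind_pmf p F)" "a \<notin> mods c"
  then show "m2 a = m a"
    using mods runs_frame[OF 1] by (auto simp: subset_eq)
next
  fix cs t q
  obtain t' where t': "t' \<le> t + T0"
    "step orc I (Config (c # cs) m t q) = return_pmf (Config (c1 # c2 @ cs) m t' q)"
    using step by blast
  obtain p1 where p1: "leads (Config (c1 # c2 @ cs) m t' q) p1" "map_pmf memory p1 = p"
    "\<And>C. C \<in> set_pmf p1 \<Longrightarrow> todo C = c2 @ cs \<and> clock C \<le> t' + T1 \<and> calls C \<le> q + Q1"
    using 1 unfolding runs_def by meson
  have "\<forall>C\<in>set_pmf p1. \<exists>p'. leads C p' \<and> map_pmf memory p' = F (memory C) \<and>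
      (\<forall>C'\<in>set_pmf p'. todo C' = cs \<and> clock C' \<le> clock C + T2 \<and> calls C' \<le> calls C + Q2)"
  proof
    fix C assume C: "C \<in> set_pmf p1"
    then have "memory C \<in> set_pmf p" using p1(2) by auto
    moreover have "C = Config (c2 @ cs) (memory C) (clock C) (calls C)"
      using p1(3)[OF C] by (cases C) auto
    ultimately show "\<exists>p'. leads C p' \<and> map_pmf memory p' = F (memory C) \<and>
      (\<forall>C'\<in>set_pmf p'. todo C' = cs \<and> clock C' \<le> clock C + T2 \<and> calls C' \<le> calls C + Q2)"
      using 2[of "memory C" cs "clock C" "calls C"] by metis
  qed
  then obtain G where G: "\<And>C. C \<in> set_pmf p1 \<Longrightarrow> leads C (G C) \<and> map_pmf memory (G C) = F (memory C) \<and>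
      (\<forall>C'\<in>set_pmf (G C). todo C' = cs \<and> clock C' \<le> clock C + T2 \<and> calls C' \<le> calls C + Q2)"
    by metis
  show "\<exists>p'. leads (Config (c # cs) m t q) p' \<and> map_pmf memory p' = bind_pmf p F \<and>
      (\<forall>C\<in>set_pmf p'. todo C = cs \<and> clock C \<le> t + (T0 + T1 + T2) \<and> calls C \<le> q + (Q1 + Q2))"
  proof (intro exI[of _ "bind_pmf p1 G"] conjI ballI)
    show "leads (Config (c # cs) m t q) (bind_pmf p1 G)"
      using t'(2) p1(1) G by (intro leads_det_step[OF t'(2)] leads_trans[OF p1(1)]) auto
    have "map_pmf memory (bind_pmf p1 G) = bind_pmf p1 (\<lambda>C. F (memory C))"
      unfolding map_bind_pmf using G by (intro bind_pmf_cong) auto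
    then show "map_pmf memory (bind_pmf p1 G) = bind_pmf p F"
      using p1(2) by (auto simp: bind_map_pmf)
  next
    fix C assume "C \<in> set_pmf (bind_pmf p1 G)"
    then obtain C1 where "C1 \<in> set_pmf p1" "C \<in> set_pmf (G C1)" by auto
    with p1(3)[of C1] G[of C1] t'(1)
    show "todo C = cs" "clock C \<le> t + (T0 + T1 + T2)" "calls C \<le> q + (Q1 + Q2)" by force+
  qed
qed

lemma runs_seq:
  assumes 1: "runs c1 m T1 Q1 p" and 2: "\<And>m1. m1 \<in> set_pmf p \<Longrightarrow> runs c2 m1 T2 Q2 (F m1)"
  shows "runs (Seq c1 c2) m (1 + T1 + T2) (Q1 + Q2) (bind_pmf p F)"
proof (rule runs_compose[OF _ 1, where ?c2.0 = "[c2]"])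
  show "\<exists>p'. leads (Config ([c2] @ cs) m1 t q) p' \<and> map_pmf memory p' = F m1 \<and>
        (\<forall>C\<in>set_pmf p'. todo C = cs \<and> clock C \<le> t + T2 \<and> calls C \<le> q + Q2)"
    if "m1 \<in> set_pmf p" for m1 cs t q
    using 2[OF that] unfolding runs_def by simp
qed (use runs_frame[OF 2] in auto)

lemma runs_if:
  assumes "runs (if aval I m e \<noteq> 0 then c1 else c2) m T Q p"
  shows "runs (If e c1 c2) m (1 + ecost e + T) Q p"
proof -
  have "runs (If e c1 c2) m (1 + ecost e + T + 0) (Q + 0) (bind_pmf p return_pmf)"
    by (rule runs_compose[OF _ assms, where ?c2.0 = "[]"])
      (auto intro!: exI[of _ "return_pmf _"] leads_refl)
  then show ?thesis by (simp add: bind_return_pmf')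
qed

lemma runs_while_end:
  assumes "aval I m e = 0"
  shows "runs (While e c) m (1 + ecost e) 0 (return_pmf m)"
  using assms by (intro runs_det) auto

lemma runs_while_step:
  assumes "aval I m e \<noteq> 0" and 1: "runs c m T1 Q1 p"
    and 2: "\<And>m1. m1 \<in> set_pmf p \<Longrightarrow> runs (While e c) m1 T2 Q2 (F m1)"
  shows "runs (While e c) m (1 + ecost e + T1 + T2) (Q1 + Q2) (bind_pmf p F)"
proof (rule runs_compose[OF _ 1, where ?c2.0 = "[While e c]"])
  show "\<exists>p'. leads (Config ([While e c] @ cs) m1 t q) p' \<and> map_pmf memory p' = F m1 \<and>
        (\<forall>C\<in>set_pmf p'. todo C = cs \<and> clock C \<le> t + T2 \<and> calls C \<le> q + Q2)"
    if "m1 \<in> set_pmf p" for m1 cs t q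
    using 2[OF that] unfolding runs_def by simp
qed (use assms runs_frame[OF 2] in auto)

lemma runs_final:
  assumes "runs c m T Q p"
  shows "\<forall>r. \<forall>s\<in>set_pmf (steps orc I r (Config [c] m 0 0)). clock s \<le> T \<and> calls s \<le> Q"
    and "\<exists>r. map_pmf memory (steps orc I r (Config [c] m 0 0)) = p \<and>
      (\<forall>s\<in>set_pmf (steps orc I r (Config [c] m 0 0)). todo s = [])"
proof -
  obtain p' where p': "leads (Config [c] m 0 0) p'" "map_pmf memory p' = p"
    "\<And>C. C \<in> set_pmf p' \<Longrightarrow> todo C = [] \<and> clock C \<le> T \<and> calls C \<le> Q"
    using assms unfolding runs_def by (metis add_0)
  then obtain r where r: "steps orc I r (Config [c] m 0 0) = p'"
    using leads_halted by blast
  show "\<forall>r. \<forall>s\<in>set_pmf (steps orc I r (Config [c] m 0 0)). clock s \<le> T \<and> calls s \<le> Q"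
    using steps_bounded[OF r] p'(3) by blast
  show "\<exists>r. map_pmf memory (steps orc I r (Config [c] m 0 0)) = p \<and>
      (\<forall>s\<in>set_pmf (steps orc I r (Config [c] m 0 0)). todo s = [])"
    using r p' by (intro exI[of _ r]) auto
qed

section \<open>Counted loops and the distributions they produce\<close>

primrec evars :: "expr \<Rightarrow> string set" where
  "evars (Const v) = {}"
| "evars (Cell a e) = insert a (evars e)"
| "evars (Input e) = evars e"
| "evars (Plus e1 e2) = evars e1 \<union> evars e2"
| "evars (Minus e1 e2) = evars e1 \<union> evars e2"

lemma aval_cong: "(\<And>a. a \<in> evars e \<Longrightarrow> m a = m' a) \<Longrightarrow> aval I m e = aval I m' e"
  by (induction e) auto

abbreviation Var :: "string \<Rightarrow> expr" where "Var x \<equiv> Cell x (Const 0)"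

abbreviation Set :: "string \<Rightarrow> expr \<Rightarrow> com" where "Set x e \<equiv> Assign x (Const 0) e"

text \<open>Truncated subtraction makes the guard nonzero exactly while the counter is below
  \<open>e\<close>.\<close>

definition For :: "string \<Rightarrow> expr \<Rightarrow> com \<Rightarrow> com" where
  "For x e c = Seq (Set x (Const 0))
     (While (Minus e (Var x)) (Seq c (Set x (Plus (Var x) (Const 1)))))"

lemma mods_For [simp]: "mods (For x e c) = insert x (mods c)"
  by (auto simp: For_def)

primrec floop :: "string \<Rightarrow> (nat \<Rightarrow> mem \<Rightarrow> mem pmf) \<Rightarrow> nat \<Rightarrow> nat \<Rightarrow> mem \<Rightarrow> mem pmf" where
  "floop x B 0 i m = return_pmf m"
| "floop x B (Suc j) i m = bind_pmf (B i m) (\<lambda>m'. floop x B j (Suc i) (upd m' x 0 (Suc i)))"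

text \<open>The definition peels off the first iteration, as the unrolling of \<open>While\<close>
  does. Inductions over the distribution built up so far have to peel off the last one
  instead.\<close>

lemma floop_Suc:
  "floop x B (Suc j) i m =
     bind_pmf (floop x B j i m) (\<lambda>m1. map_pmf (\<lambda>m2. upd m2 x 0 (Suc (i + j))) (B (i + j) m1))"
proof (induction j arbitrary: i m)
  case 0
  then show ?case by (simp add: bind_return_pmf map_pmf_def)
next
  case (Suc j)
  show ?case
    by (subst floop.simps(2), subst Suc.IH, simp add: bind_assoc_pmf)
qed

lemma upd_apply: "upd m a i v b j = (if a = b \<and> i = j then v else m b j)"
  by (auto simp: upd_def)

lemma upd_other [simp]: "a \<noteq> b \<Longrightarrow> upd m a i v b = m b"
  by (auto simp: upd_def)

text \<open>The bound keeps its value \<open>L\<close> because the body writes neither the counter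
  nor a variable of \<open>e\<close>. Per iteration, \<open>ecost e + 4\<close> pays for the guard
  and 7 for sequencing and increment; \<open>ecost e + 8\<close> pays for the initialisation and the
  last, failing guard.\<close>

lemma runs_For:
  assumes vars: "evars e \<inter> insert x (mods c) = {}" "x \<notin> mods c" and L: "aval I m e = L"
    and 0: "Inv 0 (upd m x 0 0)"
    and body: "\<And>i m1. i < L \<Longrightarrow> Inv i m1 \<Longrightarrow> m1 x 0 = i \<Longrightarrow>
      (\<And>a. a \<notin> insert x (mods c) \<Longrightarrow> m1 a = m a) \<Longrightarrow>
      runs c m1 Tb Qb (B i m1) \<and> (\<forall>m2\<in>set_pmf (B i m1). Inv (Suc i) (upd m2 x 0 (Suc i)))"
  shows "runs (For x e c) m (L * (Tb + ecost e + 11) + ecost e + 8) (L * Qb)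
           (floop x B L 0 (upd m x 0 0))" (is "runs _ _ _ _ ?p")
    and "\<And>i m'. i \<le> L \<Longrightarrow> m' \<in> set_pmf (floop x B i 0 (upd m x 0 0)) \<Longrightarrow>
      Inv i m' \<and> m' x 0 = i \<and> (\<forall>a. a \<notin> insert x (mods c) \<longrightarrow> m' a = m a)"
proof -
  let ?fr = "\<lambda>m1. \<forall>a. a \<notin> insert x (mods c) \<longrightarrow> m1 a = m a"
  let ?J = "\<lambda>i m1. Inv i m1 \<and> m1 x 0 = i \<and> ?fr m1"
  let ?w = "While (Minus e (Var x)) (Seq c (Set x (Plus (Var x) (Const 1))))"
  have body': "runs c m1 Tb Qb (B i m1)" "\<And>m2. m2 \<in> set_pmf (B i m1) \<Longrightarrow> ?J (Suc i) (upd m2 x 0 (Suc i)) \<and> m2 x 0 = i"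
    if "i < L" "?J i m1" for i m1
  proof -
    show r: "runs c m1 Tb Qb (B i m1)" using body that by blast
    show "?J (Suc i) (upd m2 x 0 (Suc i)) \<and> m2 x 0 = i" if "m2 \<in> set_pmf (B i m1)" for m2
    proof -
      have "m2 a = m1 a" if "a \<notin> mods c" for a using runs_frame[OF r \<open>m2 \<in> _\<close> that] .
      then show ?thesis using body[of i m1] \<open>i < L\<close> \<open>?J i m1\<close> that vars by (auto simp: upd_apply)
    qed
  qed
  have eL: "aval I m1 e = L" if "?fr m1" for m1
    using aval_cong[of e m1 m] that vars L by blast
  have J: "?J (i + j) m'"
    if "m' \<in> set_pmf (floop x B j i m1)" "i + j \<le> L" "?J i m1" for i j m1 m'
    using that
  proof (induction j arbitrary: i m1)
    case (Suc j)
    then obtain m2 where m2: "m2 \<in> set_pmf (B i m1)"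
      "m' \<in> set_pmf (floop x B j (Suc i) (upd m2 x 0 (Suc i)))" by auto
    then have "?J (Suc i) (upd m2 x 0 (Suc i))" using body'[of i m1] Suc.prems by auto
    from Suc.IH[OF m2(2) _ this] Suc.prems show ?case by simp
  qed auto
  have W: "runs ?w m1 (j * (Tb + ecost e + 11) + ecost e + 4) (j * Qb) (floop x B j i m1)"
    if "i + j = L" "?J i m1" for i j m1
    using that
  proof (induction j arbitrary: i m1)
    case 0
    then have "aval I m1 (Minus e (Var x)) = 0" using eL by simp
    from runs_while_end[OF this] show ?case by (simp add: eval_nat_numeral)
  next
    case (Suc j)
    then have iL: "i < L" by simp
    have "runs (Set x (Plus (Var x) (Const 1))) m2 6 0 (return_pmf (upd m2 x 0 (Suc i)))"
      if "m2 \<in> set_pmf (B i m1)" for m2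
      using runs_assign[of x "Const 0" "Plus (Var x) (Const 1)" m2] body'(2)[OF iL Suc.prems(2) that]
      by (simp add: eval_nat_numeral)
    from runs_seq[OF body'(1)[OF iL Suc.prems(2)] this]
    have 1: "runs (Seq c (Set x (Plus (Var x) (Const 1)))) m1 (Tb + 7) Qb
        (map_pmf (\<lambda>m2. upd m2 x 0 (Suc i)) (B i m1))"
      by (simp add: map_pmf_def add.commute add.left_commute)
    have g: "aval I m1 (Minus e (Var x)) \<noteq> 0" using eL Suc.prems iL by simp
    have "runs ?w m1 (1 + ecost (Minus e (Var x)) + (Tb + 7) + (j * (Tb + ecost e + 11) + ecost e + 4))
       (Qb + j * Qb) (bind_pmf (map_pmf (\<lambda>m2. upd m2 x 0 (Suc i)) (B i m1)) (floop x B j (Suc i)))"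
    proof (rule runs_while_step[OF g 1])
      fix m' assume "m' \<in> set_pmf (map_pmf (\<lambda>m2. upd m2 x 0 (Suc i)) (B i m1))"
      then obtain m2 where "m2 \<in> set_pmf (B i m1)" "m' = upd m2 x 0 (Suc i)" by auto
      then show "runs ?w m' (j * (Tb + ecost e + 11) + ecost e + 4) (j * Qb) (floop x B j (Suc i) m')"
        using Suc.prems body'(2)[OF iL Suc.prems(2)] by (intro Suc.IH) auto
    qed
    then show ?case by (simp add: bind_map_pmf algebra_simps)
  qed
  have J0: "?J 0 (upd m x 0 0)" using 0 by (auto simp: upd_apply)
  have "runs (Set x (Const 0)) m 3 0 (return_pmf (upd m x 0 0))"
    using runs_assign[of x "Const 0" "Const 0" m] by (simp add: eval_nat_numeral)
  then have "runs (For x e c) m (1 + 3 + (L * (Tb + ecost e + 11) + ecost e + 4)) (0 + L * Qb)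
      (bind_pmf (return_pmf (upd m x 0 0)) (floop x B L 0))"
    unfolding For_def by (rule runs_seq) (use W[of 0 L, OF _ J0] in simp)
  then show "runs (For x e c) m (L * (Tb + ecost e + 11) + ecost e + 8) (L * Qb) ?p"
    by (simp add: bind_return_pmf algebra_simps)
  show "Inv i m' \<and> m' x 0 = i \<and> ?fr m'"
    if "i \<le> L" "m' \<in> set_pmf (floop x B i 0 (upd m x 0 0))" for i m'
    using J[OF that(2) _ J0] that by auto
qed

text \<open>Commands whose result involves no chance end in a point mass, for which a postcondition
  on the single final memory composes more easily than a distribution.\<close>

definition wp :: "com \<Rightarrow> (mem \<Rightarrow> bool) \<Rightarrow> nat \<Rightarrow> nat \<Rightarrow> mem \<Rightarrow> bool" where
  "wp c Post T Q m \<longleftrightarrow> (\<exists>m'. runs c m T Q (return_pmf m') \<and> Post m')"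

lemma wp_weaken: "wp c Post T Q m \<Longrightarrow> T \<le> T' \<Longrightarrow> Q \<le> Q' \<Longrightarrow> wp c Post T' Q' m"
  unfolding wp_def using runs_weaken by blast

lemma wp_frame:
  assumes "wp c Post T Q m" "\<And>m'. Post m' \<Longrightarrow> (\<And>a. a \<notin> mods c \<Longrightarrow> m' a = m a) \<Longrightarrow> Post' m'"
  shows "wp c Post' T Q m"
  using assms runs_frame unfolding wp_def by (metis set_return_pmf singletonI)

lemma wp_seq:
  assumes "wp c1 (wp c2 Post T2 Q2) T1 Q1 m"
  shows "wp (Seq c1 c2) Post (1 + T1 + T2) (Q1 + Q2) m"
proof -
  obtain m1 m2 where "runs c1 m T1 Q1 (return_pmf m1)" "runs c2 m1 T2 Q2 (return_pmf m2)" "Post m2"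
    using assms unfolding wp_def by blast
  with runs_seq[of c1 m T1 Q1 "return_pmf m1" c2 T2 Q2 "\<lambda>_. return_pmf m2"] show ?thesis
    unfolding wp_def by (auto simp: bind_return_pmf)
qed

lemma wp_if:
  assumes "aval I m e \<noteq> 0 \<Longrightarrow> wp c1 Post T1 Q1 m" "aval I m e = 0 \<Longrightarrow> wp c2 Post T2 Q2 m"
  shows "wp (If e c1 c2) Post (1 + ecost e + T1 + T2) (Q1 + Q2) m"
proof -
  have "wp (if aval I m e \<noteq> 0 then c1 else c2) Post (T1 + T2) (Q1 + Q2) m"
    using assms by (auto intro: wp_weaken)
  then show ?thesis
    using runs_if[of m e c1 c2 "T1 + T2" "Q1 + Q2"] unfolding wp_def by (auto simp: add.assoc)
qed

lemma wp_For:
  assumes vars: "evars e \<inter> insert x (mods c) = {}" "x \<notin> mods c" and L: "aval I m e = L"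
    and 0: "Inv 0 (upd m x 0 0)"
    and body: "\<And>i m1. i < L \<Longrightarrow> Inv i m1 \<Longrightarrow> m1 x 0 = i \<Longrightarrow>
      (\<And>a. a \<notin> insert x (mods c) \<Longrightarrow> m1 a = m a) \<Longrightarrow>
      wp c (\<lambda>m2. Inv (Suc i) (upd m2 x 0 (Suc i))) Tb Qb m1"
    and post: "\<And>m1. Inv L m1 \<Longrightarrow> m1 x 0 = L \<Longrightarrow>
      (\<And>a. a \<notin> insert x (mods c) \<Longrightarrow> m1 a = m a) \<Longrightarrow> Post m1"
  shows "wp (For x e c) Post (L * (Tb + ecost e + 11) + ecost e + 8) (L * Qb) m"
proof -
  \<comment> \<open>The body is only known to have some final memory from each state satisfying the
    invariant; choosing one makes it a function that \<open>floop\<close> can iterate.\<close>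
  define f where "f i m1 = (SOME m2. runs c m1 Tb Qb (return_pmf m2) \<and> Inv (Suc i) (upd m2 x 0 (Suc i)))" for i m1
  have f: "runs c m1 Tb Qb (return_pmf (f i m1)) \<and> Inv (Suc i) (upd (f i m1) x 0 (Suc i))"
    if "i < L" "Inv i m1" "m1 x 0 = i" "\<And>a. a \<notin> insert x (mods c) \<Longrightarrow> m1 a = m a" for i m1
    using body[OF that] unfolding wp_def f_def by (rule someI_ex)
  note R = runs_For[where B = "\<lambda>i m. return_pmf (f i m)" and Inv = Inv, OF vars L 0]
  have "\<exists>m'. floop x (\<lambda>i m. return_pmf (f i m)) j i m1 = return_pmf m'" for j i m1
    by (induction j arbitrary: i m1) (auto simp: bind_return_pmf)
  then obtain m' where m': "floop x (\<lambda>i m. return_pmf (f i m)) L 0 (upd m x 0 0) = return_pmf m'"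
    by blast
  have "runs (For x e c) m (L * (Tb + ecost e + 11) + ecost e + 8) (L * Qb) (return_pmf m')"
    unfolding m'[symmetric] by (rule R(1)) (use f in auto)
  moreover have "Inv L m' \<and> m' x 0 = L \<and> (\<forall>a. a \<notin> insert x (mods c) \<longrightarrow> m' a = m a)"
    by (rule R(2)) (use f m' in auto)
  ultimately show ?thesis using post unfolding wp_def by blast
qed

primrec straight :: "com \<Rightarrow> bool" where
  "straight Skip = True"
| "straight (Assign a e1 e2) = True"
| "straight (Flip x) = False"
| "straight (Query x a) = False"
| "straight (Seq c1 c2) = (straight c1 \<and> straight c2)"
| "straight (If e c1 c2) = (straight c1 \<and> straight c2)"
| "straight (While e c) = False"

primrec ev :: "com \<Rightarrow> mem \<Rightarrow> mem" where
  "ev Skip m = m"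
| "ev (Assign a e1 e2) m = upd m a (aval I m e1) (aval I m e2)"
| "ev (Flip x) m = m"
| "ev (Query x a) m = m"
| "ev (Seq c1 c2) m = ev c2 (ev c1 m)"
| "ev (If e c1 c2) m = (if aval I m e \<noteq> 0 then ev c1 m else ev c2 m)"
| "ev (While e c) m = m"

text \<open>Both branches of a conditional are added up, so that the bound depends on the program
  text alone and not on the memory.\<close>

primrec scost :: "com \<Rightarrow> nat" where
  "scost Skip = 1"
| "scost (Assign a e1 e2) = 1 + ecost e1 + ecost e2"
| "scost (Flip x) = 1"
| "scost (Query x a) = 1"
| "scost (Seq c1 c2) = 1 + scost c1 + scost c2"
| "scost (If e c1 c2) = 1 + ecost e + scost c1 + scost c2"
| "scost (While e c) = 1"

lemma runs_straight: "straight c \<Longrightarrow> runs c m (scost c) 0 (return_pmf (ev c m))"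
proof (induction c arbitrary: m)
  case Skip
  show ?case using runs_skip by simp
next
  case (Assign a e1 e2)
  show ?case using runs_assign by simp
next
  case (Seq c1 c2)
  then have "runs (Seq c1 c2) m (1 + scost c1 + scost c2) (0 + 0)
      (bind_pmf (return_pmf (ev c1 m)) (\<lambda>m. return_pmf (ev c2 m)))"
    by (intro runs_seq) auto
  then show ?case by (simp add: bind_return_pmf)
next
  case (If e c1 c2)
  have "runs c1 m (scost c1 + scost c2) 0 (return_pmf (ev c1 m))"
    by (rule runs_weaken[OF If.IH(1)]) (use If.prems in auto)
  moreover have "runs c2 m (scost c1 + scost c2) 0 (return_pmf (ev c2 m))"
    by (rule runs_weaken[OF If.IH(2)]) (use If.prems in auto)
  ultimately have "runs (If e c1 c2) m (1 + ecost e + (scost c1 + scost c2)) 0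
      (return_pmf (ev (If e c1 c2) m))"
    by (intro runs_if) auto
  then show ?case by (simp add: add.assoc)
qed auto

lemma wp_straight: "straight c \<Longrightarrow> Post (ev c m) \<Longrightarrow> wp c Post (scost c) 0 m"
  using runs_straight unfolding wp_def by blast

end

section \<open>Depth-first search of a pruned binary tree\<close>

text \<open>
  A node is the list of branching bits on the path to it, the last one first.  The Boolean
  component of a search state says that the subtree of the current node is finished.
\<close>

context
  fixes yes :: "bool list \<Rightarrow> bool"
begin

text \<open>The path itself serves as the stack: a finished left child is replaced by its sibling, a
  finished right child is popped. The finished root is a fixed point, so surplus steps are
  harmless.\<close>

fun dfs :: "nat \<Rightarrow> bool list \<times> bool \<times> nat \<Rightarrow> bool list \<times> bool \<times> nat" where
  "dfs D ([], True, q) = ([], True, q)"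
| "dfs D (True # rs, True, q) = (rs, True, q)"
| "dfs D (False # rs, True, q) = (True # rs, False, q)"
| "dfs D (rs, False, q) =
     (if yes rs then if length rs < D then (False # rs, False, q) else (rs, True, Suc q)
      else (rs, True, q))"

text \<open>The number of \<open>dfs\<close> steps spent on a subtree of height \<open>h\<close>;
  the 3 counts the descent, the switch to the right child and the final return.\<close>

primrec tsize :: "nat \<Rightarrow> bool list \<Rightarrow> nat" where
  "tsize 0 rs = 1"
| "tsize (Suc h) rs = (if yes rs then 3 + tsize h (False # rs) + tsize h (True # rs) else 1)"

text \<open>Since the last bit comes first, dropping leading bits moves to an ancestor. Demanding
  \<open>yes\<close> of all ancestors down from \<open>rs\<close> singles out the nodes that the
  pruned search really reaches and does not cut off.\<close>

definition alive :: "nat \<Rightarrow> bool list \<Rightarrow> bool list set" where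
  "alive j rs = {w. length w = j \<and> (\<forall>i\<le>j. yes (drop i w @ rs))}"

lemma finite_alive: "finite (alive j rs)"
proof (rule finite_subset)
  show "alive j rs \<subseteq> {w. set w \<subseteq> UNIV \<and> length w = j}" by (auto simp: alive_def)
qed (rule finite_lists_length_eq, simp)

lemma alive_0: "alive 0 rs = (if yes rs then {[]} else {})"
  by (auto simp: alive_def)

lemma alive_Suc:
  "alive (Suc j) rs = (if yes rs then (\<lambda>w. w @ [False]) ` alive j (False # rs) \<union>
     (\<lambda>w. w @ [True]) ` alive j (True # rs) else {})" (is "_ = ?R")
proof -
  have iff: "w @ [b] \<in> alive (Suc j) rs \<longleftrightarrow> yes rs \<and> w \<in> alive j (b # rs)" for w b
    by (auto simp: alive_def le_Suc_eq)
  show ?thesis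
  proof (rule set_eqI)
    fix v
    show "v \<in> alive (Suc j) rs \<longleftrightarrow> v \<in> ?R"
    proof (cases v rule: rev_cases)
      case Nil
      then show ?thesis by (auto simp: alive_def)
    next
      case (snoc w b)
      then show ?thesis using iff[of w b] by (cases b) auto
    qed
  qed
qed

lemma card_alive_Suc:
  "card (alive (Suc j) rs) =
     (if yes rs then card (alive j (False # rs)) + card (alive j (True # rs)) else 0)"
proof -
  have "card ((\<lambda>w. w @ [False]) ` alive j (False # rs) \<union> (\<lambda>w. w @ [True]) ` alive j (True # rs)) =
      card ((\<lambda>w. w @ [False]) ` alive j (False # rs)) + card ((\<lambda>w. w @ [True]) ` alive j (True # rs))"
    by (intro card_Un_disjoint) (auto simp: finite_alive)
  then show ?thesis by (auto simp: alive_Suc card_image inj_on_def)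
qed

lemma dfs_tsize:
  assumes "length rs + h = D"
  shows "(dfs D ^^ tsize h rs) (rs, False, q) = (rs, True, q + card (alive h rs))"
  using assms
proof (induction h arbitrary: rs q)
  case 0
  then show ?case by (simp add: alive_0)
next
  case (Suc h)
  show ?case
  proof (cases "yes rs")
    case True
    let ?a = "tsize h (False # rs)" and ?b = "tsize h (True # rs)"
    have split: "(dfs D ^^ (3 + ?a + ?b)) s =
        dfs D ((dfs D ^^ ?b) (dfs D ((dfs D ^^ ?a) (dfs D s))))" for s
    proof -
      have "3 + ?a + ?b = Suc (?b + Suc (?a + Suc 0))" by simp
      then show ?thesis by (simp only: funpow_add funpow.simps o_def id_def)
    qed
    show ?thesis using True Suc.prems Suc.IH[of "False # rs"] Suc.IH[of "True # rs"]
      by (simp add: split card_alive_Suc del: funpow.simps)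
  next
    case False
    then show ?thesis by (simp add: card_alive_Suc)
  qed
qed

lemma dfs_done: "(dfs D ^^ j) ([], True, q) = ([], True, q)"
  by (induction j) auto

lemma dfs_complete:
  assumes "tsize D [] \<le> B"
  shows "(dfs D ^^ B) ([], False, 0) = ([], True, card (alive D []))"
proof -
  have "(dfs D ^^ ((B - tsize D []) + tsize D [])) ([], False, 0) = ([], True, card (alive D []))"
    unfolding funpow_add using dfs_tsize[of "[]" D D 0] by (simp add: dfs_done)
  with assms show ?thesis by simp
qed

lemma dfs_sound:
  assumes "(dfs D ^^ B) ([], False, 0) = ([], True, q)"
  shows "q = card (alive D [])"
proof -
  have "(dfs D ^^ (tsize D [] + B)) ([], False, 0) = ([], True, q)"
    unfolding funpow_add using assms by (simp add: dfs_done)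
  then show ?thesis using dfs_complete[of D "tsize D [] + B"] by simp
qed

text \<open>Opening an alive node above the bottom level replaces its single step by three steps
  plus one for each child, a gain of 4.\<close>

lemma tsize_le: "tsize h rs \<le> 1 + 4 * (\<Sum>j<h. card (alive j rs))"
proof (induction h arbitrary: rs)
  case (Suc h)
  have "(\<Sum>j<Suc h. card (alive j rs)) = (if yes rs then 1 + (\<Sum>j<h. card (alive j (False # rs))) +
      (\<Sum>j<h. card (alive j (True # rs))) else 0)"
    by (subst sum.lessThan_Suc_shift) (simp add: card_alive_Suc alive_0 sum.distrib del: sum.lessThan_Suc)
  with Suc[of "False # rs"] Suc[of "True # rs"] show ?case by simp
qed simp

lemma card_alive_add: "card (alive (a + i) []) \<le> 2 ^ i * card (alive a [])"
proof -
  let ?L = "{x::bool list. length x = i}"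
  have L: "finite ?L" "card ?L = 2 ^ i"
    using finite_lists_length_eq[of "UNIV :: bool set" i] card_lists_length_eq[of "UNIV :: bool set" i]
    by auto
  have sub: "alive (a + i) [] \<subseteq> (\<lambda>(x, y). x @ y) ` (?L \<times> alive a [])"
  proof
    fix w assume w: "w \<in> alive (a + i) []"
    have "drop i w \<in> alive a []"
      unfolding alive_def
    proof safe
      show "length (drop i w) = a" using w by (simp add: alive_def)
      show "yes (drop j (drop i w) @ [])" if "j \<le> a" for j
        using w that by (auto simp: alive_def dest!: spec[of _ "j + i"])
    qed
    moreover have "take i w \<in> ?L" using w by (simp add: alive_def)
    ultimately show "w \<in> (\<lambda>(x, y). x @ y) ` (?L \<times> alive a [])"
      by (intro image_eqI[of _ _ "(take i w, drop i w)"]) auto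
  qed
  have "card (alive (a + i) []) \<le> card (?L \<times> alive a [])"
    by (rule surj_card_le[OF _ sub]) (simp add: L finite_alive)
  then show ?thesis by (simp add: card_cartesian_product L)
qed

text \<open>Each alive node is charged to its ancestor at the last depth divisible by
  \<open>k\<close>; an ancestor is charged at most \<open>1 + 2 + ... + 2 ^ (k - 1) < 2 ^ k\<close>
  times.\<close>

lemma tsize_blocks:
  "tsize (T * k) [] \<le> 1 + 4 * (2 ^ k * (\<Sum>t<T. card (alive (t * k) [])))"
proof -
  have "(\<Sum>j<T * k. card (alive j [])) \<le> 2 ^ k * (\<Sum>t<T. card (alive (t * k) []))"
  proof (induction T)
    case (Suc T)
    have "{..<Suc T * k} = {..<T * k} \<union> {T * k..<T * k + k}" by auto
    then have "(\<Sum>j<Suc T * k. card (alive j [])) =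
        (\<Sum>j<T * k. card (alive j [])) + (\<Sum>j=T * k..<T * k + k. card (alive j []))"
      by (simp add: sum.union_disjoint ivl_disj_int)
    also have "(\<Sum>j=T * k..<T * k + k. card (alive j [])) = (\<Sum>i<k. card (alive (T * k + i) []))"
      using sum.shift_bounds_nat_ivl[of "\<lambda>j. card (alive j [])" 0 "T * k" k]
      by (simp add: atLeast0LessThan add.commute)
    also have "\<dots> \<le> (\<Sum>i<k. 2 ^ i * card (alive (T * k) []))"
      by (intro sum_mono card_alive_add)
    also have "\<dots> = (2 ^ k - 1) * card (alive (T * k) [])"
      by (simp add: sum_distrib_right[symmetric] sum_power2 lessThan_atLeast0)
    also have "\<dots> \<le> 2 ^ k * card (alive (T * k) [])" by simp
    finally show ?case using Suc by (simp add: algebra_simps)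
  qed simp
  with tsize_le[of "T * k" "[]"] show ?thesis by linarith
qed

end


section \<open>Candidate tuples\<close>

text \<open>
  The branching bits are dealt out cyclically to \<open>k\<close> coordinates, most significant bits first.
\<close>

primrec cval :: "nat \<Rightarrow> bool list \<Rightarrow> nat \<Rightarrow> nat" where
  "cval k [] = (\<lambda>_. 0)"
| "cval k (b # rs) = (cval k rs)(length rs mod k := 2 * cval k rs (length rs mod k) + of_bool b)"

text \<open>How many of the first \<open>L\<close> branching bits coordinate \<open>i\<close> has
  received.\<close>

primrec lev :: "nat \<Rightarrow> nat \<Rightarrow> nat \<Rightarrow> nat" where
  "lev k 0 i = 0"
| "lev k (Suc L) i = lev k L i + of_bool (L mod k = i)"

lemma lev_block:
  assumes "i < k"
  shows "lev k (t * k) i = t"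
proof (induction t)
  case (Suc t)
  have "s \<le> k \<Longrightarrow> lev k (t * k + s) i = t + of_bool (i < s)" for s
    by (induction s) (use Suc in auto)
  from this[of k] assms show ?case by (simp add: add.commute)
qed simp

text \<open>The common length tells which coordinate received the last bit, and the parity of that
  coordinate is the bit.\<close>

lemma cval_inj:
  assumes "length rs = length rs'" "\<And>i. i < k \<Longrightarrow> cval k rs i = cval k rs' i" "k > 0"
  shows "rs = rs'"
  using assms(1,2)
proof (induction rs rs' rule: list_induct2)
  case (Cons b rs b' rs')
  let ?i = "length rs mod k"
  have "?i < k" using assms(3) by simp
  with Cons.prems[of ?i] Cons.hyps
  have *: "2 * cval k rs ?i + of_bool b = 2 * cval k rs' ?i + of_bool b'" by simp
  then have "cval k rs ?i = cval k rs' ?i" "b = b'" by (cases b; cases b'; simp; presburger)+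
  moreover have "cval k rs i = cval k rs' i" if "i < k" for i
    using Cons.prems[OF that] calculation(1) Cons.hyps by (cases "i = ?i") auto
  ultimately show ?case using Cons.IH by simp
qed simp

lemma cval_less: "cval k rs i < 2 ^ lev k (length rs) i"
  by (induction rs) auto

text \<open>The way back from tuples to nodes: the first \<open>L\<close> branching bits that spell
  out the entries of \<open>c\<close> as \<open>T\<close>-bit numbers.\<close>

primrec path :: "nat \<Rightarrow> nat \<Rightarrow> (nat \<Rightarrow> nat) \<Rightarrow> nat \<Rightarrow> bool list" where
  "path k T c 0 = []"
| "path k T c (Suc L) = odd (c (L mod k) div 2 ^ (T - Suc (lev k L (L mod k)))) # path k T c L"

lemma length_path [simp]: "length (path k T c L) = L"
  by (induction L) auto

lemma drop_path: "i \<le> L \<Longrightarrow> drop i (path k T c L) = path k T c (L - i)"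
proof (induction L arbitrary: i)
  case (Suc L)
  then show ?case by (cases i) auto
qed simp

lemma lev_mono: "L \<le> L' \<Longrightarrow> lev k L i \<le> lev k L' i"
  by (induction L' rule: nat_induct) (auto simp: le_Suc_eq)

lemma cval_path:
  assumes "i < k" "L \<le> T * k" "c i < 2 ^ T"
  shows "cval k (path k T c L) i = c i div 2 ^ (T - lev k L i)"
  using assms(2)
proof (induction L)
  case 0
  then show ?case using assms(3) by simp
next
  case (Suc L)
  show ?case
  proof (cases "L mod k = i")
    case True
    have "lev k (Suc L) i \<le> T"
      using lev_mono[OF Suc.prems, of k i] lev_block[OF assms(1)] by simp
    then obtain s where s: "T - lev k L i = Suc s" "T - Suc (lev k L i) = s"
      using True by (cases "T - lev k L i") auto
    have "2 * (c i div 2 ^ Suc s) + of_bool (odd (c i div 2 ^ s)) = c i div 2 ^ s"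
    proof -
      have "2 * (x div 2) + of_bool (odd x) = x" for x :: nat
        by (cases "odd x") (auto elim!: oddE evenE)
      from this[of "c i div 2 ^ s"] show ?thesis
        by (simp only: power_Suc2 div_mult2_eq)
    qed
    then show ?thesis using True Suc s by simp
  next
    case False
    then show ?thesis using Suc by simp
  qed
qed

definition sel :: "nat \<Rightarrow> nat \<Rightarrow> nat \<Rightarrow> (nat \<Rightarrow> nat) \<Rightarrow> nat \<Rightarrow> (nat \<Rightarrow> nat) \<Rightarrow> nat set" where
  "sel n k T code t c = {u. u < n \<and> (\<exists>l<k. code u div 2 ^ (T - t) = c l)}"

text \<open>For \<open>l = 0\<close> truncated subtraction yields the trivial
  \<open>c 0 \<le> c 0\<close>; in this form the order test is one uniform loop of the
  program.\<close>

definition good :: "(nat set \<Rightarrow> bool) \<Rightarrow> nat \<Rightarrow> nat \<Rightarrow> nat \<Rightarrow> (nat \<Rightarrow> nat) \<Rightarrow> nat \<Rightarrow> (nat \<Rightarrow> nat) \<Rightarrow> bool" where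
  "good dec n k T code t c \<longleftrightarrow> (\<forall>l<k. c (l - 1) \<le> c l) \<and> dec (sel n k T code t c)"

text \<open>Nodes between two full levels pass untested. For \<open>k = 0\<close> the tree is just
  its root, which is tested because \<open>0 mod 0 = 0\<close>.\<close>

definition viable :: "(nat set \<Rightarrow> bool) \<Rightarrow> nat \<Rightarrow> nat \<Rightarrow> nat \<Rightarrow> (nat \<Rightarrow> nat) \<Rightarrow> bool list \<Rightarrow> bool" where
  "viable dec n k T code rs \<longleftrightarrow>
     (length rs mod k = 0 \<longrightarrow> good dec n k T code (length rs div k) (cval k rs))"

lemma sorted_map_upt_iff:
  fixes c :: "nat \<Rightarrow> nat"
  shows "sorted (map c [0..<k]) \<longleftrightarrow> (\<forall>l<k. c (l - 1) \<le> c l)"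
proof
  assume "\<forall>l<k. c (l - 1) \<le> c l"
  then have "c i \<le> c (Suc i)" if "Suc i < k" for i using that by fastforce
  then show "sorted (map c [0..<k])" by (simp add: sorted_iff_nth_Suc)
next
  assume "sorted (map c [0..<k])"
  then have "c i \<le> c (Suc i)" if "Suc i < k" for i
    using that by (simp add: sorted_iff_nth_Suc)
  then have "c (l - 1) \<le> c l" if "l < k" for l using that by (cases l) auto
  then show "\<forall>l<k. c (l - 1) \<le> c l" by blast
qed

section \<open>Expected number of surviving candidates\<close>

definition codes :: "nat \<Rightarrow> nat \<Rightarrow> (nat \<Rightarrow> nat) pmf" where
  "codes n T = Pi_pmf {..<n} 0 (\<lambda>_. pmf_of_set {..<2 ^ T})"

definition tuples :: "nat \<Rightarrow> nat \<Rightarrow> nat list set" where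
  "tuples k N = {xs. length xs = k \<and> sorted xs \<and> set xs \<subseteq> {..<N}}"

lemma finite_tuples: "finite (tuples k N)"
  by (rule finite_subset[OF _ finite_lists_length_eq[of "{..<N}" k]]) (auto simp: tuples_def)

text \<open>Stars and bars: adding its index to each entry makes a nondecreasing tuple strictly
  increasing, and such a tuple is determined by its set of entries.\<close>

lemma card_tuples_le: "card (tuples k N) \<le> (N + k) choose k"
proof -
  let ?up = "\<lambda>xs. map (\<lambda>i. xs ! i + i) [0..<k]"
  have up: "sorted (?up xs)" "distinct (?up xs)" "set (?up xs) \<subseteq> {..<N + k}" if "xs \<in> tuples k N" for xs
  proof -
    have "xs ! i \<le> xs ! j" if "i \<le> j" "j < k" for i j
      using \<open>xs \<in> _\<close> that by (auto simp: tuples_def intro: sorted_nth_mono)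
    then have "sorted_wrt (<) (?up xs)" by (fastforce simp: sorted_wrt_iff_nth_less intro!: add_le_less_mono)
    then show "sorted (?up xs)" "distinct (?up xs)" by (auto simp: strict_sorted_iff)
    have "xs ! i < N" if "i < k" for i
      using \<open>xs \<in> _\<close> that nth_mem[of i xs] unfolding tuples_def by blast
    then show "set (?up xs) \<subseteq> {..<N + k}" by (auto intro!: add_less_mono)
  qed
  have "inj_on (\<lambda>xs. set (?up xs)) (tuples k N)"
  proof (rule inj_onI)
    fix xs ys assume xy: "xs \<in> tuples k N" "ys \<in> tuples k N" "set (?up xs) = set (?up ys)"
    then have "?up xs = ?up ys" using up by (intro sorted_distinct_set_unique) auto
    then have "xs ! i = ys ! i" if "i < k" for i using that by simp
    then show "xs = ys" using xy by (auto simp: tuples_def intro: nth_equalityI)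
  qed
  then have "card (tuples k N) = card ((\<lambda>xs. set (?up xs)) ` tuples k N)"
    by (simp add: card_image)
  also have "\<dots> \<le> card {A. A \<subseteq> {..<N + k} \<and> card A = k}"
  proof (rule card_mono)
    show "(\<lambda>xs. set (?up xs)) ` tuples k N \<subseteq> {A. A \<subseteq> {..<N + k} \<and> card A = k}"
    proof safe
      fix xs assume "xs \<in> tuples k N"
      then show "card (set (?up xs)) = k" using distinct_card[OF up(2)] by simp
    qed (use up(3) in blast)
  qed simp
  also have "\<dots> = (N + k) choose k" by (simp add: n_subsets)
  finally show ?thesis .
qed

text \<open>\<open>k ^ k / fact k\<close> is a single term of the series of \<open>exp k\<close>,
  and \<open>exp 1 \<le> 3\<close>.\<close>

lemma power_self_le: "real (k ^ k) \<le> 4 ^ k * fact k"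
proof -
  have "(\<Sum>n\<in>{k}. real k ^ n /\<^sub>R fact n) \<le> (\<Sum>n. real k ^ n /\<^sub>R fact n)"
    by (rule sum_le_suminf[OF summable_exp_generic]) auto
  then have "real k ^ k / fact k \<le> exp (real k)" by (simp add: exp_def divide_inverse mult.commute)
  also have "\<dots> = exp 1 ^ k" by (simp add: exp_of_nat_mult[symmetric])
  also have "\<dots> \<le> 4 ^ k" using exp_le by (intro power_mono) auto
  finally show ?thesis by (simp add: field_simps)
qed

text \<open>
  The factor \<open>min k N ^ k / N ^ k\<close> bounds the probability that \<open>k\<close> independent uniform elements
  of \<open>{..<N}\<close> all lie in a given \<open>k\<close>-tuple.
\<close>

lemma card_tuples_min: "real (card (tuples k N)) * real (min k N) ^ k \<le> 8 ^ k * real N ^ k"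
proof (cases "N < k")
  \<comment> \<open>With fewer than \<open>k\<close> strings a tuple may cover all of them, and the
    probability bound is 1; here the mere number of tuples is small enough.\<close>
  case True
  have "card (tuples k N) \<le> 2 ^ (N + k)"
    using card_tuples_le[of k N] binomial_le_pow2[of "N + k" k] by (rule le_trans)
  then have "real (card (tuples k N)) \<le> real (2 ^ (N + k))" by (simp only: of_nat_le_iff)
  then have "real (card (tuples k N)) \<le> 2 ^ (N + k)" by simp
  also have "\<dots> \<le> 2 ^ (3 * k)" using True by (intro power_increasing) auto
  also have "\<dots> = (8::real) ^ k" by (simp add: power_mult)
  finally show ?thesis using True by (simp add: mult_right_mono)
next
  \<comment> \<open>The two factors are \<open>2 ^ k * N ^ k / fact k\<close> from counting and
    \<open>4 ^ k * fact k\<close> from \<open>power_self_le\<close>; the factorials cancel.\<close>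
  case False
  have "real (card (tuples k N)) * fact k \<le> real ((N + k) choose k) * fact k"
    using card_tuples_le[of k N] by (intro mult_right_mono) auto
  also have "\<dots> = real (((N + k) choose k) * fact k)" by simp
  also have "\<dots> \<le> real ((N + k) ^ k)"
    using binomial_fact_pow[of "N + k" k] by (simp only: of_nat_le_iff)
  also have "\<dots> \<le> real ((2 * N) ^ k)"
    using False by (simp only: of_nat_le_iff, intro power_mono) auto
  finally have *: "real (card (tuples k N)) * fact k \<le> 2 ^ k * real N ^ k"
    by (simp add: power_mult_distrib)
  have "real (card (tuples k N)) * real (k ^ k) \<le> real (card (tuples k N)) * (4 ^ k * fact k)"
    using power_self_le by (intro mult_left_mono) auto
  also have "\<dots> \<le> 4 ^ k * (2 ^ k * real N ^ k)"
    using mult_left_mono[OF *, of "4 ^ k"] by (simp add: mult_ac)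
  also have "\<dots> = (4 * 2) ^ k * real N ^ k"
    by (simp only: power_mult_distrib mult.assoc)
  finally show ?thesis using False by simp
qed

lemma prob_prefix_le:
  fixes S :: "nat set"
  assumes "t \<le> T" "finite S"
  shows "measure_pmf.prob (pmf_of_set {..<2 ^ T}) {v. v div 2 ^ (T - t) \<in> S} \<le> real (card S) / 2 ^ t"
proof -
  let ?d = "2 ^ (T - t) :: nat"
  have sub: "{..<2 ^ T} \<inter> {v. v div ?d \<in> S} \<subseteq> (\<lambda>(s, r). s * ?d + r) ` (S \<times> {..<?d})"
  proof
    fix v assume "v \<in> {..<2 ^ T} \<inter> {v. v div ?d \<in> S}"
    then have "(v div ?d, v mod ?d) \<in> S \<times> {..<?d}" by simp
    moreover have "v = v div ?d * ?d + v mod ?d" by (rule div_mult_mod_eq[symmetric])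
    ultimately show "v \<in> (\<lambda>(s, r). s * ?d + r) ` (S \<times> {..<?d})"
      by (metis (mono_tags, lifting) case_prod_conv image_eqI)
  qed
  have "card ({..<2 ^ T} \<inter> {v. v div ?d \<in> S}) \<le> card (S \<times> {..<?d})"
    by (rule surj_card_le[OF _ sub]) (simp add: assms)
  also have "\<dots> = card S * ?d" by (simp add: card_cartesian_product)
  finally have "real (card ({..<2 ^ T} \<inter> {v. v div ?d \<in> S})) \<le> real (card S * ?d)"
    by (simp only: of_nat_le_iff)
  then have *: "real (card ({..<2 ^ T} \<inter> {v. v div ?d \<in> S})) \<le> real (card S) * 2 ^ (T - t)"
    by simp
  have "(2::real) ^ T = 2 ^ t * 2 ^ (T - t)" using assms(1) by (simp add: power_add[symmetric])
  with * show ?thesis by (simp add: measure_pmf_of_set lessThan_empty_iff field_simps)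
qed

text \<open>By independence the event is a product: each element of \<open>W\<close> contributes the
  share of strings occurring in \<open>xs\<close>, every other element contributes 1. A
  \<open>k\<close>-tuple over \<open>N\<close> strings has at most \<open>min k N\<close> distinct
  entries.\<close>

lemma prob_tuple_covers:
  assumes "W \<subseteq> {..<n}" "card W = k" "t \<le> T" "xs \<in> tuples k (2 ^ t)"
  shows "measure_pmf.prob (codes n T) {code. \<forall>u\<in>W. code u div 2 ^ (T - t) \<in> set xs}
      \<le> (real (min k (2 ^ t)) / 2 ^ t) ^ k"
proof -
  let ?B = "\<lambda>u. if u \<in> W then {v. v div 2 ^ (T - t) \<in> set xs} else UNIV"
  let ?m = "real (min k (2 ^ t)) / 2 ^ t"
  have "{code. \<forall>u\<in>W. code u div 2 ^ (T - t) \<in> set xs} = Pi {..<n} ?B"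
    using assms(1) by (auto simp: Pi_def split: if_splits)
  then have "measure_pmf.prob (codes n T) {code. \<forall>u\<in>W. code u div 2 ^ (T - t) \<in> set xs} =
      (\<Prod>u<n. measure_pmf.prob (pmf_of_set {..<2 ^ T}) (?B u))"
    unfolding codes_def by (simp add: measure_Pi_pmf_Pi)
  also have "\<dots> \<le> (\<Prod>u<n. if u \<in> W then ?m else 1)"
  proof (intro prod_mono conjI)
    fix u
    have "card (set xs) \<le> min k (2 ^ t)"
      using assms(4) card_length[of xs] card_mono[of "{..<2 ^ t}" "set xs"] by (auto simp: tuples_def)
    then have "real (card (set xs)) / 2 ^ t \<le> ?m" by (intro divide_right_mono) (simp_all only: of_nat_le_iff, simp)
    then show "measure_pmf.prob (pmf_of_set {..<2 ^ T}) (?B u) \<le> (if u \<in> W then ?m else 1)"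
      using prob_prefix_le[OF assms(3), of "set xs"] by auto
  qed simp
  also have "\<dots> = (\<Prod>u\<in>W. ?m)"
    using assms(1) by (simp add: prod.If_cases Int_absorb1)
  also have "\<dots> = ?m ^ k" by (simp add: assms(2))
  finally show ?thesis .
qed

text \<open>Union bound over all ordered pairs, the diagonal contributing nothing.\<close>

lemma prob_not_inj_le:
  "measure_pmf.prob (codes n T) {code. \<not> inj_on code {..<n}} \<le> real (n * n) / 2 ^ T"
proof -
  let ?C = "\<lambda>(u, v). {code :: nat \<Rightarrow> nat. u \<noteq> v \<and> code u = code v}"
  have pair: "measure_pmf.prob (codes n T) (?C p) \<le> 1 / 2 ^ T" if "p \<in> {..<n} \<times> {..<n}" for p
  proof -
    obtain u v where p: "p = (u, v)" "u < n" "v < n" using \<open>p \<in> _\<close> by auto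
    show ?thesis
    proof (cases "u = v")
      case False
      let ?B = "\<lambda>x w. if w \<in> {u, v} then {x} else UNIV :: nat set"
      \<comment> \<open>Splitting by the common value \<open>x\<close> gives \<open>2 ^ T\<close>
        product events of probability \<open>1 / 2 ^ T\<close> squared each.\<close>
      have "AE code in codes n T. code \<in> ?C p \<longrightarrow> code \<in> (\<Union>x<2 ^ T. Pi {..<n} (?B x))"
      proof (rule AE_pmfI, rule impI)
        fix code assume "code \<in> set_pmf (codes n T)" "code \<in> ?C p"
        then have "code u < 2 ^ T" "code u = code v"
          using p by (auto simp: codes_def set_Pi_pmf PiE_dflt_def lessThan_empty_iff)
        then show "code \<in> (\<Union>x<2 ^ T. Pi {..<n} (?B x))" by (auto simp: Pi_def)
      qed
      then have "measure_pmf.prob (codes n T) (?C p) \<le>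
          measure_pmf.prob (codes n T) (\<Union>x<2 ^ T. Pi {..<n} (?B x))"
        by (intro measure_pmf.finite_measure_mono_AE) auto
      also have "\<dots> \<le> (\<Sum>x<2 ^ T. measure_pmf.prob (codes n T) (Pi {..<n} (?B x)))"
        by (intro measure_pmf.finite_measure_subadditive_finite) auto
      also have "\<dots> = (\<Sum>x<(2::nat) ^ T. (1 / 2 ^ T) ^ 2)"
      proof (intro sum.cong refl)
        fix x :: nat assume "x \<in> {..<2 ^ T}"
        then have "measure_pmf.prob (pmf_of_set {..<2 ^ T}) (?B x w) =
            (if w \<in> {u, v} then 1 / 2 ^ T else 1)" for w
          by (auto simp: measure_pmf_of_set lessThan_empty_iff)
        then have "measure_pmf.prob (codes n T) (Pi {..<n} (?B x)) =
            (\<Prod>w<n. if w \<in> {u, v} then 1 / 2 ^ T else 1)"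
          unfolding codes_def by (subst measure_Pi_pmf_Pi) simp_all
        also have "\<dots> = (\<Prod>w\<in>{u, v}. 1 / 2 ^ T)"
        proof -
          have "{..<n} \<inter> {w. w \<in> {u, v}} = {u, v}" using p by auto
          then show ?thesis by (subst prod.If_cases) simp_all
        qed
        finally show "measure_pmf.prob (codes n T) (Pi {..<n} (?B x)) = (1 / 2 ^ T) ^ 2"
          using False by (simp add: power2_eq_square)
      qed
      also have "\<dots> = 1 / 2 ^ T" by (simp add: power2_eq_square)
      finally show ?thesis .
    qed (simp add: p)
  qed
  have "{code. \<not> inj_on code {..<n}} = (\<Union>p\<in>{..<n} \<times> {..<n}. ?C p)"
    by (auto simp: inj_on_def)
  then have "measure_pmf.prob (codes n T) {code. \<not> inj_on code {..<n}} \<le>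
      (\<Sum>p\<in>{..<n} \<times> {..<n}. measure_pmf.prob (codes n T) (?C p))"
    using measure_pmf.finite_measure_subadditive_finite[of "{..<n} \<times> {..<n}" ?C "codes n T"] by simp
  also have "\<dots> \<le> (\<Sum>p\<in>{..<n} \<times> {..<n}. 1 / 2 ^ T)" by (intro sum_mono pair)
  finally show ?thesis by (simp add: card_cartesian_product)
qed

lemma finite_codes: "finite (set_pmf (codes n T))"
proof -
  have "set_pmf (codes n T) \<subseteq> PiE_dflt {..<n} 0 (\<lambda>_. {..<2 ^ T})"
    by (auto simp: codes_def set_Pi_pmf PiE_dflt_def lessThan_empty_iff)
  then show ?thesis by (rule finite_subset) (intro finite_PiE_dflt; simp)
qed

section \<open>Leaves of the search tree and witnesses\<close>

locale witness_system =
  fixes Ws :: "nat set set" and n k :: nat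
  assumes witness: "W \<in> Ws \<Longrightarrow> W \<subseteq> {..<n} \<and> card W = k"
begin

definition dec :: "nat set \<Rightarrow> bool" where
  "dec X \<longleftrightarrow> (\<exists>W\<in>Ws. W \<subseteq> X)"

abbreviation live :: "nat \<Rightarrow> (nat \<Rightarrow> nat) \<Rightarrow> nat \<Rightarrow> bool list set" where
  "live T code j \<equiv> alive (viable dec n k T code) j []"

lemma finite_Ws: "finite Ws"
  by (rule finite_subset[of _ "Pow {..<n}"]) (use witness in auto)

lemma finite_witness: "W \<in> Ws \<Longrightarrow> finite W"
  using witness finite_subset by blast

lemma live_block:
  assumes "rs \<in> live T code (t * k)"
  shows "length rs = t * k" "good dec n k T code t (cval k rs)"
proof -
  show len: "length rs = t * k" using assms by (simp add: alive_def)
  have "viable dec n k T code rs" using assms unfolding alive_def by force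
  then show "good dec n k T code t (cval k rs)"
    using len by (cases "k = 0") (auto simp: viable_def good_def sel_def)
qed

text \<open>With distinct codes, \<open>k\<close> entries of full length select at most
  \<open>k\<close> elements, which leaves no room besides the witness.\<close>

lemma sel_eq_witness:
  assumes "inj_on code {..<n}" "W \<in> Ws" "W \<subseteq> sel n k T code T c"
  shows "sel n k T code T c = W"
proof -
  let ?X = "sel n k T code T c"
  have "code ` ?X \<subseteq> c ` {..<k}" by (auto simp: sel_def)
  then have "card (code ` ?X) \<le> k"
    using card_mono[of "c ` {..<k}" "code ` ?X"] card_image_le[of "{..<k}" c] by simp
  moreover have "inj_on code ?X" by (rule inj_on_subset[OF assms(1)]) (auto simp: sel_def)
  ultimately have "card ?X \<le> card W" using witness[OF assms(2)] by (simp add: card_image)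
  then show ?thesis
    using card_seteq[of ?X W] assms(3) by (auto simp: sel_def)
qed

text \<open>A leaf corresponds to the set it selects. In the other direction, a witness yields the
  leaf spelling out its codes in increasing order; sorting makes this leaf the only one.\<close>

theorem card_leaves:
  assumes inj: "inj_on code {..<n}" and code: "\<And>u. u < n \<Longrightarrow> code u < 2 ^ T"
  shows "card (live T code (T * k)) = card Ws"
proof (rule bij_betw_same_card)
  let ?g = "\<lambda>rs. sel n k T code T (cval k rs)"
  have leaf: "?g rs \<in> Ws" "sorted (map (cval k rs) [0..<k])"
    if "rs \<in> live T code (T * k)" for rs
    using live_block(2)[OF that] sel_eq_witness[OF inj]
    by (auto simp: good_def dec_def sorted_map_upt_iff)
  \<comment> \<open>All \<open>k\<close> entries are used up by the \<open>k\<close> distinct codes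
    of the witness, so no entry is idle or repeated, and the sorted tuple can be read off the
    selected set.\<close>
  have set_leaf: "set (map (cval k rs) [0..<k]) = code ` ?g rs" "distinct (map (cval k rs) [0..<k])"
    if "rs \<in> live T code (T * k)" for rs
  proof -
    let ?c = "cval k rs"
    have sub: "code ` ?g rs \<subseteq> ?c ` {..<k}" by (auto simp: sel_def)
    have "card (code ` ?g rs) = k"
      using leaf(1)[OF that] witness inj by (metis card_image inj_on_subset)
    moreover have "card (?c ` {..<k}) \<le> k" using card_image_le[of "{..<k}" ?c] by simp
    ultimately have eq: "code ` ?g rs = ?c ` {..<k}"
      using card_seteq[OF _ sub] by simp
    then show "set (map ?c [0..<k]) = code ` ?g rs" by (simp add: atLeast0LessThan)
    have "card (?c ` {..<k}) = card {..<k}" using eq \<open>card (code ` ?g rs) = k\<close> by simp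
    then show "distinct (map ?c [0..<k])"
      by (simp add: distinct_map eq_card_imp_inj_on atLeast0LessThan)
  qed
  show "bij_betw ?g (live T code (T * k)) Ws"
    unfolding bij_betw_def
  proof (intro conjI subset_antisym)
    show "inj_on ?g (live T code (T * k))"
    proof (rule inj_onI)
      fix rs rs' assume rs: "rs \<in> live T code (T * k)" "rs' \<in> live T code (T * k)" "?g rs = ?g rs'"
      have "map (cval k rs) [0..<k] = map (cval k rs') [0..<k]"
        using leaf(2) set_leaf rs by (intro sorted_distinct_set_unique) auto
      then have "cval k rs i = cval k rs' i" if "i < k" for i using that by simp
      moreover have "length rs = length rs'" using live_block(1) rs by simp
      ultimately show "rs = rs'" using live_block(1)[OF rs(1)] by (cases "k = 0") (auto intro: cval_inj)
    qed
    show "?g ` live T code (T * k) \<subseteq> Ws" using leaf(1) by blast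
    show "Ws \<subseteq> ?g ` live T code (T * k)"
    proof
      fix W assume W: "W \<in> Ws"
      define xs where "xs = sorted_list_of_set (code ` W)"
      define c where "c = (\<lambda>i. xs ! i)"
      have xs: "sorted xs" "set xs = code ` W" "length xs = k"
        using witness[OF W] finite_witness[OF W] inj
        by (auto simp: xs_def card_image[OF inj_on_subset])
      have c_less: "c i < 2 ^ T" if "i < k" for i
      proof -
        have "c i \<in> code ` W" using xs that by (metis c_def nth_mem)
        then show ?thesis using witness[OF W] code by auto
      qed
      let ?rs = "path k T c (T * k)"
      have block: "cval k (path k T c (t * k)) i = c i div 2 ^ (T - t)" if "t \<le> T" "i < k" for t i
        using cval_path[of i k "t * k" T c] that c_less lev_block by simp
      have sub: "W \<subseteq> sel n k T code t (cval k (path k T c (t * k)))" if "t \<le> T" for t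
      proof
        fix u assume u: "u \<in> W"
        then obtain l where "l < k" "c l = code u"
          using xs by (metis c_def imageI in_set_conv_nth)
        then show "u \<in> sel n k T code t (cval k (path k T c (t * k)))"
          using u witness[OF W] block[OF that] by (auto simp: sel_def intro!: exI[of _ l])
      qed
      \<comment> \<open>No ancestor is cut off: truncating codes preserves both their order and the
        fact that they select \<open>W\<close>.\<close>
      have "viable dec n k T code (path k T c L)" if L: "L \<le> T * k" for L
        unfolding viable_def
      proof
        assume "length (path k T c L) mod k = 0"
        then obtain t where t: "L = t * k" by (metis length_path mod_0_imp_dvd dvd_def mult.commute)
        show "good dec n k T code (length (path k T c L) div k) (cval k (path k T c L))"
        proof (cases "k = 0")
          case True
          then show ?thesis using sub[of 0] t W by (auto simp: good_def dec_def sel_def)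
        next
          case False
          then have "t \<le> T" using L t by simp
          moreover have "c (l - 1) \<le> c l" if "l < k" for l
            using xs that by (auto simp: c_def intro!: sorted_nth_mono)
          ultimately show ?thesis
            using False t W sub[of t] block[of t] by (auto simp: good_def dec_def intro!: div_le_mono)
        qed
      qed
      then have "?rs \<in> live T code (T * k)" by (simp add: alive_def drop_path)
      moreover have "?g ?rs = W" by (rule sel_eq_witness[OF inj W sub]) simp
      ultimately show "W \<in> ?g ` live T code (T * k)" by blast
    qed
  qed
qed

text \<open>A live node at a full level is determined by its tuple, and some witness keeps it alive;
  the right side counts all pairs of a witness and a tuple covering it.\<close>

lemma card_live_block_le:
  assumes "t \<le> T"
  shows "card (live T code (t * k)) \<le>
     (\<Sum>W\<in>Ws. card {xs \<in> tuples k (2 ^ t). \<forall>u\<in>W. code u div 2 ^ (T - t) \<in> set xs})"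
proof -
  let ?g = "\<lambda>rs. map (cval k rs) [0..<k]"
  let ?S = "\<lambda>W. {xs \<in> tuples k (2 ^ t). \<forall>u\<in>W. code u div 2 ^ (T - t) \<in> set xs}"
  have "inj_on ?g (live T code (t * k))"
  proof (rule inj_onI)
    fix rs rs' assume rs: "rs \<in> live T code (t * k)" "rs' \<in> live T code (t * k)" "?g rs = ?g rs'"
    then have "cval k rs i = cval k rs' i" if "i < k" for i using that by simp
    moreover have "length rs = t * k" "length rs' = t * k" using live_block(1) rs by blast+
    ultimately show "rs = rs'" using cval_inj[of rs rs' k] by (cases "k = 0") simp_all
  qed
  moreover have "?g ` live T code (t * k) \<subseteq> (\<Union>W\<in>Ws. ?S W)"
  proof safe
    fix rs assume rs: "rs \<in> live T code (t * k)"
    note good = live_block(2)[OF rs]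
    then obtain W where W: "W \<in> Ws" "W \<subseteq> sel n k T code t (cval k rs)"
      by (auto simp: good_def dec_def)
    have "cval k rs l < 2 ^ t" if "l < k" for l
      using cval_less[of k rs l] live_block(1)[OF rs] lev_block[OF that] by simp
    then have "?g rs \<in> ?S W"
      using W good by (auto simp: tuples_def sel_def good_def sorted_map_upt_iff)
    then show "?g rs \<in> (\<Union>W\<in>Ws. ?S W)" using W by blast
  qed
  ultimately have "card (live T code (t * k)) \<le> card (\<Union>W\<in>Ws. ?S W)"
    by (intro card_inj_on_le[of ?g]) (auto simp: finite_Ws finite_tuples)
  also have "\<dots> \<le> (\<Sum>W\<in>Ws. card (?S W))" by (rule card_UN_le[OF finite_Ws])
  finally show ?thesis .
qed

lemma expectation_live_block_le:
  assumes "t \<le> T"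
  shows "measure_pmf.expectation (codes n T) (\<lambda>code. real (card (live T code (t * k)))) \<le>
     real (card Ws) * 8 ^ k"
proof -
  let ?E = "measure_pmf.expectation (codes n T)"
  let ?A = "\<lambda>W xs. {code :: nat \<Rightarrow> nat. \<forall>u\<in>W. code u div 2 ^ (T - t) \<in> set xs}"
  have int: "integrable (codes n T) f" for f :: "(nat \<Rightarrow> nat) \<Rightarrow> real"
    by (rule integrable_measure_pmf_finite[OF finite_codes])
  have "?E (\<lambda>code. real (card (live T code (t * k)))) \<le>
      ?E (\<lambda>code. \<Sum>W\<in>Ws. \<Sum>xs\<in>tuples k (2 ^ t). indicator (?A W xs) code)"
  proof (intro integral_mono int)
    fix code
    have "(\<Sum>xs\<in>tuples k (2 ^ t). indicator (?A W xs) code) =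
        real (card {xs \<in> tuples k (2 ^ t). \<forall>u\<in>W. code u div 2 ^ (T - t) \<in> set xs})" for W
      by (simp add: indicator_def finite_tuples Int_def sum.If_cases if_distrib cong: if_cong)
    then show "real (card (live T code (t * k))) \<le>
        (\<Sum>W\<in>Ws. \<Sum>xs\<in>tuples k (2 ^ t). indicator (?A W xs) code)"
      using card_live_block_le[OF assms, of code] by (simp add: of_nat_sum[symmetric] del: of_nat_sum)
  qed
  also have "\<dots> = (\<Sum>W\<in>Ws. \<Sum>xs\<in>tuples k (2 ^ t). measure_pmf.prob (codes n T) (?A W xs))"
    by (simp add: Bochner_Integration.integral_sum int)
  also have "\<dots> \<le> (\<Sum>W\<in>Ws. \<Sum>xs\<in>tuples k (2 ^ t). (real (min k (2 ^ t)) / 2 ^ t) ^ k)"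
    using witness assms by (intro sum_mono prob_tuple_covers) auto
  also have "\<dots> = real (card Ws) * (real (card (tuples k (2 ^ t))) * real (min k (2 ^ t)) ^ k / (2 ^ t) ^ k)"
    by (simp add: power_divide)
  also have "\<dots> \<le> real (card Ws) * 8 ^ k"
    using card_tuples_min[of k "2 ^ t"] by (intro mult_left_mono) (simp_all add: divide_simps)
  finally show ?thesis .
qed

text \<open>The bounds at all levels add up to an expected \<open>1 + 4 * T * 16 ^ k * M\<close>
  steps, a quarter of \<open>B\<close>, so Markov's inequality leaves a failure probability of 1/4;
  the condition on \<open>T\<close> leaves another 1/4 for collisions.\<close>

theorem prob_success:
  assumes T: "4 * (n * n) \<le> 2 ^ T" and M: "card Ws \<le> M"
    and B: "B = 4 + 16 * (T * (16 ^ k * M))"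
  shows "measure_pmf.prob (codes n T)
     {code. inj_on code {..<n} \<and> tsize (viable dec n k T code) (T * k) [] \<le> B} \<ge> 1 / 2"
    (is "measure_pmf.prob _ ?G \<ge> _")
proof -
  let ?E = "measure_pmf.expectation (codes n T)"
  let ?P = "measure_pmf.prob (codes n T)"
  let ?s = "\<lambda>code. real (tsize (viable dec n k T code) (T * k) [])"
  let ?c = "\<lambda>t code. real (card (live T code (t * k)))"
  have int: "integrable (codes n T) f" for f :: "(nat \<Rightarrow> nat) \<Rightarrow> real"
    by (rule integrable_measure_pmf_finite[OF finite_codes])
  have "?E ?s \<le> ?E (\<lambda>code. 1 + 4 * (2 ^ k * (\<Sum>t<T. ?c t code)))"
  proof (intro integral_mono int)
    fix code
    have "?s code \<le> real (1 + 4 * (2 ^ k * (\<Sum>t<T. card (live T code (t * k)))))"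
      using tsize_blocks by (simp only: of_nat_le_iff)
    then show "?s code \<le> 1 + 4 * (2 ^ k * (\<Sum>t<T. ?c t code))" by simp
  qed
  also have "\<dots> = 1 + 4 * (2 ^ k * (\<Sum>t<T. ?E (?c t)))"
    by (simp add: int Bochner_Integration.integral_sum)
  also have "\<dots> \<le> 1 + 4 * (2 ^ k * (\<Sum>t<T. real M * 8 ^ k))"
  proof (intro add_left_mono mult_left_mono sum_mono)
    fix t assume "t \<in> {..<T}"
    then have "?E (?c t) \<le> real (card Ws) * 8 ^ k" by (intro expectation_live_block_le) simp
    also have "\<dots> \<le> real M * 8 ^ k" using M by simp
    finally show "?E (?c t) \<le> real M * 8 ^ k" .
  qed auto
  also have "\<dots> = real B / 4"
  proof -
    have "(16::real) ^ k = 2 ^ k * 8 ^ k" by (simp add: power_mult_distrib[symmetric])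
    then show ?thesis by (simp add: B)
  qed
  finally have E: "?E ?s \<le> real B / 4" .
  have "B > 0" by (simp add: B)
  have "?P {code \<in> space (codes n T). real B \<le> ?s code} \<le> ?E ?s / real B"
    by (rule integral_Markov_inequality_measure[where A = "{}"]) (use \<open>B > 0\<close> int in auto)
  also have "\<dots> \<le> 1 / 4" using E \<open>B > 0\<close> by (simp add: field_simps)
  finally have size: "?P {code. real B \<le> ?s code} \<le> 1 / 4" by simp
  have "real (4 * (n * n)) \<le> real (2 ^ T)" using T by (simp only: of_nat_le_iff)
  then have "real (n * n) / 2 ^ T \<le> 1 / 4" by (simp add: field_simps)
  with prob_not_inj_le[of n T] have inj: "?P {code. \<not> inj_on code {..<n}} \<le> 1 / 4"
    by linarith
  have "1 - ?P ?G = ?P (- ?G)" by (simp add: measure_pmf.prob_compl[symmetric] Compl_eq_Diff_UNIV)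
  also have "\<dots> \<le> ?P ({code. \<not> inj_on code {..<n}} \<union> {code. real B \<le> ?s code})"
    by (intro measure_pmf.finite_measure_mono) auto
  also have "\<dots> \<le> ?P {code. \<not> inj_on code {..<n}} + ?P {code. real B \<le> ?s code}"
    by (rule measure_Un_le) auto
  finally show ?thesis using size inj by linarith
qed

end

section \<open>The program\<close>

lemmas wp_ForI = wp_weaken[OF wp_For]
lemmas wp_seqI = wp_weaken[OF wp_seq]
lemmas wp_straightI = wp_weaken[OF wp_straight]
lemmas wp_ifI = wp_weaken[OF wp_if]

definition neq :: "expr \<Rightarrow> expr \<Rightarrow> expr" where
  "neq e1 e2 = Plus (Minus e1 e2) (Minus e2 e1)"

lemma neq_simps [simp]:
  "aval I m (neq e1 e2) = 0 \<longleftrightarrow> aval I m e1 = aval I m e2"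
  "0 < aval I m (neq e1 e2) \<longleftrightarrow> aval I m e1 \<noteq> aval I m e2"
  "evars (neq e1 e2) = evars e1 \<union> evars e2"
  "ecost (neq e1 e2) = 3 + 2 * ecost e1 + 2 * ecost e2"
  by (auto simp: neq_def)

text \<open>
  Array names: \<open>P\<close> holds at \<open>t n + u\<close> the prefix of length \<open>t\<close> of the code of \<open>u\<close>, and \<open>E\<close> the codes;
  \<open>a\<close> holds the bits of the current node, first bit first, \<open>d\<close> their number and \<open>z\<close> the depth \<open>T k\<close>
  of the tree; \<open>C\<close> is the current tuple and \<open>o\<close> the offset in \<open>P\<close> of its level; \<open>s\<close> says that the
  current subtree is finished and \<open>q\<close> counts the leaves; \<open>w\<close> is the budget of search steps,
  \<open>g\<close> flags a collision of codes and \<open>f\<close> a completed search.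
\<close>

definition mark :: com where
  "mark = For ''u'' (Var ''n'') (Seq (Assign ''X'' (Var ''u'') (Const 0))
     (For ''l'' (Var ''k'')
       (If (neq (Cell ''P'' (Plus (Var ''o'') (Var ''u''))) (Cell ''C'' (Var ''l'')))
         Skip (Assign ''X'' (Var ''u'') (Const 1)))))"

definition order_check :: com where
  "order_check = For ''l'' (Var ''k'')
     (If (Minus (Cell ''C'' (Minus (Var ''l'') (Const 1))) (Cell ''C'' (Var ''l'')))
       (Set ''y'' (Const 0)) Skip)"

definition test :: com where
  "test = Seq mark (Seq (Query ''y'' ''X'') order_check)"

text \<open>The machine has no division or multiplication, so \<open>i\<close> and \<open>o\<close>
  track \<open>j mod k\<close> and \<open>(j div k) * n\<close> incrementally. Afterwards
  \<open>i\<close> is zero exactly at the levels where the oracle is to be asked.\<close>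

definition decode :: com where
  "decode = Seq (For ''l'' (Var ''k'') (Assign ''C'' (Var ''l'') (Const 0)))
     (Seq (Seq (Set ''i'' (Const 0)) (Set ''o'' (Const 0)))
       (For ''j'' (Var ''d'')
         (Seq (Assign ''C'' (Var ''i'') (Plus (Plus (Cell ''C'' (Var ''i'')) (Cell ''C'' (Var ''i''))) (Cell ''a'' (Var ''j''))))
         (Seq (Set ''i'' (Plus (Var ''i'') (Const 1)))
         (If (Minus (Var ''k'') (Var ''i'')) Skip
           (Seq (Set ''i'' (Const 0)) (Set ''o'' (Plus (Var ''o'') (Var ''n'')))))))))"

definition descend :: com where
  "descend = Seq decode (Seq (Set ''y'' (Const 1)) (Seq (If (Var ''i'') Skip test)
     (If (Var ''y'')
       (If (Minus (Var ''z'') (Var ''d''))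
         (Seq (Assign ''a'' (Var ''d'') (Const 0)) (Set ''d'' (Plus (Var ''d'') (Const 1))))
         (Seq (Set ''q'' (Plus (Var ''q'') (Const 1))) (Set ''s'' (Const 1))))
       (Set ''s'' (Const 1)))))"

definition backtrack :: com where
  "backtrack = If (Var ''d'')
     (If (Cell ''a'' (Minus (Var ''d'') (Const 1)))
       (Set ''d'' (Minus (Var ''d'') (Const 1)))
       (Seq (Assign ''a'' (Minus (Var ''d'') (Const 1)) (Const 1)) (Set ''s'' (Const 0))))
     Skip"

text \<open>The loop always runs through its whole budget, idling at the finished root. A step makes
  at most one oracle call, so \<open>w\<close> bounds the calls as well.\<close>

definition traverse :: com where
  "traverse = Seq (Seq (Set ''d'' (Const 0)) (Seq (Set ''s'' (Const 0)) (Set ''q'' (Const 0))))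
     (For ''h'' (Var ''w'') (If (Var ''s'') backtrack descend))"

definition collide :: com where
  "collide = Seq (Set ''g'' (Const 0)) (For ''u'' (Var ''n'') (For ''v'' (Var ''u'')
     (If (neq (Cell ''E'' (Var ''u'')) (Cell ''E'' (Var ''v''))) Skip (Set ''g'' (Const 1)))))"

section \<open>Correctness of the search\<close>

text \<open>The cost bound \<open>\<tau>\<close> covers both readings of the oracle: the ideal one
  with \<open>\<tau> = 0\<close>, and a decision program whose running time is charged to each
  call.\<close>

locale search = witness_system Ws "usize I" "param I" for Ws and I :: inst +
  fixes orc :: oracle_fun and \<tau> T :: nat
  assumes orc: "X \<subseteq> universe I \<Longrightarrow> fst (orc X) = dec X \<and> snd (orc X) \<le> \<tau>"
begin

abbreviation "n \<equiv> usize I"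
abbreviation "k \<equiv> param I"

definition params :: "mem \<Rightarrow> bool" where
  "params m \<longleftrightarrow> m ''n'' 0 = n \<and> m ''k'' 0 = k"

lemma wp_Query:
  assumes "Post (upd m x 0 (of_bool (dec {u. u < n \<and> m a u \<noteq> 0})))"
  shows "wp orc I (Query x a) Post (1 + n + \<tau>) 1 m"
proof -
  let ?X = "{u \<in> universe I. m a u \<noteq> 0}"
  have X: "?X = {u. u < n \<and> m a u \<noteq> 0}" by (auto simp: universe_def)
  have "fst (orc ?X) = dec ?X" "snd (orc ?X) \<le> \<tau>" using orc[of ?X] by auto
  moreover have "runs orc I (Query x a) m (1 + n + snd (orc ?X)) 1
      (return_pmf (upd m x 0 (of_bool (fst (orc ?X)))))"
    by (rule runs_query) simp
  ultimately have "runs orc I (Query x a) m (1 + n + \<tau>) 1 (return_pmf (upd m x 0 (of_bool (dec ?X))))"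
    by (auto intro: runs_weaken)
  then show ?thesis using assms unfolding wp_def X by blast
qed

text \<open>The numerals in this and the following time bounds are rounded up generously; only their
  growth in the parameters matters later.\<close>

lemma wp_mark:
  assumes m: "params m"
  shows "wp orc I mark (\<lambda>m'. \<forall>u<n. m' ''X'' u \<noteq> 0 \<longleftrightarrow> (\<exists>l<k. m ''P'' (m ''o'' 0 + u) = m ''C'' l))
    (n * (k * 100 + 100) + 100) 0 m"
  unfolding mark_def
proof (rule wp_ForI[where L = n and Tb = "k * 100 + 60" and Qb = 0 and
      Inv = "\<lambda>i m'. \<forall>u<i. m' ''X'' u \<noteq> 0 \<longleftrightarrow> (\<exists>l<k. m ''P'' (m ''o'' 0 + u) = m ''C'' l)"], goal_cases)
  case (5 i m1)
  let ?h = "\<lambda>u. m ''P'' (m ''o'' 0 + u)"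
  show ?case
    apply (rule wp_seqI, rule wp_straight, simp)
      apply (rule wp_For[where L = k and Tb = 60 and Qb = 0 and
        Inv = "\<lambda>j m'. (\<forall>u<i. m' ''X'' u \<noteq> 0 \<longleftrightarrow> (\<exists>l<k. ?h u = m ''C'' l)) \<and>
        (m' ''X'' i \<noteq> 0 \<longleftrightarrow> (\<exists>l<j. ?h i = m ''C'' l))"])
    subgoal by simp
    subgoal by simp
    subgoal using 5 m by (simp add: params_def)
    subgoal using 5 by (simp add: upd_apply)
    subgoal for j m2
      apply (rule wp_straightI)
      subgoal by simp
      subgoal using 5 by (simp add: upd_apply less_Suc_eq) blast
      subgoal by simp
      subgoal by simp
      done
    subgoal using 5 by (auto simp: upd_apply less_Suc_eq)
    by simp_all
qed (use m in \<open>simp_all add: params_def algebra_simps\<close>)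

lemma wp_order_check:
  assumes m: "params m"
  shows "wp orc I order_check
    (\<lambda>m'. m' ''y'' 0 \<noteq> 0 \<longleftrightarrow> m ''y'' 0 \<noteq> 0 \<and> (\<forall>l<k. m ''C'' (l - 1) \<le> m ''C'' l))
    (k * 100 + 100) 0 m"
  unfolding order_check_def
proof (rule wp_ForI[where L = k and Tb = 60 and Qb = 0 and
      Inv = "\<lambda>i m'. m' ''y'' 0 \<noteq> 0 \<longleftrightarrow> m ''y'' 0 \<noteq> 0 \<and> (\<forall>l<i. m ''C'' (l - 1) \<le> m ''C'' l)"], goal_cases)
  case (5 i m1)
  show ?case
    apply (rule wp_straightI)
    subgoal by simp
    subgoal using 5 by (auto simp: upd_apply less_Suc_eq)
    by simp_all
qed (use m in \<open>simp_all add: params_def\<close>)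

lemma wp_test:
  assumes m: "params m"
  shows "wp orc I test
    (\<lambda>m'. m' ''y'' 0 \<noteq> 0 \<longleftrightarrow> (\<forall>l<k. m ''C'' (l - 1) \<le> m ''C'' l) \<and>
       dec {u. u < n \<and> (\<exists>l<k. m ''P'' (m ''o'' 0 + u) = m ''C'' l)})
    (n * (k * 100 + 101) + k * 100 + \<tau> + 210) 1 m"
  unfolding test_def
  apply (rule wp_seqI)
    apply (rule wp_frame[OF wp_mark[OF m]])
    apply (rule wp_seq)
    apply (rule wp_Query)
    apply (rule wp_frame[OF wp_order_check])
  subgoal for m1
    using m by (simp add: params_def mark_def)
  subgoal premises prems for m1 m2
  proof -
    have X: "{u. u < n \<and> 0 < m1 ''X'' u} = {u. u < n \<and> (\<exists>l<k. m ''P'' (m ''o'' 0 + u) = m ''C'' l)}"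
      using prems(1) by auto
    have C: "m1 ''C'' = m ''C''" using prems(2)[of "''C''"] by (simp add: mark_def)
    show ?thesis using prems(3) by (auto simp: X C upd_apply)
  qed
  by (simp_all add: algebra_simps)

lemma wp_decode:
  assumes m: "params m" and d: "m ''d'' 0 = length rs" "k = 0 \<Longrightarrow> rs = []"
    and a: "\<And>j. j < length rs \<Longrightarrow> m ''a'' j = of_bool (rev rs ! j)"
  shows "wp orc I decode
    (\<lambda>m'. (\<forall>l<k. m' ''C'' l = cval k rs l) \<and> m' ''i'' 0 = length rs mod k \<and>
       m' ''o'' 0 = (length rs div k) * n)
    (k * 100 + length rs * 100 + 100) 0 m"
proof -
  \<comment> \<open>The ancestor at depth \<open>j\<close>: its surplus later bits stand at the head
    of the list. The loop decodes one more bit of the path per iteration.\<close>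
  let ?d = "\<lambda>j. drop (length rs - j) rs"
  have loop: "wp orc I (Seq (Seq (Set ''i'' (Const 0)) (Set ''o'' (Const 0)))
       (For ''j'' (Var ''d'')
         (Seq (Assign ''C'' (Var ''i'') (Plus (Plus (Cell ''C'' (Var ''i'')) (Cell ''C'' (Var ''i''))) (Cell ''a'' (Var ''j''))))
         (Seq (Set ''i'' (Plus (Var ''i'') (Const 1)))
         (If (Minus (Var ''k'') (Var ''i'')) Skip
           (Seq (Set ''i'' (Const 0)) (Set ''o'' (Plus (Var ''o'') (Var ''n''))))))))) (\<lambda>m'. (\<forall>l<k. m' ''C'' l = cval k rs l) \<and> m' ''i'' 0 = length rs mod k \<and>
       m' ''o'' 0 = (length rs div k) * n) (length rs * 100 + 40) 0 m1"
    if m1: "\<forall>l<k. m1 ''C'' l = 0" "\<And>a. a \<notin> {''l'', ''C''} \<Longrightarrow> m1 a = m a" for m1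
    apply (rule wp_seqI, rule wp_straight, simp)
    apply (rule wp_For[where L = "length rs" and Tb = 70 and Qb = 0 and
      Inv = "\<lambda>j m'. (\<forall>l<k. m' ''C'' l = cval k (?d j) l) \<and> m' ''i'' 0 = j mod k \<and>
       m' ''o'' 0 = (j div k) * n"])
    subgoal by simp
    subgoal by simp
    subgoal using m1 d by simp
    subgoal using m1 by (simp add: upd_apply)
    subgoal premises p for j m2
    proof -
      have k: "k > 0" using d(2) p(1) by (cases "k = 0") auto
      define rs' where "rs' = ?d j"
      have dS: "?d (Suc j) = rev rs ! j # rs'"
        unfolding rs'_def using Cons_nth_drop_Suc[of "length rs - Suc j" rs] p(1)
        by (simp add: rev_nth Suc_diff_Suc)
      have len: "length rs' = j" using p(1) by (simp add: rs'_def)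
      have aj: "m2 ''a'' j = of_bool (rev rs ! j)" using p(1,4) m1(2) a by simp
      have nk: "m2 ''n'' 0 = n" "m2 ''k'' 0 = k" using p(4) m1(2) m by (simp_all add: params_def)
      have jk: "j mod k < k" using k by simp
      show ?thesis
        apply (rule wp_straightI)
        subgoal by simp
        subgoal using p(2)[folded rs'_def] p(3) jk
          apply (simp add: upd_apply dS len aj nk)
          apply (auto simp: mod_Suc div_Suc mult_2)
          done
        by simp_all
    qed
    subgoal by simp
    by simp_all
  show ?thesis
    unfolding decode_def
    apply (rule wp_seqI)
      apply (rule wp_frame)
       apply (rule wp_For[where L = k and Tb = 10 and Qb = 0 and
        Inv = "\<lambda>i m'. \<forall>l<i. m' ''C'' l = 0"])
    subgoal by simp
    subgoal by simp
    subgoal using m by (simp add: params_def)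
    subgoal by simp
    subgoal for i m1
      apply (rule wp_straightI)
      subgoal by simp
      subgoal by (auto simp: upd_apply less_Suc_eq)
      by simp_all
      apply assumption
     apply (rule loop)
    subgoal by simp
    subgoal by simp
    by simp_all
qed

text \<open>The simulation relation between memories and \<open>dfs\<close> states. Row
  \<open>t\<close> of \<open>P\<close> holds all prefixes of length \<open>t\<close>, so the set for
  an oracle call is found by mere comparison.\<close>

definition repr :: "(nat \<Rightarrow> nat) \<Rightarrow> bool list \<times> bool \<times> nat \<Rightarrow> mem \<Rightarrow> bool" where
  "repr code = (\<lambda>(rs, b, q) m. params m \<and> m ''z'' 0 = T * k \<and> length rs \<le> T * k \<and>
     m ''d'' 0 = length rs \<and> (\<forall>j<length rs. m ''a'' j = of_bool (rev rs ! j)) \<and>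
     m ''s'' 0 = of_bool b \<and> m ''q'' 0 = q \<and>
     (\<forall>t\<le>T. \<forall>u<n. m ''P'' (t * n + u) = code u div 2 ^ (T - t)))"

definition body_time :: nat where
  "body_time = n * (k * 100 + 101) + k * 200 + T * k * 100 + \<tau> + 600"

lemma wp_test_viable:
  assumes m: "params m" and P: "\<And>t u. t \<le> T \<Longrightarrow> u < n \<Longrightarrow> m ''P'' (t * n + u) = code u div 2 ^ (T - t)"
    and C: "\<And>l. l < k \<Longrightarrow> m ''C'' l = cval k rs l" and i: "m ''i'' 0 = length rs mod k"
    and o: "m ''o'' 0 = (length rs div k) * n" and y: "m ''y'' 0 = 1" and len: "length rs \<le> T * k"
  shows "wp orc I (If (Var ''i'') Skip test) (\<lambda>m'. m' ''y'' 0 \<noteq> 0 \<longleftrightarrow> viable dec n k T code rs)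
    (n * (k * 100 + 101) + k * 100 + \<tau> + 220) 1 m"
proof -
  have t: "length rs div k \<le> T" using div_le_mono[OF len, of k] by (cases "k = 0") auto
  have X: "{u. u < n \<and> (\<exists>l<k. m ''P'' (m ''o'' 0 + u) = m ''C'' l)} =
      sel n k T code (length rs div k) (cval k rs)"
    using P[OF t] C o by (auto simp: sel_def)
  have C': "(\<forall>l<k. m ''C'' (l - 1) \<le> m ''C'' l) \<longleftrightarrow> (\<forall>l<k. cval k rs (l - 1) \<le> cval k rs l)"
    using C by (simp add: less_imp_diff_less)
  show ?thesis
    apply (rule wp_ifI)
       apply (rule wp_straight)
    subgoal by simp
    subgoal using i y by (simp add: viable_def)
      apply (rule wp_frame[OF wp_test[OF m]])
    subgoal using i unfolding X C' by (simp add: viable_def good_def)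
    by simp_all
qed

lemma wp_descend:
  assumes r: "repr code (rs, False, q) m"
  shows "wp orc I descend (repr code (dfs (viable dec n k T code) (T * k) (rs, False, q)))
    body_time 1 m"
proof -
  let ?v = "viable dec n k T code rs"
  have m: "params m" "length rs \<le> T * k"
    and P: "\<And>t u. t \<le> T \<Longrightarrow> u < n \<Longrightarrow> m ''P'' (t * n + u) = code u div 2 ^ (T - t)"
    using r by (auto simp: repr_def)
  let ?end = "If (Var ''y'')
       (If (Minus (Var ''z'') (Var ''d''))
         (Seq (Assign ''a'' (Var ''d'') (Const 0)) (Set ''d'' (Plus (Var ''d'') (Const 1))))
         (Seq (Set ''q'' (Plus (Var ''q'') (Const 1))) (Set ''s'' (Const 1))))
       (Set ''s'' (Const 1))"
  have final: "wp orc I ?end (repr code (dfs (viable dec n k T code) (T * k) (rs, False, q))) 60 0 m1"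
    if y: "m1 ''y'' 0 \<noteq> 0 \<longleftrightarrow> ?v" and fr: "\<And>a. a \<notin> {''y'', ''X'', ''u'', ''l'', ''C'', ''i'', ''o'', ''j''} \<Longrightarrow> m1 a = m a"
    for m1
  proof (rule wp_straightI)
    have "m1 ''z'' 0 = T * k" "m1 ''d'' 0 = length rs" "m1 ''q'' 0 = q" "m1 ''s'' 0 = 0"
      "m1 ''n'' 0 = n" "m1 ''k'' 0 = k" "m1 ''P'' = m ''P''" "m1 ''a'' = m ''a''"
      using r by (simp_all add: fr repr_def params_def)
    then show "repr code (dfs (viable dec n k T code) (T * k) (rs, False, q)) (ev I ?end m1)"
      using r y by (auto simp: repr_def params_def upd_apply nth_append less_Suc_eq)
  qed simp_all
  show ?thesis
    unfolding descend_def
    apply (rule wp_seqI)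
      apply (rule wp_frame)
       apply (rule wp_decode[OF m(1), of rs])
    subgoal using r by (simp add: repr_def)
    subgoal using m(2) by simp
    subgoal using r by (simp add: repr_def)
      apply (rule wp_seq, rule wp_straight, simp)
      apply (rule wp_seq)
      apply (rule wp_frame)
       apply (rule wp_test_viable[where code = code and rs = rs])
    subgoal using m(1) by (simp add: params_def decode_def)
    subgoal using P by (simp add: decode_def)
    subgoal by simp
    subgoal by simp
    subgoal by simp
    subgoal by (simp add: upd_apply)
    subgoal by (rule m(2))
      apply (rule final)
    subgoal by simp
    subgoal by (simp add: decode_def test_def mark_def order_check_def upd_def)
    subgoal using m(2) by (simp add: body_time_def algebra_simps)
    by simp
qed

lemma wp_backtrack:
  assumes r: "repr code (rs, True, q) m"
  shows "wp orc I backtrack (repr code (dfs (viable dec n k T code) (T * k) (rs, True, q)))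
    100 0 m"
proof (rule wp_straightI)
  show "repr code (dfs (viable dec n k T code) (T * k) (rs, True, q)) (ev I backtrack m)"
  proof (cases rs)
    case Nil
    then show ?thesis using r by (simp add: repr_def backtrack_def)
  next
    case (Cons b rs')
    then have "m ''a'' (length rs') = of_bool b" "\<forall>j<length rs'. m ''a'' j = of_bool (rev rs' ! j)"
      "m ''d'' 0 = Suc (length rs')"
      using r by (auto simp: repr_def nth_append)
    then show ?thesis
      using r unfolding Cons
      by (cases b) (auto simp: repr_def params_def backtrack_def upd_apply nth_append less_Suc_eq)
  qed
qed (simp_all add: backtrack_def)

lemma wp_body:
  assumes r: "repr code s m"
  shows "wp orc I (If (Var ''s'') backtrack descend) (repr code (dfs (viable dec n k T code) (T * k) s))
    (body_time + 110) 1 m"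
proof -
  obtain rs b q where s: "s = (rs, b, q)" by (cases s)
  then have b: "m ''s'' 0 = of_bool b" using r by (simp add: repr_def)
  show ?thesis
    apply (rule wp_ifI[where ?T1.0 = 100 and ?Q1.0 = 0 and ?T2.0 = body_time and ?Q2.0 = 1])
    subgoal using wp_backtrack[of code rs q m] r b s by (cases b) auto
    subgoal using wp_descend[of code rs q m] r b s by (cases b) auto
    by simp_all
qed

lemma wp_traverse:
  assumes m: "params m" "m ''z'' 0 = T * k" "m ''w'' 0 = B"
    and P: "\<And>t u. t \<le> T \<Longrightarrow> u < n \<Longrightarrow> m ''P'' (t * n + u) = code u div 2 ^ (T - t)"
  shows "wp orc I traverse
    (repr code ((dfs (viable dec n k T code) (T * k) ^^ B) ([], False, 0)))
    (B * (body_time + 130) + 50) B m"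
  unfolding traverse_def
  apply (rule wp_seqI, rule wp_straight, simp)
    apply (rule wp_For[where L = B and Tb = "body_time + 110" and Qb = 1 and
      Inv = "\<lambda>i. repr code ((dfs (viable dec n k T code) (T * k) ^^ i) ([], False, 0))"])
  subgoal by (simp add: descend_def backtrack_def decode_def test_def mark_def order_check_def)
  subgoal by (simp add: descend_def backtrack_def decode_def test_def mark_def order_check_def)
  subgoal using m by simp
  subgoal using m P by (simp add: repr_def params_def upd_apply)
  subgoal for i m1
    apply (rule wp_frame[OF wp_body])
     apply assumption
    apply (simp add: repr_def params_def split: prod.splits)
    done
    apply assumption
  by (simp_all add: algebra_simps)

lemma wp_collide:
  assumes m: "params m"
  shows "wp orc I collide (\<lambda>m'. m' ''g'' 0 = 0 \<longleftrightarrow> inj_on (m ''E'') {..<n}) (n * (n * 100 + 100) + 100) 0 m"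
proof -
  let ?E = "m ''E''"
  have inj: "inj_on ?E {..<Suc i} \<longleftrightarrow> inj_on ?E {..<i} \<and> (\<forall>v<i. ?E i \<noteq> ?E v)" for i
    by (auto simp: lessThan_Suc)
  show ?thesis
    unfolding collide_def
    apply (rule wp_seqI, rule wp_straight, simp)
      apply (rule wp_For[where L = n and Tb = "n * 100 + 50" and Qb = 0 and
        Inv = "\<lambda>i m'. m' ''g'' 0 = 0 \<longleftrightarrow> inj_on ?E {..<i}"])
    subgoal by simp
    subgoal by simp
    subgoal using m by (simp add: params_def)
    subgoal by (simp add: upd_apply)
    subgoal premises p for i m1
      apply (rule wp_ForI[where L = i and Tb = 60 and Qb = 0 and
        Inv = "\<lambda>j m'. m' ''g'' 0 = 0 \<longleftrightarrow> inj_on ?E {..<i} \<and> (\<forall>v<j. ?E i \<noteq> ?E v)"])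
      subgoal by simp
      subgoal by simp
      subgoal using p by simp
      subgoal using p by simp
      subgoal for j m2
        apply (rule wp_straightI)
        subgoal by simp
        subgoal using p by (simp add: upd_apply less_Suc_eq) blast
        by simp_all
      subgoal unfolding inj by simp
      subgoal using p(1) by simp
      by simp
    apply assumption
    by (simp_all add: algebra_simps)
qed

end

section \<open>Independent repetitions\<close>

text \<open>Doubling and adding a fresh bit generates the prefixes of one code in order of length,
  so that its whole column of \<open>P\<close> arises without division.\<close>

definition flips :: com where
  "flips = For ''t'' (Var ''T'') (Seq (Flip ''x'')
     (Seq (Set ''c'' (Plus (Plus (Var ''c'') (Var ''c'')) (Var ''x'')))
     (Seq (Set ''o'' (Plus (Var ''o'') (Var ''n''))) (Assign ''P'' (Var ''o'') (Var ''c'')))))"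

definition gen :: com where
  "gen = For ''u'' (Var ''n'')
     (Seq (Seq (Set ''c'' (Const 0)) (Seq (Set ''o'' (Var ''u'')) (Assign ''P'' (Var ''o'') (Const 0))))
     (Seq flips (Assign ''E'' (Var ''u'') (Var ''c''))))"

text \<open>A count is accepted only from a finished search back at the root with distinct codes,
  which are the conditions under which it is exact.\<close>

definition conclude :: com where
  "conclude = If (Var ''s'') (If (Var ''d'') Skip (If (Var ''g'') Skip
     (Seq (Set ''f'' (Const 1)) (Set ''out'' (Var ''q''))))) Skip"

definition attempt :: com where
  "attempt = Seq gen (Seq collide (Seq traverse conclude))"

section \<open>Uniform independent codes from coin flips\<close>

lemma pair_pmf_of_set:
  assumes "finite A" "A \<noteq> {}" "finite B" "B \<noteq> {}"
  shows "pair_pmf (pmf_of_set A) (pmf_of_set B) = pmf_of_set (A \<times> B)"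
proof (rule pmf_eqI)
  fix x
  show "pmf (pair_pmf (pmf_of_set A) (pmf_of_set B)) x = pmf (pmf_of_set (A \<times> B)) x"
    using assms by (cases x) (simp add: pmf_pair card_cartesian_product indicator_def)
qed

text \<open>A number below \<open>2 ^ Suc t\<close> is the same as its half together with its
  parity, so the uniform distribution on pairs is carried over by a bijection.\<close>

lemma unif_double:
  "bind_pmf (pmf_of_set {..<2 ^ t}) (\<lambda>c. map_pmf (\<lambda>b. 2 * c + of_bool b) (bernoulli_pmf (1 / 2))) =
     pmf_of_set {..<2 ^ Suc t :: nat}"
proof -
  let ?f = "\<lambda>(c, b). 2 * c + of_bool b :: nat"
  have ne: "{..<2 ^ t :: nat} \<noteq> {}" by (simp add: lessThan_empty_iff)
  have "bind_pmf (pmf_of_set {..<2 ^ t}) (\<lambda>c. map_pmf (\<lambda>b. 2 * c + of_bool b) (bernoulli_pmf (1 / 2))) =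
      map_pmf ?f (pair_pmf (pmf_of_set {..<2 ^ t}) (pmf_of_set UNIV))"
    by (simp add: pair_pmf_def map_bind_pmf map_pmf_def bind_assoc_pmf bind_return_pmf
        bernoulli_pmf_half_conv_pmf_of_set)
  also have "\<dots> = map_pmf ?f (pmf_of_set ({..<2 ^ t} \<times> UNIV))"
    using ne by (subst pair_pmf_of_set) auto
  also have "\<dots> = pmf_of_set (?f ` ({..<2 ^ t} \<times> UNIV))"
  proof (rule map_pmf_of_set_inj)
    show "inj_on ?f ({..<2 ^ t} \<times> UNIV)"
      by (auto simp: inj_on_def split: if_splits; presburger)
  qed (use ne in auto)
  also have "?f ` ({..<2 ^ t} \<times> UNIV) = {..<2 ^ Suc t}"
  proof (intro subset_antisym subsetI)
    fix v :: nat assume "v \<in> {..<2 ^ Suc t}"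
    then show "v \<in> ?f ` ({..<2 ^ t} \<times> UNIV)"
      by (intro image_eqI[of _ _ "(v div 2, odd v)"]) auto
  qed (auto split: if_splits)
  finally show ?thesis .
qed

context search
begin

text \<open>Writes are confined to column \<open>u\<close>, the indices congruent to
  \<open>u\<close> modulo \<open>n\<close>; this preserves the columns of elements treated
  earlier.\<close>

lemma runs_flips:
  assumes m: "params m" "m ''T'' 0 = T" "m ''c'' 0 = 0" "m ''o'' 0 = u" "m ''P'' u = 0" and u: "u < n"
  shows "\<exists>p. runs orc I flips m (T * 100 + 100) 0 p \<and>
    map_pmf (\<lambda>m'. m' ''c'' 0) p = pmf_of_set {..<2 ^ T} \<and>
    (\<forall>m'\<in>set_pmf p. (\<forall>t\<le>T. m' ''P'' (t * n + u) = m' ''c'' 0 div 2 ^ (T - t)) \<and>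
      m' ''c'' 0 < 2 ^ T \<and> (\<forall>j. j mod n \<noteq> u \<longrightarrow> m' ''P'' j = m ''P'' j))"
proof -
  let ?S = "Seq (Set ''c'' (Plus (Plus (Var ''c'') (Var ''c'')) (Var ''x'')))
     (Seq (Set ''o'' (Plus (Var ''o'') (Var ''n''))) (Assign ''P'' (Var ''o'') (Var ''c'')))"
  define B where "B m = map_pmf (\<lambda>b. ev I ?S (upd m ''x'' 0 (of_bool b))) (bernoulli_pmf (1/2))" for m
  define Inv where "Inv t m' \<longleftrightarrow> m' ''o'' 0 = t * n + u \<and> m' ''c'' 0 < 2 ^ t \<and>
      (\<forall>t'\<le>t. m' ''P'' (t' * n + u) = m' ''c'' 0 div 2 ^ (t - t')) \<and>
      (\<forall>j. j mod n \<noteq> u \<longrightarrow> m' ''P'' j = m ''P'' j)" for t and m' :: mem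
  have r: "runs orc I (Seq (Flip ''x'') ?S) m' 60 0 (B m')" for m'
  proof -
    have "runs orc I (Seq (Flip ''x'') ?S) m' (1 + 1 + scost ?S) (0 + 0)
      (bind_pmf (map_pmf (\<lambda>b. upd m' ''x'' 0 (of_bool b)) (bernoulli_pmf (1/2))) (\<lambda>m. return_pmf (ev I ?S m)))"
      by (intro runs_seq runs_flip runs_straight) simp
    then show ?thesis
      unfolding B_def by (auto simp: map_pmf_def bind_assoc_pmf bind_return_pmf intro: runs_weaken)
  qed
  have step: "Inv (Suc t) (upd m2 ''t'' 0 (Suc t))"
    if I: "Inv t m1" "m1 ''n'' 0 = n" and B: "m2 \<in> set_pmf (B m1)" for t m1 m2
  proof -
    obtain b where m2: "m2 = ev I ?S (upd m1 ''x'' 0 (of_bool b))" using B by (auto simp: B_def)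
    define c where "c = 2 * m1 ''c'' 0 + of_bool b"
    have m2': "m2 ''o'' 0 = Suc t * n + u" "m2 ''c'' 0 = c"
      "m2 ''P'' j = (if j = Suc t * n + u then c else m1 ''P'' j)" for j
      using I by (auto simp: Inv_def m2 c_def upd_apply)
    \<comment> \<open>Appending a bit leaves all shorter prefixes unchanged, so the earlier rows
      remain correct for the longer code.\<close>
    have div: "c div 2 ^ (Suc t - t') = m1 ''c'' 0 div 2 ^ (t - t')" if "t' \<le> t" for t'
      using that by (simp add: c_def Suc_diff_le div_mult2_eq)
    have ne: "t' * n + u \<noteq> Suc t * n + u" if "t' \<le> t" for t'
      using mult_le_mono1[OF that, of n] u unfolding mult_Suc by linarith
    have "c < 2 ^ Suc t" using I by (simp add: Inv_def c_def)
    moreover have "m2 ''P'' (t' * n + u) = c div 2 ^ (Suc t - t')" if "t' \<le> Suc t" for t'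
    proof (cases "t' = Suc t")
      case True
      then show ?thesis by (simp add: m2'(3))
    next
      case False
      with that have "t' \<le> t" by simp
      then show ?thesis using I(1) div ne by (simp add: m2'(3) Inv_def)
    qed
    moreover have "m2 ''P'' j = m ''P'' j" if "j mod n \<noteq> u" for j
    proof -
      have "(Suc t * n + u) mod n = u" using u by (simp del: mult_Suc)
      with that have "j \<noteq> Suc t * n + u" by blast
      then show ?thesis using that I(1) by (simp add: m2'(3) Inv_def)
    qed
    ultimately show ?thesis using m2'(1,2) by (simp add: Inv_def)
  qed
  note vars = runs_For[where orc = orc and I = I and e = "Var ''T''" and x = "''t''" and c = "Seq (Flip ''x'') ?S" and
      L = T and Inv = Inv and m = m and Tb = 60 and Qb = 0 and B = "\<lambda>_. B"]
  have init: "Inv 0 (upd m ''t'' 0 0)" using m by (simp add: Inv_def)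
  let ?p = "\<lambda>t. floop ''t'' (\<lambda>_. B) t 0 (upd m ''t'' 0 0)"
  have body: "runs orc I (Seq (Flip ''x'') ?S) m1 60 0 (B m1) \<and>
      (\<forall>m2\<in>set_pmf (B m1). Inv (Suc i) (upd m2 ''t'' 0 (Suc i)))"
    if "Inv i m1" "\<And>a. a \<notin> insert ''t'' (mods (Seq (Flip ''x'') ?S)) \<Longrightarrow> m1 a = m a" for i m1
  proof -
    have "m1 ''n'' 0 = n" using that(2)[of "''n''"] m by (simp add: params_def)
    then show ?thesis using r step that(1) by blast
  qed
  have 1: "runs orc I flips m (T * (60 + 2 + 11) + 2 + 8) (T * 0) (?p T)"
    unfolding flips_def using vars(1) body init m by simp
  have 2: "Inv T m'" if "m' \<in> set_pmf (?p T)" for m'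
    using vars(2)[of T m'] body init m that by simp
  have 3: "map_pmf (\<lambda>m'. m' ''c'' 0) (?p t) = pmf_of_set {..<2 ^ t}" for t
  proof (induction t)
    case 0
    have "{..<Suc 0} = {0}" by auto
    then show ?case using m by (simp add: pmf_of_set_singleton)
  next
    case (Suc t)
    have "map_pmf (\<lambda>m'. m' ''c'' 0) (?p (Suc t)) =
        bind_pmf (?p t) (\<lambda>m1. map_pmf (\<lambda>b. 2 * m1 ''c'' 0 + of_bool b) (bernoulli_pmf (1/2)))"
      unfolding floop_Suc B_def by (simp add: map_bind_pmf map_pmf_comp upd_apply mult_2)
    also have "\<dots> = bind_pmf (map_pmf (\<lambda>m'. m' ''c'' 0) (?p t))
        (\<lambda>c. map_pmf (\<lambda>b. 2 * c + of_bool b) (bernoulli_pmf (1/2)))"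
      by (simp add: bind_map_pmf)
    finally show ?case by (simp only: Suc unif_double)
  qed
  show ?thesis
    using runs_weaken[OF 1] 2 3[of T] by (intro exI[of _ "?p T"]) (auto simp: Inv_def)
qed

lemma runs_gen_body:
  assumes m: "params m" "m ''T'' 0 = T" "m ''u'' 0 = u" and u: "u < n"
  shows "\<exists>p. runs orc I (Seq (Seq (Set ''c'' (Const 0)) (Seq (Set ''o'' (Var ''u'')) (Assign ''P'' (Var ''o'') (Const 0))))
     (Seq flips (Assign ''E'' (Var ''u'') (Var ''c'')))) m (T * 100 + 150) 0 p \<and>
    map_pmf (\<lambda>m'. m' ''E'' u) p = pmf_of_set {..<2 ^ T} \<and>
    (\<forall>m'\<in>set_pmf p. (\<forall>t\<le>T. m' ''P'' (t * n + u) = m' ''E'' u div 2 ^ (T - t)) \<and>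
      m' ''E'' u < 2 ^ T \<and> (\<forall>j. j mod n \<noteq> u \<longrightarrow> m' ''P'' j = m ''P'' j) \<and>
      (\<forall>j. j \<noteq> u \<longrightarrow> m' ''E'' j = m ''E'' j))"
proof -
  let ?S = "Seq (Set ''c'' (Const 0)) (Seq (Set ''o'' (Var ''u'')) (Assign ''P'' (Var ''o'') (Const 0)))"
  let ?A = "Assign ''E'' (Var ''u'') (Var ''c'')"
  let ?m = "ev I ?S m"
  obtain p where p: "runs orc I flips ?m (T * 100 + 100) 0 p"
    "map_pmf (\<lambda>m'. m' ''c'' 0) p = pmf_of_set {..<2 ^ T}"
    "\<And>m' t. m' \<in> set_pmf p \<Longrightarrow> t \<le> T \<Longrightarrow> m' ''P'' (t * n + u) = m' ''c'' 0 div 2 ^ (T - t)"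
    "\<And>m'. m' \<in> set_pmf p \<Longrightarrow> m' ''c'' 0 < 2 ^ T"
    "\<And>m' j. m' \<in> set_pmf p \<Longrightarrow> j mod n \<noteq> u \<Longrightarrow> m' ''P'' j = ?m ''P'' j"
    using runs_flips[of ?m u] m u by (auto simp: params_def upd_apply)
  have fr: "m' ''E'' = m ''E''" "m' ''u'' 0 = u" if "m' \<in> set_pmf p" for m'
    using runs_frame[OF p(1) that, of "''E''"] runs_frame[OF p(1) that, of "''u''"] m
    by (simp_all add: flips_def upd_apply)
  let ?q = "map_pmf (ev I ?A) p"
  have "runs orc I (Seq flips ?A) ?m (1 + (T * 100 + 100) + scost ?A) (0 + 0)
      (bind_pmf p (\<lambda>m. return_pmf (ev I ?A m)))"
    by (rule runs_seq[OF p(1) runs_straight]) simp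
  then have "runs orc I (Seq ?S (Seq flips ?A)) m (1 + scost ?S + (1 + (T * 100 + 100) + scost ?A)) (0 + (0 + 0))
      (bind_pmf (return_pmf ?m) (\<lambda>_. ?q))"
    by (intro runs_seq runs_straight) (simp_all add: map_pmf_def)
  then have "runs orc I (Seq ?S (Seq flips ?A)) m (T * 100 + 150) 0 ?q"
    by (auto simp: bind_return_pmf intro: runs_weaken)
  moreover have "map_pmf (\<lambda>m'. m' ''E'' u) ?q = map_pmf (\<lambda>m'. m' ''c'' 0) p"
    unfolding map_pmf_comp using fr by (intro map_pmf_cong) (auto simp: upd_apply)
  moreover have "(\<forall>t\<le>T. m' ''P'' (t * n + u) = m' ''E'' u div 2 ^ (T - t)) \<and>
      m' ''E'' u < 2 ^ T \<and> (\<forall>j. j mod n \<noteq> u \<longrightarrow> m' ''P'' j = m ''P'' j) \<and>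
      (\<forall>j. j \<noteq> u \<longrightarrow> m' ''E'' j = m ''E'' j)" if "m' \<in> set_pmf ?q" for m'
  proof -
    obtain m1 where m1: "m1 \<in> set_pmf p" "m' = upd m1 ''E'' u (m1 ''c'' 0)"
      using \<open>m' \<in> _\<close> fr by auto
    have "m1 ''P'' j = m ''P'' j" if "j mod n \<noteq> u" for j
    proof -
      have "j \<noteq> u" using that u by auto
      then show ?thesis using p(5)[OF m1(1) that] m(3) by (simp add: upd_apply)
    qed
    then show ?thesis using p(3,4)[OF m1(1)] fr(1)[OF m1(1)] by (simp add: m1(2) upd_apply)
  qed
  ultimately show ?thesis using p(2) by (intro exI[of _ ?q]) simp
qed

lemma runs_gen:
  assumes m: "params m" "m ''T'' 0 = T"
  shows "\<exists>p. runs orc I gen m (n * (T * 100 + 200) + 100) 0 p \<and>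
    map_pmf (\<lambda>m' u. if u < n then m' ''E'' u else 0) p = codes n T \<and>
    (\<forall>m'\<in>set_pmf p. \<forall>u<n. m' ''E'' u < 2 ^ T \<and>
      (\<forall>t\<le>T. m' ''P'' (t * n + u) = m' ''E'' u div 2 ^ (T - t)))"
proof -
  let ?c = "Seq (Seq (Set ''c'' (Const 0)) (Seq (Set ''o'' (Var ''u'')) (Assign ''P'' (Var ''o'') (Const 0))))
     (Seq flips (Assign ''E'' (Var ''u'') (Var ''c'')))"
  define R where "R u m p \<longleftrightarrow> runs orc I ?c m (T * 100 + 150) 0 p \<and>
    map_pmf (\<lambda>m'. m' ''E'' u) p = pmf_of_set {..<2 ^ T} \<and>
    (\<forall>m'\<in>set_pmf p. (\<forall>t\<le>T. m' ''P'' (t * n + u) = m' ''E'' u div 2 ^ (T - t)) \<and>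
      m' ''E'' u < 2 ^ T \<and> (\<forall>j. j mod n \<noteq> u \<longrightarrow> m' ''P'' j = m ''P'' j) \<and>
      (\<forall>j. j \<noteq> u \<longrightarrow> m' ''E'' j = m ''E'' j))" for u m p
  \<comment> \<open>The distribution of the body depends on the memory it starts from and is known
    only through its properties.\<close>
  define B where "B u m = (SOME p. R u m p)" for u m
  have B: "R u m1 (B u m1)" if "u < n" "m1 ''u'' 0 = u" "\<And>a. a \<notin> insert ''u'' (mods ?c) \<Longrightarrow> m1 a = m a" for u m1
  proof -
    have "params m1" "m1 ''T'' 0 = T"
      using that(3)[of "''n''"] that(3)[of "''k''"] that(3)[of "''T''"] m
      by (simp_all add: flips_def params_def)
    then show ?thesis
      unfolding B_def using runs_gen_body[of m1 u] that(1,2) by (intro someI_ex[of "R u m1"]) (auto simp: R_def)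
  qed
  define Inv where "Inv i m' \<longleftrightarrow> (\<forall>u<i. u < n \<longrightarrow> m' ''E'' u < 2 ^ T \<and>
      (\<forall>t\<le>T. m' ''P'' (t * n + u) = m' ''E'' u div 2 ^ (T - t)))" for i and m' :: mem
  have body: "runs orc I ?c m1 (T * 100 + 150) 0 (B i m1) \<and>
      (\<forall>m2\<in>set_pmf (B i m1). Inv (Suc i) (upd m2 ''u'' 0 (Suc i)))"
    if "i < n" "Inv i m1" "m1 ''u'' 0 = i" "\<And>a. a \<notin> insert ''u'' (mods ?c) \<Longrightarrow> m1 a = m a" for i m1
  proof -
    note R = B[OF that(1,3,4), unfolded R_def]
    have "Inv (Suc i) (upd m2 ''u'' 0 (Suc i))" if m2: "m2 \<in> set_pmf (B i m1)" for m2
    proof -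
      have R': "\<And>t. t \<le> T \<Longrightarrow> m2 ''P'' (t * n + i) = m2 ''E'' i div 2 ^ (T - t)" "m2 ''E'' i < 2 ^ T"
        "\<And>j. j mod n \<noteq> i \<Longrightarrow> m2 ''P'' j = m1 ''P'' j" "\<And>j. j \<noteq> i \<Longrightarrow> m2 ''E'' j = m1 ''E'' j"
        using R m2 by blast+
      have "m2 ''E'' u < 2 ^ T \<and> (\<forall>t\<le>T. m2 ''P'' (t * n + u) = m2 ''E'' u div 2 ^ (T - t))"
        if "u < Suc i" "u < n" for u
      proof (cases "u = i")
        case True
        then show ?thesis using R'(1,2) by blast
      next
        case False
        have "(t * n + u) mod n \<noteq> i" for t using False that by simp
        then show ?thesis
          using \<open>Inv i m1\<close> R'(3,4) False that by (simp add: Inv_def)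
      qed
      then show ?thesis by (simp add: Inv_def)
    qed
    then show ?thesis using R by blast
  qed
  note loop = runs_For[where orc = orc and I = I and e = "Var ''n''" and x = "''u''" and c = ?c and
      L = n and Inv = Inv and m = m and Tb = "T * 100 + 150" and Qb = 0 and B = B]
  let ?p = "\<lambda>u. floop ''u'' B u 0 (upd m ''u'' 0 0)"
  have pre: "''n'' \<notin> mods ?c" "''u'' \<notin> mods ?c" "aval I m (Var ''n'') = n" "Inv 0 (upd m ''u'' 0 0)"
    using m by (simp_all add: flips_def params_def Inv_def)
  have 1: "runs orc I gen m (n * (T * 100 + 150 + 2 + 11) + 2 + 8) (n * 0) (?p n)"
  proof -
    have "runs orc I gen m (n * (T * 100 + 150 + ecost (Var ''n'') + 11) + ecost (Var ''n'') + 8) (n * 0) (?p n)"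
      unfolding gen_def
    proof (rule loop(1), goal_cases)
      case 1
      show ?case using pre(1) by simp
    qed (fact pre | rule body; assumption)+
    then show ?thesis by (simp add: numeral_2_eq_2)
  qed
  have 2: "Inv i m' \<and> m' ''u'' 0 = i \<and> (\<forall>a. a \<notin> insert ''u'' (mods ?c) \<longrightarrow> m' a = m a)"
    if "m' \<in> set_pmf (?p i)" "i \<le> n" for m' i
  proof (rule loop(2), goal_cases)
    case 1
    show ?case using pre(1) by simp
  qed (fact pre that | rule body; assumption)+
  \<comment> \<open>Entries not yet drawn are masked by 0, the default of \<open>Pi_pmf\<close>; the
    array itself may still hold codes of an earlier attempt.\<close>
  let ?key = "\<lambda>u m' v. if v < u then m' ''E'' v else (0::nat)"
  have 3: "map_pmf (?key u) (?p u) = Pi_pmf {..<u} 0 (\<lambda>_. pmf_of_set {..<2 ^ T})" if "u \<le> n" for u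
    using that
  proof (induction u)
    case 0
    then show ?case by simp
  next
    case (Suc u)
    have "map_pmf (?key (Suc u)) (?p (Suc u)) =
        bind_pmf (?p u) (\<lambda>m1. map_pmf (\<lambda>m2. ?key (Suc u) (upd m2 ''u'' 0 (Suc u))) (B u m1))"
      unfolding floop_Suc by (simp add: map_bind_pmf map_pmf_comp)
    \<comment> \<open>The new entry has the same distribution whatever the memory \<open>m1\<close>,
      which is its independence from the entries drawn before.\<close>
    also have "\<dots> = bind_pmf (?p u) (\<lambda>m1. map_pmf (\<lambda>e. (?key u m1)(u := e)) (pmf_of_set {..<2 ^ T}))"
    proof (intro bind_pmf_cong refl)
      fix m1 assume m1: "m1 \<in> set_pmf (?p u)"
      have R: "R u m1 (B u m1)" using 2[OF m1] Suc.prems by (intro B) auto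
      have "map_pmf (\<lambda>m2. ?key (Suc u) (upd m2 ''u'' 0 (Suc u))) (B u m1) =
          map_pmf (\<lambda>m2. (?key u m1)(u := m2 ''E'' u)) (B u m1)"
        using R unfolding R_def by (intro map_pmf_cong refl) (auto simp: fun_eq_iff)
      also have "\<dots> = map_pmf (\<lambda>e. (?key u m1)(u := e)) (map_pmf (\<lambda>m2. m2 ''E'' u) (B u m1))"
        by (simp add: map_pmf_comp)
      finally show "map_pmf (\<lambda>m2. ?key (Suc u) (upd m2 ''u'' 0 (Suc u))) (B u m1) =
          map_pmf (\<lambda>e. (?key u m1)(u := e)) (pmf_of_set {..<2 ^ T})"
        using R by (simp add: R_def)
    qed
    also have "\<dots> = bind_pmf (map_pmf (?key u) (?p u)) (\<lambda>f. map_pmf (\<lambda>e. f(u := e)) (pmf_of_set {..<2 ^ T}))"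
      by (simp add: bind_map_pmf)
    also have "\<dots> = Pi_pmf {..<Suc u} 0 (\<lambda>_. pmf_of_set {..<2 ^ T})"
      using Suc by (simp add: lessThan_Suc Pi_pmf_insert' map_pmf_def bind_commute_pmf[of "pmf_of_set _"])
    finally show ?case .
  qed
  show ?thesis
    using runs_weaken[OF 1] 2[of _ n] 3[of n]
    by (intro exI[of _ "?p n"]) (auto simp: Inv_def codes_def algebra_simps)
qed

end

section \<open>Parameters of the search and the complete program\<close>

definition setup_com :: "nat \<Rightarrow> com" where
  "setup_com M =
     Seq (Seq (Set ''p'' (Const 1)) (Set ''T'' (Const 2)))
     (Seq (For ''j'' (Var ''n'') (If (Minus (Var ''n'') (Var ''p''))
        (Seq (Set ''p'' (Plus (Var ''p'') (Var ''p''))) (Set ''T'' (Plus (Var ''T'') (Const 2)))) Skip))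
     (Seq (Set ''b'' (Const M))
     (Seq (For ''j'' (Var ''k'')
        (Set ''b'' (Plus (Plus (Plus (Plus (Var ''b'') (Var ''b'')) (Plus (Var ''b'') (Var ''b'')))
                               (Plus (Plus (Var ''b'') (Var ''b'')) (Plus (Var ''b'') (Var ''b''))))
                         (Plus (Plus (Plus (Var ''b'') (Var ''b'')) (Plus (Var ''b'') (Var ''b'')))
                               (Plus (Plus (Var ''b'') (Var ''b'')) (Plus (Var ''b'') (Var ''b'')))))))
     (Seq (Seq (Set ''w'' (Const 0)) (Set ''z'' (Const 0)))
     (Seq (For ''j'' (Var ''T'') (Seq (Set ''w'' (Plus (Var ''w'') (Var ''b'')))
        (Set ''z'' (Plus (Var ''z'') (Var ''k'')))))
     (Seq (Set ''w'' (Plus (Plus (Var ''w'') (Var ''w'')) (Plus (Var ''w'') (Var ''w''))))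
          (Set ''w'' (Plus (Const 4) (Plus (Plus (Var ''w'') (Var ''w'')) (Plus (Var ''w'') (Var ''w'')))))))))))"

text \<open>By truncated subtraction, \<open>more\<close> becomes nonzero exactly if the accepted
  count exceeds \<open>M\<close>.\<close>

definition finish :: "nat \<Rightarrow> com" where
  "finish M = If (Var ''f'') (Set ''more'' (Minus (Var ''out'') (Const M))) (Set ''more'' (Const 1))"

definition algorithm :: "nat \<Rightarrow> nat \<Rightarrow> com" where
  "algorithm R M = Seq (setup_com M) (Seq (For ''r'' (Const R) attempt) (finish M))"

definition budget :: "nat \<Rightarrow> nat \<Rightarrow> nat \<Rightarrow> nat" where
  "budget T k M = 4 + 16 * (T * (16 ^ k * M))"

text \<open>All values arise by additions: \<open>p\<close> doubles up to \<open>n\<close>,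
  \<open>b\<close> is multiplied by 16 once per unit of \<open>k\<close>, and \<open>w\<close>
  finally becomes 4 plus 16 times itself. The condition \<open>2 ^ (l - 1) < n\<close> records that
  doubling stopped in time; from it follow \<open>l \<le> log 2 n + 1\<close> for the calls and
  \<open>l \<le> n\<close> for the time.\<close>

lemma wp_setup:
  fixes I :: inst
  defines "n \<equiv> usize I" and "k \<equiv> param I"
  assumes m: "m ''n'' 0 = n" "m ''k'' 0 = k"
  shows "wp orc I (setup_com M)
    (\<lambda>m'. \<exists>l. n \<le> 2 ^ l \<and> (l = 0 \<or> 2 ^ (l - 1) < n) \<and> m' ''T'' 0 = 2 * l + 2 \<and>
      m' ''z'' 0 = (2 * l + 2) * k \<and> m' ''w'' 0 = budget (2 * l + 2) k M)
    (n * 300 + k * 300 + 600) 0 m"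
proof -
  let ?lev = "\<lambda>m'. \<exists>l. n \<le> 2 ^ l \<and> (l = 0 \<or> 2 ^ (l - 1) < n) \<and> m' ''T'' 0 = 2 * l + 2"
  have second: "wp orc I (Seq (Set ''b'' (Const M))
     (Seq (For ''j'' (Var ''k'')
        (Set ''b'' (Plus (Plus (Plus (Plus (Var ''b'') (Var ''b'')) (Plus (Var ''b'') (Var ''b'')))
                               (Plus (Plus (Var ''b'') (Var ''b'')) (Plus (Var ''b'') (Var ''b''))))
                         (Plus (Plus (Plus (Var ''b'') (Var ''b'')) (Plus (Var ''b'') (Var ''b'')))
                               (Plus (Plus (Var ''b'') (Var ''b'')) (Plus (Var ''b'') (Var ''b'')))))))
     (Seq (Seq (Set ''w'' (Const 0)) (Set ''z'' (Const 0)))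
     (Seq (For ''j'' (Var ''T'') (Seq (Set ''w'' (Plus (Var ''w'') (Var ''b'')))
        (Set ''z'' (Plus (Var ''z'') (Var ''k'')))))
     (Seq (Set ''w'' (Plus (Plus (Var ''w'') (Var ''w'')) (Plus (Var ''w'') (Var ''w''))))
          (Set ''w'' (Plus (Const 4) (Plus (Plus (Var ''w'') (Var ''w'')) (Plus (Var ''w'') (Var ''w''))))))))))
    (\<lambda>m'. \<exists>l. n \<le> 2 ^ l \<and> (l = 0 \<or> 2 ^ (l - 1) < n) \<and> m' ''T'' 0 = 2 * l + 2 \<and>
      m' ''z'' 0 = (2 * l + 2) * k \<and> m' ''w'' 0 = budget (2 * l + 2) k M)
     (n * 120 + k * 120 + 350) 0 m1"
    if "?lev m1" and m1: "m1 ''n'' 0 = n" "m1 ''k'' 0 = k" for m1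
  proof -
    obtain l where l: "n \<le> 2 ^ l" "l = 0 \<or> 2 ^ (l - 1) < n" "m1 ''T'' 0 = 2 * l + 2"
      using \<open>?lev m1\<close> by blast
    have "l \<le> n"
    proof (cases l)
      case (Suc l')
      have "l' < 2 ^ l'" by (rule less_exp)
      moreover have "2 ^ l' < n" using l(2) Suc by simp
      ultimately show ?thesis using Suc by linarith
    qed simp
    show ?thesis
      apply (rule wp_seqI, rule wp_straight, simp)
        apply (rule wp_seq)
        apply (rule wp_frame)
         apply (rule wp_For[where L = k and Tb = 100 and Qb = 0 and Inv = "\<lambda>i m'. m' ''b'' 0 = 16 ^ i * M"])
      subgoal by simp
      subgoal by simp
      subgoal using m1 by simp
      subgoal by (simp add: upd_apply)
      subgoal for i m2
        apply (rule wp_straightI)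
        by (simp_all add: upd_apply)
        apply assumption
        apply (rule wp_seq, rule wp_straight, simp)
        apply (rule wp_seq)
        apply (rule wp_For[where L = "2 * l + 2" and Tb = 30 and Qb = 0 and
          Inv = "\<lambda>i m'. m' ''w'' 0 = i * (16 ^ k * M) \<and> m' ''z'' 0 = i * k \<and> m' ''T'' 0 = 2 * l + 2"])
      subgoal by simp
      subgoal by simp
      subgoal using l by (simp add: upd_apply)
      subgoal using l by (simp add: upd_apply)
      subgoal for m2 i m3
        apply (rule wp_straightI)
        using m1 by (simp_all add: upd_apply)
        apply (rule wp_straight)
      subgoal by simp
      subgoal using l by (intro exI[of _ l]) (simp add: upd_apply budget_def algebra_simps)
      subgoal using \<open>l \<le> n\<close> by (simp add: algebra_simps)
      by simp
  qed
  show ?thesis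
    unfolding setup_com_def
    apply (rule wp_seqI, rule wp_straight, simp)
      apply (rule wp_seq)
      apply (rule wp_frame[where Post = ?lev])
       \<comment> \<open>Either doubling has stopped, or it happened in each of the \<open>i\<close>
         iterations; \<open>n\<close> iterations suffice since \<open>n \<le> 2 ^ n\<close>.\<close>
       apply (rule wp_For[where L = n and Tb = 60 and Qb = 0 and
        Inv = "\<lambda>i m'. \<exists>l. m' ''p'' 0 = 2 ^ l \<and> m' ''T'' 0 = 2 * l + 2 \<and>
          (l = 0 \<or> 2 ^ (l - 1) < n) \<and> (n \<le> 2 ^ l \<or> l = i)"])
    subgoal by simp
    subgoal by simp
    subgoal using m by simp
    subgoal by (intro exI[of _ 0]) (simp add: upd_apply)
    subgoal premises p for i m1
    proof -
      obtain l where l: "m1 ''p'' 0 = 2 ^ l" "m1 ''T'' 0 = 2 * l + 2"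
        "l = 0 \<or> 2 ^ (l - 1) < n" "n \<le> 2 ^ l \<or> l = i" using p(2) by blast
      have n: "m1 ''n'' 0 = n" using p(4) m by simp
      show ?thesis
      proof (rule wp_straightI, goal_cases)
        case 2
        show ?case
        proof (cases "n \<le> 2 ^ l")
          case True
          then show ?thesis using l n by (intro exI[of _ l]) (simp add: upd_apply)
        next
          case False
          then show ?thesis using l n by (intro exI[of _ "Suc l"]) (simp add: upd_apply)
        qed
      qed simp_all
    qed
    subgoal premises p for m1
    proof -
      obtain l where l: "m1 ''p'' 0 = 2 ^ l" "m1 ''T'' 0 = 2 * l + 2"
        "l = 0 \<or> 2 ^ (l - 1) < n" "n \<le> 2 ^ l \<or> l = n" using p(1) by blast
      moreover have "n \<le> 2 ^ n" using less_exp[of n] by simp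
      ultimately show "?lev m1" by (intro exI[of _ l]) auto
    qed
      apply (rule second)
    subgoal by assumption
    subgoal using m by simp
    subgoal using m by simp
    subgoal by simp
    by simp
qed

section \<open>Success and soundness of repeated attempts\<close>

lemma prob_bind_le:
  assumes "\<And>x. x \<in> set_pmf p \<Longrightarrow> measure_pmf.prob (f x) F \<le> c * indicator G x" "0 \<le> c"
  shows "measure_pmf.prob (bind_pmf p f) F \<le> c * measure_pmf.prob p G"
proof -
  have "ennreal (measure_pmf.prob (bind_pmf p f) F) = (\<integral>\<^sup>+x. ennreal (measure_pmf.prob (f x) F) \<partial>p)"
    by (simp add: measure_pmf.emeasure_eq_measure[symmetric])
  also have "\<dots> \<le> (\<integral>\<^sup>+x. ennreal c * indicator G x \<partial>p)"
  proof (intro nn_integral_mono_AE AE_pmfI)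
    fix x assume "x \<in> set_pmf p"
    from assms(1)[OF this] show "ennreal (measure_pmf.prob (f x) F) \<le> ennreal c * indicator G x"
      using assms(2) by (cases "x \<in> G") (auto simp: measure_le_0_iff intro: ennreal_leI)
  qed
  also have "\<dots> = ennreal (c * measure_pmf.prob p G)"
    using assms(2) by (simp add: nn_integral_cmult measure_pmf.emeasure_eq_measure ennreal_mult)
  finally show ?thesis using assms(2) by simp
qed

text \<open>The array \<open>E\<close> may hold anything beyond \<open>n\<close>, whereas a sample
  of \<open>codes\<close> is 0 there; neither the search nor the oracle sees the difference.\<close>

lemma viable_cong:
  assumes "\<And>u. u < n \<Longrightarrow> code u = code' u"
  shows "viable dec n k T code = viable dec n k T code'"
proof -
  have "sel n k T code = sel n k T code'" using assms by (auto simp: sel_def fun_eq_iff)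
  then show ?thesis by (simp add: viable_def good_def fun_eq_iff)
qed

context search
begin

text \<open>The invariant of the repetitions: on every outcome of the coins, a raised flag
  \<open>f\<close> certifies that \<open>out\<close> is the exact number.\<close>

definition ready :: "nat \<Rightarrow> mem \<Rightarrow> bool" where
  "ready B m \<longleftrightarrow> params m \<and> m ''T'' 0 = T \<and> m ''z'' 0 = T * k \<and> m ''w'' 0 = B \<and>
     (m ''f'' 0 \<noteq> 0 \<longrightarrow> m ''out'' 0 = card Ws)"

definition lucky :: "nat \<Rightarrow> (nat \<Rightarrow> nat) \<Rightarrow> bool" where
  "lucky B code \<longleftrightarrow> inj_on code {..<n} \<and> tsize (viable dec n k T code) (T * k) [] \<le> B"

text \<open>Once the codes are drawn, the rest of an attempt is deterministic. Luck matters only for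
  raising the flag; soundness, contained in \<open>ready\<close>, holds for all codes, by
  \<open>dfs_sound\<close> and \<open>card_leaves\<close>.\<close>

lemma wp_search:
  assumes m: "ready B m"
    and code: "\<And>u. u < n \<Longrightarrow> m ''E'' u < 2 ^ T"
      "\<And>u t. u < n \<Longrightarrow> t \<le> T \<Longrightarrow> m ''P'' (t * n + u) = m ''E'' u div 2 ^ (T - t)"
  shows "wp orc I (Seq collide (Seq traverse conclude))
    (\<lambda>m'. ready B m' \<and> (m ''f'' 0 \<noteq> 0 \<or> lucky B (m ''E'') \<longrightarrow> m' ''f'' 0 \<noteq> 0))
    (n * (n * 100 + 100) + B * (body_time + 130) + 300) B m"
proof -
  let ?s = "(dfs (viable dec n k T (m ''E'')) (T * k) ^^ B) ([], False, 0)"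
  have fin: "wp orc I conclude
      (\<lambda>m'. ready B m' \<and> (m ''f'' 0 \<noteq> 0 \<or> lucky B (m ''E'') \<longrightarrow> m' ''f'' 0 \<noteq> 0)) 50 0 m2"
    if g: "m2 ''g'' 0 = 0 \<longleftrightarrow> inj_on (m ''E'') {..<n}" and r: "repr (m ''E'') ?s m2"
      and fr: "\<And>a. a \<in> {''n'', ''k'', ''T'', ''z'', ''w'', ''f'', ''out''} \<Longrightarrow> m2 a = m a" for m2
  proof (rule wp_straightI)
    obtain rs b q where s: "?s = (rs, b, q)" by (cases ?s)
    have m2: "m2 ''s'' 0 = of_bool b" "m2 ''d'' 0 = length rs" "m2 ''q'' 0 = q"
      using r unfolding s by (simp_all add: repr_def)
    have sound: "q = card Ws" if "rs = []" "b" "inj_on (m ''E'') {..<n}"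
    proof -
      have "?s = ([], True, q)" using s that by simp
      then have "q = card (live T (m ''E'') (T * k))" by (rule dfs_sound)
      also have "\<dots> = card Ws" by (rule card_leaves[OF that(3) code(1)])
      finally show ?thesis .
    qed
    have complete: "rs = [] \<and> b" if "lucky B (m ''E'')"
      using dfs_complete[where yes = "viable dec n k T (m ''E'')" and D = "T * k" and B = B] that s
      by (simp add: lucky_def)
    have *: "ready B m2" "m2 ''f'' = m ''f''" using m fr by (simp_all add: ready_def params_def)
    show "ready B (ev I conclude m2) \<and>
        (m ''f'' 0 \<noteq> 0 \<or> lucky B (m ''E'') \<longrightarrow> ev I conclude m2 ''f'' 0 \<noteq> 0)"
    proof (cases "b \<and> rs = [] \<and> inj_on (m ''E'') {..<n}")
      case True
      then have "q = card Ws" "m2 ''g'' 0 = 0" using sound g by blast+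
      moreover from this have "ev I conclude m2 = upd (upd m2 ''f'' 0 1) ''out'' 0 q"
        using True m2 by (simp add: conclude_def)
      ultimately show ?thesis using *(1) by (simp add: ready_def params_def upd_apply)
    next
      case False
      moreover have "inj_on (m ''E'') {..<n}" if "lucky B (m ''E'')" using that by (simp add: lucky_def)
      ultimately have "\<not> lucky B (m ''E'')" using complete by blast
      moreover have "m2 ''s'' 0 = 0 \<or> m2 ''d'' 0 \<noteq> 0 \<or> m2 ''g'' 0 \<noteq> 0"
      proof (cases "b \<and> rs = []")
        case True
        then show ?thesis using False g by blast
      next
        case False
        then show ?thesis using m2(1,2) by auto
      qed
      then have "ev I conclude m2 = m2" by (auto simp: conclude_def)
      ultimately show ?thesis using * by simp
    qed
  qed (simp_all add: conclude_def)
  have m': "params m" "m ''z'' 0 = T * k" "m ''w'' 0 = B" using m by (simp_all add: ready_def)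
  have mods: "mods collide = {''g'', ''u'', ''v''}"
    "mods traverse = {''d'', ''s'', ''q'', ''h'', ''a'', ''l'', ''C'', ''i'', ''o'', ''j'', ''y'', ''u'', ''X''}"
    by (auto simp: collide_def traverse_def descend_def backtrack_def decode_def test_def mark_def order_check_def)
  show ?thesis
    apply (rule wp_seqI)
      apply (rule wp_frame[OF wp_collide[OF m'(1)]])
      apply (rule wp_seq)
      apply (rule wp_frame)
       apply (rule wp_traverse[where B = B and code = "m ''E''"])
    subgoal using m' by (simp add: mods params_def)
    subgoal using m' by (simp add: mods)
    subgoal using m' by (simp add: mods)
    subgoal using code(2) by (simp add: mods)
      apply (rule fin)
    subgoal premises p for m1 m2
      using p(1) p(4)[of "''g''"] by (simp add: mods)
    subgoal by assumption
    subgoal premises p for m1 m2 a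
    proof -
      have "a \<notin> mods collide" "a \<notin> mods traverse" using p(5) unfolding mods by auto
      then show ?thesis using p(2)[of a] p(4)[of a] by simp
    qed
    by simp_all
qed

definition attempt_time :: "nat \<Rightarrow> nat" where
  "attempt_time B = n * (T * 100 + 200) + n * (n * 100 + 100) + B * (body_time + 130) + 500"

lemma runs_attempt:
  assumes m: "ready B m"
  shows "\<exists>p. runs orc I attempt m (attempt_time B) B p \<and>
    (\<forall>m'\<in>set_pmf p. ready B m' \<and> (m ''f'' 0 \<noteq> 0 \<longrightarrow> m' ''f'' 0 \<noteq> 0)) \<and>
    measure_pmf.prob (codes n T) {code. lucky B code} \<le> measure_pmf.prob p {m'. m' ''f'' 0 \<noteq> 0}"
proof -
  obtain p where p: "runs orc I gen m (n * (T * 100 + 200) + 100) 0 p"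
    "map_pmf (\<lambda>m' u. if u < n then m' ''E'' u else 0) p = codes n T"
    "\<And>m' u. m' \<in> set_pmf p \<Longrightarrow> u < n \<Longrightarrow> m' ''E'' u < 2 ^ T"
    "\<And>m' u t. m' \<in> set_pmf p \<Longrightarrow> u < n \<Longrightarrow> t \<le> T \<Longrightarrow> m' ''P'' (t * n + u) = m' ''E'' u div 2 ^ (T - t)"
    using runs_gen[of m] m unfolding ready_def by blast
  let ?c = "Seq collide (Seq traverse conclude)"
  let ?t = "n * (n * 100 + 100) + B * (body_time + 130) + 300"
  have fr: "m1 a = m a" if "m1 \<in> set_pmf p" "a \<in> {''n'', ''k'', ''T'', ''z'', ''w'', ''f'', ''out''}" for m1 a
    using runs_frame[OF p(1) that(1), of a] that(2) by (auto simp: gen_def flips_def)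
  have "\<exists>m'. runs orc I ?c m1 ?t B (return_pmf m') \<and> ready B m' \<and>
      (m1 ''f'' 0 \<noteq> 0 \<or> lucky B (m1 ''E'') \<longrightarrow> m' ''f'' 0 \<noteq> 0)" if "m1 \<in> set_pmf p" for m1
  proof -
    have "ready B m1" using m fr[OF that] by (simp add: ready_def params_def)
    from wp_search[OF this] p(3,4)[OF that] show ?thesis unfolding wp_def by blast
  qed
  then obtain g where g: "\<And>m1. m1 \<in> set_pmf p \<Longrightarrow> runs orc I ?c m1 ?t B (return_pmf (g m1))"
    "\<And>m1. m1 \<in> set_pmf p \<Longrightarrow> ready B (g m1)"
    "\<And>m1. m1 \<in> set_pmf p \<Longrightarrow> m1 ''f'' 0 \<noteq> 0 \<or> lucky B (m1 ''E'') \<Longrightarrow> g m1 ''f'' 0 \<noteq> 0"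
    by metis
  have "runs orc I attempt m (1 + (n * (T * 100 + 200) + 100) + ?t) (0 + B) (bind_pmf p (\<lambda>m1. return_pmf (g m1)))"
    unfolding attempt_def by (rule runs_seq[OF p(1) g(1)])
  then have run: "runs orc I attempt m (attempt_time B) B (map_pmf g p)"
    unfolding map_pmf_def by (rule runs_weaken) (simp_all add: attempt_time_def)
  have "measure_pmf.prob (codes n T) {code. lucky B code} =
      measure_pmf.prob p {m1. lucky B (\<lambda>u. if u < n then m1 ''E'' u else 0)}"
    unfolding p(2)[symmetric] by (simp add: vimage_def)
  also have "\<dots> = measure_pmf.prob p {m1. lucky B (m1 ''E'')}"
  proof -
    have "lucky B (\<lambda>u. if u < n then code u else 0) = lucky B code" for code
      using viable_cong[of n "\<lambda>u. if u < n then code u else 0" code dec k T]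
      by (simp add: lucky_def inj_on_def)
    then show ?thesis by simp
  qed
  also have "\<dots> \<le> measure_pmf.prob p {m1. g m1 ''f'' 0 \<noteq> 0}"
    using g(3) by (intro measure_pmf.finite_measure_mono_AE) (auto simp: AE_measure_pmf_iff)
  also have "\<dots> = measure_pmf.prob (map_pmf g p) {m'. m' ''f'' 0 \<noteq> 0}"
    by (simp add: vimage_def)
  finally show ?thesis
    using run g fr by (intro exI[of _ "map_pmf g p"]) auto
qed

text \<open>The guarantee of an attempt holds from every \<open>ready\<close> memory, so failure
  probabilities multiply although the attempts share their memory.\<close>

lemma runs_attempts:
  assumes m: "ready B m" and half: "measure_pmf.prob (codes n T) {code. lucky B code} \<ge> \<epsilon>" "0 \<le> \<epsilon>" "\<epsilon> \<le> 1"
  shows "\<exists>p. runs orc I (For ''r'' (Const R) attempt) m (R * (attempt_time B + 12) + 9) (R * B) p \<and>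
    (\<forall>m'\<in>set_pmf p. ready B m') \<and> measure_pmf.prob p {m'. m' ''f'' 0 = 0} \<le> (1 - \<epsilon>) ^ R"
proof -
  define Q where "Q m p \<longleftrightarrow> runs orc I attempt m (attempt_time B) B p \<and>
    (\<forall>m'\<in>set_pmf p. ready B m' \<and> (m ''f'' 0 \<noteq> 0 \<longrightarrow> m' ''f'' 0 \<noteq> 0)) \<and>
    measure_pmf.prob (codes n T) {code. lucky B code} \<le> measure_pmf.prob p {m'. m' ''f'' 0 \<noteq> 0}" for m p
  define A where "A m = (SOME p. Q m p)" for m
  have A: "Q m (A m)" if "ready B m" for m
    unfolding A_def using runs_attempt[OF that] by (intro someI_ex[of "Q m"]) (simp add: Q_def)
  have mods: "mods attempt = {''u'', ''c'', ''o'', ''P'', ''t'', ''x'', ''E'', ''g'', ''v'', ''d'', ''s'', ''q'', ''h'',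
      ''a'', ''l'', ''C'', ''i'', ''j'', ''y'', ''X'', ''f'', ''out''}"
    by (auto simp: attempt_def gen_def flips_def conclude_def collide_def traverse_def descend_def
        backtrack_def decode_def test_def mark_def order_check_def)
  have upd_ready: "ready B (upd m' ''r'' 0 i) \<longleftrightarrow> ready B m'" for m' i
    by (simp add: ready_def params_def)
  let ?p = "\<lambda>i. floop ''r'' (\<lambda>_. A) i 0 (upd m ''r'' 0 0)"
  have pre: "evars (Const R) \<inter> insert ''r'' (mods attempt) = {}" "''r'' \<notin> mods attempt"
    "aval I m (Const R) = R" "ready B (upd m ''r'' 0 0)"
    using m by (simp_all add: mods upd_ready)
  have body: "runs orc I attempt m1 (attempt_time B) B (A m1) \<and>
      (\<forall>m2\<in>set_pmf (A m1). ready B (upd m2 ''r'' 0 (Suc i)))" if "ready B m1" for m1 i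
    using A[OF that] unfolding Q_def upd_ready by blast
  have 1: "runs orc I (For ''r'' (Const R) attempt) m
      (R * (attempt_time B + ecost (Const R) + 11) + ecost (Const R) + 8) (R * B) (?p R)"
    by (rule runs_For(1)[where Inv = "\<lambda>_. ready B"]) (fact pre | rule body; assumption)+
  have 2: "ready B m'" if "m' \<in> set_pmf (?p i)" "i \<le> R" for m' i
    using runs_For(2)[where Inv = "\<lambda>_. ready B" and B = "\<lambda>_. A", OF pre body that(2,1)] by blast
  have 3: "measure_pmf.prob (?p i) {m'. m' ''f'' 0 = 0} \<le> (1 - \<epsilon>) ^ i" if "i \<le> R" for i
    using that
  proof (induction i)
    case (Suc i)
    let ?F = "{m' :: mem. m' ''f'' 0 = 0}"
    \<comment> \<open>A flag once raised stays raised, so failing now requires having failed before,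
      and then costs a further factor \<open>1 - \<epsilon>\<close>.\<close>
    have F: "measure_pmf.prob (A m1) ?F \<le> (1 - \<epsilon>) * indicator ?F m1" if "m1 \<in> set_pmf (?p i)" for m1
    proof -
      have Q: "Q m1 (A m1)" using 2[OF that] Suc.prems by (intro A) simp
      show ?thesis
      proof (cases "m1 ''f'' 0 = 0")
        case True
        have "- {m' :: mem. m' ''f'' 0 \<noteq> 0} = ?F" by auto
        then have "measure_pmf.prob (A m1) ?F = 1 - measure_pmf.prob (A m1) {m'. m' ''f'' 0 \<noteq> 0}"
          using measure_pmf.prob_compl[of "{m'. m' ''f'' 0 \<noteq> 0}" "A m1"] by (simp add: Compl_eq_Diff_UNIV)
        then show ?thesis using True Q half by (simp add: Q_def)
      next
        case False
        then have "measure_pmf.prob (A m1) ?F = 0"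
          using Q by (auto simp: Q_def measure_pmf_zero_iff)
        then show ?thesis using False by simp
      qed
    qed
    have "measure_pmf.prob (?p (Suc i)) ?F \<le> (1 - \<epsilon>) * measure_pmf.prob (?p i) ?F"
      unfolding floop_Suc using F half by (intro prob_bind_le) (simp_all add: vimage_def)
    also have "\<dots> \<le> (1 - \<epsilon>) * (1 - \<epsilon>) ^ i" using Suc half by (intro mult_left_mono) auto
    finally show ?case by simp
  qed simp
  have "runs orc I (For ''r'' (Const R) attempt) m (R * (attempt_time B + 12) + 9) (R * B) (?p R)"
    using 1 by (rule runs_weaken) simp_all
  then show ?thesis using 2[of _ R] 3[of R] by (intro exI[of _ "?p R"]) simp
qed

end

section \<open>Resource bounds\<close>

definition total_time :: "nat \<Rightarrow> nat \<Rightarrow> nat \<Rightarrow> nat \<Rightarrow> nat \<Rightarrow> nat \<Rightarrow> nat" where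
  "total_time n k \<tau> T R B = n * 300 + k * 300 + 700 +
     R * (n * (T * 100 + 200) + n * (n * 100 + 100) +
          B * (n * (k * 100 + 101) + k * 200 + T * k * 100 + \<tau> + 730) + 512)"

lemma runs_algorithm:
  fixes I :: inst
  defines "n \<equiv> usize I" and "k \<equiv> param I"
  assumes "search Ws I orc \<tau>"
  obtains p l where "n \<le> 2 ^ l" "l = 0 \<or> 2 ^ (l - 1) < n"
    "runs orc I (algorithm R M) (init I X)
       (total_time n k \<tau> (2 * l + 2) R (budget (2 * l + 2) k M)) (R * budget (2 * l + 2) k M) p"
    "card Ws \<le> M \<Longrightarrow> measure_pmf.prob p {m. answer_of m = Exactly (card Ws)} \<ge> 1 - (1 / 2) ^ R"
    "\<And>m. M < card Ws \<Longrightarrow> m \<in> set_pmf p \<Longrightarrow> answer_of m = MoreThanM"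
proof -
  let ?m = "init I X"
  have "wp orc I (setup_com M)
    (\<lambda>m'. \<exists>l. n \<le> 2 ^ l \<and> (l = 0 \<or> 2 ^ (l - 1) < n) \<and> m' ''T'' 0 = 2 * l + 2 \<and>
      m' ''z'' 0 = (2 * l + 2) * k \<and> m' ''w'' 0 = budget (2 * l + 2) k M)
    (n * 300 + k * 300 + 600) 0 ?m"
    unfolding n_def k_def by (rule wp_setup) (simp_all add: init_def)
  then obtain m1 l where m1: "runs orc I (setup_com M) ?m (n * 300 + k * 300 + 600) 0 (return_pmf m1)"
    and l: "n \<le> 2 ^ l" "l = 0 \<or> 2 ^ (l - 1) < n" "m1 ''T'' 0 = 2 * l + 2"
      "m1 ''z'' 0 = (2 * l + 2) * k" "m1 ''w'' 0 = budget (2 * l + 2) k M"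
    unfolding wp_def by blast
  interpret search Ws I orc \<tau> "2 * l + 2" by fact
  let ?B = "budget (2 * l + 2) k M"
  have fr: "m1 a = ?m a" if "a \<in> {''n'', ''k'', ''f''}" for a
    using runs_frame[OF m1, of m1 a] that by (auto simp: setup_com_def)
  have ready: "ready ?B m1"
    unfolding ready_def params_def using l fr by (simp add: n_def k_def init_def)
  \<comment> \<open>With more than \<open>M\<close> witnesses the budget promises nothing. Taking 0
    then lets one lemma provide the run and its soundness in both cases.\<close>
  define \<epsilon> where "\<epsilon> = (if card Ws \<le> M then 1 / 2 else 0 :: real)"
  have \<epsilon>: "0 \<le> \<epsilon>" "\<epsilon> \<le> 1" by (simp_all add: \<epsilon>_def)
  have half: "measure_pmf.prob (codes (usize I) (2 * l + 2)) {code. lucky ?B code} \<ge> \<epsilon>"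
  proof (cases "card Ws \<le> M")
    case True
    have "n * n \<le> 2 ^ l * 2 ^ l" using l(1) by (rule mult_le_mono) (rule l(1))
    then have "4 * (usize I * usize I) \<le> 2 ^ (2 * l + 2)"
      by (simp add: n_def power_add power_mult power2_eq_square power_mult_distrib[symmetric])
    from prob_success[OF this True budget_def] show ?thesis
      using True by (simp only: \<epsilon>_def lucky_def[abs_def] k_def if_True)
  qed (simp add: \<epsilon>_def)
  from runs_attempts[OF ready half \<epsilon>, of R] obtain p where
    p: "runs orc I (For ''r'' (Const R) attempt) m1 (R * (attempt_time ?B + 12) + 9) (R * ?B) p"
      "\<And>m. m \<in> set_pmf p \<Longrightarrow> ready ?B m"
      "measure_pmf.prob p {m. m ''f'' 0 = 0} \<le> (1 - \<epsilon>) ^ R"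
    by blast
  let ?q = "map_pmf (ev I (finish M)) p"
  have "runs orc I (Seq (For ''r'' (Const R) attempt) (finish M)) m1
      (1 + (R * (attempt_time ?B + 12) + 9) + scost (finish M)) (R * ?B + 0)
      (bind_pmf p (\<lambda>m. return_pmf (ev I (finish M) m)))"
    by (intro runs_seq[OF p(1)] runs_straight) (simp add: finish_def)
  then have "runs orc I (algorithm R M) ?m
     (1 + (n * 300 + k * 300 + 600) + (1 + (R * (attempt_time ?B + 12) + 9) + scost (finish M)))
     (0 + (R * ?B + 0)) (bind_pmf (return_pmf m1) (\<lambda>_. ?q))"
    unfolding algorithm_def by (intro runs_seq[OF m1]) (simp add: map_pmf_def)
  then have run: "runs orc I (algorithm R M) ?m (total_time n k \<tau> (2 * l + 2) R ?B) (R * ?B) ?q"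
    unfolding bind_return_pmf
  proof (rule runs_weaken)
    show "1 + (n * 300 + k * 300 + 600) + (1 + (R * (attempt_time ?B + 12) + 9) + scost (finish M)) \<le>
        total_time n k \<tau> (2 * l + 2) R ?B"
      unfolding total_time_def attempt_time_def body_time_def finish_def n_def k_def
      by (simp add: algebra_simps)
  qed simp
  have ans: "answer_of (ev I (finish M) m) =
      (if m ''f'' 0 \<noteq> 0 \<and> card Ws \<le> M then Exactly (card Ws) else MoreThanM)"
    if "ready ?B m" for m
  proof -
    have "m ''f'' 0 \<noteq> 0 \<Longrightarrow> m ''out'' 0 = card Ws" using that unfolding ready_def by blast
    then show ?thesis by (auto simp: answer_of_def finish_def upd_apply)
  qed
  show thesis
  proof (rule that[OF l(1,2) run])
    assume M: "card Ws \<le> M"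
    have "{m :: mem. m ''f'' 0 \<noteq> 0} = - {m. m ''f'' 0 = 0}" by auto
    then have "1 - (1 / 2) ^ R \<le> measure_pmf.prob p {m. m ''f'' 0 \<noteq> 0}"
      using p(3) M measure_pmf.prob_compl[of "{m. m ''f'' 0 = 0}" p]
      by (simp add: \<epsilon>_def Compl_eq_Diff_UNIV)
    also have "\<dots> \<le> measure_pmf.prob p {m. answer_of (ev I (finish M) m) = Exactly (card Ws)}"
      using ans p(2) M by (intro measure_pmf.finite_measure_mono_AE) (auto simp: AE_measure_pmf_iff)
    finally show "1 - (1 / 2) ^ R \<le> measure_pmf.prob ?q {m. answer_of m = Exactly (card Ws)}"
      by (simp add: vimage_def)
  next
    fix m assume "M < card Ws" "m \<in> set_pmf ?q"
    then show "answer_of m = MoreThanM" using ans p(2) by auto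
  qed
qed

section \<open>From program runs to calls, outputs and expected time\<close>

lemma calls_at_mostI:
  assumes "runs orc I c (init I (universe I)) T Q p" "real Q \<le> B"
  shows "calls_at_most orc I c B"
  using runs_final(1)[OF assms(1)] assms(2)
  unfolding calls_at_most_def run_def by (meson le_trans of_nat_mono order_trans)

lemma output_prob_ge:
  assumes "runs orc I c (init I (universe I)) T Q p"
  shows "measure_pmf.prob p {m. answer_of m = v} \<le> output_prob orc I c v"
proof -
  let ?run = "run orc I (universe I) c"
  obtain r where r: "map_pmf memory (?run r) = p" "\<forall>s\<in>set_pmf (?run r). todo s = []"
    using runs_final(2)[OF assms] unfolding run_def by blast
  have "measure_pmf.prob p {m. answer_of m = v} = measure_pmf.prob (?run r) {s. answer_of (memory s) = v}"
    unfolding r(1)[symmetric] by (simp add: vimage_def)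
  also have "\<dots> = measure_pmf.prob (?run r) (halted_with v)"
    using r(2) by (intro measure_pmf.finite_measure_eq_AE) (auto simp: AE_measure_pmf_iff halted_with_def)
  also have "\<dots> \<le> output_prob orc I c v"
    unfolding output_prob_def by (intro cSUP_upper bdd_aboveI2[where M = 1]) auto
  finally show ?thesis .
qed

lemma always_outputsI:
  assumes "runs orc I c (init I (universe I)) T Q p" "\<And>m. m \<in> set_pmf p \<Longrightarrow> answer_of m = v"
  shows "always_outputs orc I c v"
proof -
  obtain r where r: "map_pmf memory (run orc I (universe I) c r) = p"
    "\<forall>s\<in>set_pmf (run orc I (universe I) c r). todo s = []"
    using runs_final(2)[OF assms(1)] unfolding run_def by blast
  then show ?thesis
    using assms(2) unfolding always_outputs_def halted_with_def by (intro exI[of _ r]) auto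
qed

lemma expected_time_le:
  assumes "runs orc I c (init I (universe I)) T Q p"
  shows "expected_time orc I c \<le> of_nat T"
  unfolding expected_time_def
proof (rule SUP_least)
  fix r
  have "(\<integral>\<^sup>+ s. of_nat (clock s) \<partial>measure_pmf (run orc I (universe I) c r)) \<le>
      (\<integral>\<^sup>+ s. of_nat T \<partial>measure_pmf (run orc I (universe I) c r))"
    using runs_final(1)[OF assms] unfolding run_def by (intro nn_integral_mono_AE) (auto simp: AE_measure_pmf_iff)
  then show "(\<integral>\<^sup>+ s. of_nat (clock s) \<partial>measure_pmf (run orc I (universe I) c r)) \<le> of_nat T"
    by simp
qed

text \<open>Halted configurations are stationary, so running for the sum of both lengths reaches
  both results at once. This makes the description in \<open>subroutine\<close> well
  defined.\<close>

lemma computes_unique: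
  assumes "computes c I X v t" "computes c I X v' t'"
  shows "v = v'" "t = t'"
proof -
  let ?s = "\<lambda>r. steps (\<lambda>_. (False, 0)) I r (Config [c] (init I X) 0 0)"
  obtain r m q r' m' q' where 1: "?s r = return_pmf (Config [] m t q)" "m ''out'' 0 = v"
    and 2: "?s r' = return_pmf (Config [] m' t' q')" "m' ''out'' 0 = v'"
    using assms unfolding computes_def run_def by blast
  have "?s (r + r') = return_pmf (Config [] m t q)"
    by (simp add: steps_add 1 bind_return_pmf steps_halted)
  moreover have "?s (r' + r) = return_pmf (Config [] m' t' q')"
    by (simp add: steps_add 2 bind_return_pmf steps_halted)
  ultimately have "Config [] m t q = Config [] m' t' q'" by (simp add: add.commute)
  then show "v = v'" "t = t'" using 1(2) 2(2) by simp_all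
qed

text \<open>Every command advances the clock. Hence the time bound of a decision program forces
  \<open>g k \<ge> 1\<close> as soon as an instance with parameter \<open>k\<close> and
  \<open>n \<ge> 2\<close> exists, and lower-order terms can be absorbed into a product with
  \<open>g k\<close>.\<close>

lemma computes_time_pos:
  assumes "computes c I X v t"
  shows "t > 0"
proof -
  let ?o = "\<lambda>_. (False, 0)" and ?C = "Config [c] (init I X) 0 0"
  obtain r m q where r: "steps ?o I r ?C = return_pmf (Config [] m t q)"
    using assms unfolding computes_def run_def by blast
  then obtain r' where "r = Suc r'" by (cases r) auto
  with r obtain C where C: "C \<in> set_pmf (step ?o I ?C)" "Config [] m t q \<in> set_pmf (steps ?o I r' C)"
    by (metis UN_E set_bind_pmf set_return_pmf singletonI steps.simps(2))
  have "clock C > 0" using C(1) by (cases c) auto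
  with steps_mono[OF C(2)] show ?thesis by simp
qed

lemma subroutine_eq:
  assumes "computes D I X v t"
  shows "subroutine D I X = (v \<noteq> 0, t)"
  unfolding subroutine_def using assms computes_unique by (intro the_equality) blast+

text \<open>In \<open>32 ^ k\<close>, the budget supplies \<open>16 ^ k\<close>, and a further
  \<open>2 ^ k\<close> absorbs factors \<open>k\<close>. Of the two extra powers of
  \<open>n\<close>, one comes from \<open>T \<le> 3 * n\<close> in the budget, the other from
  scanning the universe in each search step. The numeral 81000 is \<open>52 * 1500\<close> for the
  searches plus a remainder for everything else.\<close>

lemma total_time_le:
  assumes n: "2 \<le> n" and "1 \<le> M" "1 \<le> G" "1 \<le> R" and T: "T \<le> 2 * n + 2"
  shows "total_time n k (G * n ^ d) T R (budget T k M) \<le> R * (81000 * (32 ^ k * n ^ (d + 2) * G * M))"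
proof -
  define S K q where "S = (16::nat) ^ k" and "K = (2::nat) ^ k" and "q = n ^ d"
  define Y where "Y = K * n * q * G"
  define Z where "Z = 32 ^ k * n ^ (d + 2) * G * M"
  have pos: "1 \<le> S" "1 \<le> q" "1 \<le> K" "k \<le> K" "1 \<le> n"
    using n by (simp_all add: S_def q_def K_def)
  have T3: "T \<le> 3 * n" using T n by simp
  have Z: "Z = Y * (n * S * M)"
  proof -
    have "(32::nat) ^ k = K * S" by (simp add: K_def S_def power_mult_distrib[symmetric])
    then show ?thesis by (simp add: Z_def Y_def q_def power_add power2_eq_square algebra_simps)
  qed
  have Y: "a * b * 1 * 1 \<le> Y" if "a \<le> K" "b \<le> n" for a b
    unfolding Y_def using that pos assms by (intro mult_le_mono) auto
  have Y': "k * n \<le> Y" "n \<le> Y" "k \<le> Y" "1 \<le> Y"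
    using Y[of k n] Y[of 1 n] Y[of k 1] Y[of 1 1] pos by simp_all
  have tau: "G * n ^ d \<le> Y"
    using mult_le_mono[of 1 "K * n" "q * G" "q * G"] pos by (simp add: Y_def q_def mult_ac)
  have Tk: "T * k \<le> 3 * Y"
  proof -
    have "T * k \<le> 3 * n * k" by (rule mult_le_mono1[OF T3])
    also have "\<dots> = 3 * (k * n)" by simp
    finally show ?thesis using Y'(1) by linarith
  qed
  have body: "n * (k * 100 + 101) + k * 200 + T * k * 100 + G * n ^ d + 730 \<le> 1500 * Y"
    using Y' tau Tk by (simp add: algebra_simps)
  have "1 \<le> n * S * M" using pos assms by simp
  moreover have "T * (16 ^ k * M) \<le> 3 * (n * S * M)"
    using mult_le_mono1[OF T3, of "S * M"] by (simp add: S_def mult_ac)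
  ultimately have B: "budget T k M \<le> 52 * (n * S * M)"
    unfolding budget_def by linarith
  have "budget T k M * (n * (k * 100 + 101) + k * 200 + T * k * 100 + G * n ^ d + 730) \<le>
      (52 * (n * S * M)) * (1500 * Y)"
    by (rule mult_le_mono[OF B body])
  then have main: "budget T k M * (n * (k * 100 + 101) + k * 200 + T * k * 100 + G * n ^ d + 730) \<le> 78000 * Z"
    by (simp add: Z mult_ac)
  have "Y * 1 \<le> Z" unfolding Z by (rule mult_le_mono2) fact
  moreover have "n * n \<le> Z"
    unfolding Z using pos assms Y'(2) mult_le_mono[of n Y n "n * S * M"] by simp
  moreover have "n * T \<le> 3 * (n * n)" using T3 by simp
  ultimately have Z': "n \<le> Z" "k \<le> Z" "1 \<le> Z" "n * T \<le> 3 * Z" "n * n \<le> Z" using Y' by linarith+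
  have "total_time n k (G * n ^ d) T R (budget T k M) \<le>
     1300 * Z + R * (n * (T * 100 + 200) + n * (n * 100 + 100) + 78000 * Z + 512)"
    unfolding total_time_def using Z' main
    by (intro add_mono mult_le_mono2) linarith+
  also have "n * (T * 100 + 200) + n * (n * 100 + 100) + 78000 * Z + 512 \<le> 79700 * Z"
    using Z' by (simp add: algebra_simps)
  finally have "total_time n k (G * n ^ d) T R (budget T k M) \<le> 1300 * Z + R * (79700 * Z)" by simp
  moreover have "1300 * Z \<le> R * (1300 * Z)" using mult_le_mono1[OF assms(4), of "1300 * Z"] by simp
  moreover have "R * (81000 * Z) = R * (1300 * Z) + R * (79700 * Z)" by (simp add: algebra_simps)
  ultimately show ?thesis unfolding Z_def[symmetric] by linarith
qed

theorem theorem10: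
  fixes P :: problem
  assumes "self_contained P"
  shows "\<exists>(A :: real \<Rightarrow> nat \<Rightarrow> com) (f :: nat \<Rightarrow> real) (h :: nat \<Rightarrow> real).
    f \<in> O(\<lambda>k. real k) \<and> h \<in> O(\<lambda>k. real k) \<and>
    (\<forall>\<delta> M I. 0 < \<delta> \<and> \<delta> \<le> 1 / 2 \<and> I \<in> instances P \<longrightarrow>
       (2 \<le> usize I \<and> 1 \<le> M \<longrightarrow>
          calls_at_most (decision_oracle P I) I (A \<delta> M)
            (2 powr f (param I) * (log 2 (real (usize I)))\<^sup>2 * real M * log 2 (1 / \<delta>))) \<and>
       (card (witnesses P I) \<le> M \<longrightarrow>
          output_prob (decision_oracle P I) I (A \<delta> M) (Exactly (card (witnesses P I)))
            \<ge> 1 - \<delta>) \<and>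
       (card (witnesses P I) > M \<longrightarrow>
          always_outputs (decision_oracle P I) I (A \<delta> M) MoreThanM)) \<and>
    (\<forall>D g d. computable g \<and> solves_decision P D g d \<longrightarrow>
       (\<exists>e :: nat. \<forall>\<delta> M I.
          0 < \<delta> \<and> \<delta> \<le> 1 / 2 \<and> I \<in> instances P \<and> 2 \<le> usize I \<and> 1 \<le> M \<longrightarrow>
          expected_time (subroutine D I) I (A \<delta> M)
            \<le> ennreal (2 powr h (param I) * real (g (param I)) * real (usize I) ^ e
                         * real M * log 2 (1 / \<delta>))))"
proof -
  \<comment> \<open>Each attempt halves the failure probability. As
    \<open>\<delta> \<le> 1 / 2\<close>, the logarithm is at least 1, so rounding up at most doubles
    it.\<close>
  define R where "R \<delta> = nat \<lceil>log 2 (1 / \<delta>)\<rceil>" for \<delta> :: real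
  have R: "(1 / 2) ^ R \<delta> \<le> \<delta>" "real (R \<delta>) \<le> 2 * log 2 (1 / \<delta>)" "1 \<le> R \<delta>" "1 \<le> log 2 (1 / \<delta>)"
    if "0 < \<delta>" "\<delta> \<le> 1 / 2" for \<delta>
  proof -
    have "log 2 2 \<le> log 2 (1 / \<delta>)"
      using that by (subst log_le_cancel_iff) (auto simp: field_simps)
    then show L: "1 \<le> log 2 (1 / \<delta>)" by simp
    have R: "log 2 (1 / \<delta>) \<le> real (R \<delta>)" "real (R \<delta>) \<le> log 2 (1 / \<delta>) + 1"
      using L unfolding R_def by linarith+
    show "real (R \<delta>) \<le> 2 * log 2 (1 / \<delta>)" using R L by linarith
    show "1 \<le> R \<delta>" using R(1) L by linarith
    have "1 / \<delta> = 2 powr log 2 (1 / \<delta>)" using that by simp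
    also have "\<dots> \<le> 2 powr real (R \<delta>)" using R(1) by simp
    finally have "1 / \<delta> \<le> 2 ^ R \<delta>" by (simp add: powr_realpow)
    then show "(1 / 2) ^ R \<delta> \<le> \<delta>" using that by (simp add: power_divide field_simps)
  qed
  have sys: "witness_system (witnesses P I) (usize I) (param I)" if "I \<in> instances P" for I
    using assms that by (auto simp: witness_system_def self_contained_def universe_def)
  have dec: "witness_system.dec (witnesses P I) X = decision P I X" if "I \<in> instances P" for I X
    using sys[OF that] by (simp add: witness_system.dec_def decision_def)
  have search1: "search (witnesses P I) I (decision_oracle P I) 0" if "I \<in> instances P" for I
    using sys[OF that] dec[OF that] by (auto simp: search_def search_axioms_def decision_oracle_def)
  have search2: "search (witnesses P I) I (subroutine D I) (g (param I) * usize I ^ d)" "1 \<le> g (param I)"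
    if I: "I \<in> instances P" "2 \<le> usize I" and D: "solves_decision P D g d" for I D g d
  proof -
    have D': "\<exists>t. computes D I X (of_bool (decision P I X)) t \<and> t \<le> g (param I) * usize I ^ d"
      if "X \<subseteq> universe I" for X
      using D I that unfolding solves_decision_def by blast
    have "fst (subroutine D I X) = decision P I X \<and> snd (subroutine D I X) \<le> g (param I) * usize I ^ d"
      if "X \<subseteq> universe I" for X
      using D'[OF that] subroutine_eq by fastforce
    then show "search (witnesses P I) I (subroutine D I) (g (param I) * usize I ^ d)"
      using sys[OF I(1)] dec[OF I(1)] by (auto simp: search_def search_axioms_def)
    show "1 \<le> g (param I)"
      using D'[of "{}"] computes_time_pos by (cases "g (param I)") fastforce+
  qed
  define A where "A \<delta> M = algorithm (R \<delta>) M" for \<delta> M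
  \<comment> \<open>\<open>2 ^ f k\<close> is \<open>2 * 128 * 16 ^ k\<close>, with 2 from rounding
    in \<open>R\<close> and 128 above \<open>4 + 16 * 6\<close> from the budget. Likewise
    \<open>2 ^ h k\<close> is \<open>2 * 131072 * 32 ^ k\<close>, with
    \<open>2 ^ 17 = 131072\<close> above 81000.\<close>
  define f h :: "nat \<Rightarrow> real" where "f k = 4 * real k + 8" and "h k = 5 * real k + 18" for k
  have "f \<in> O(\<lambda>k. real k)"
    by (rule bigoI[of _ 12]) (auto simp: f_def intro!: eventually_at_top_linorderI[of 1])
  moreover have "h \<in> O(\<lambda>k. real k)"
    by (rule bigoI[of _ 23]) (auto simp: h_def intro!: eventually_at_top_linorderI[of 1])
  moreover have "(2 \<le> usize I \<and> 1 \<le> M \<longrightarrow>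
          calls_at_most (decision_oracle P I) I (A \<delta> M)
            (2 powr f (param I) * (log 2 (real (usize I)))\<^sup>2 * real M * log 2 (1 / \<delta>))) \<and>
       (card (witnesses P I) \<le> M \<longrightarrow>
          output_prob (decision_oracle P I) I (A \<delta> M) (Exactly (card (witnesses P I)))
            \<ge> 1 - \<delta>) \<and>
       (card (witnesses P I) > M \<longrightarrow>
          always_outputs (decision_oracle P I) I (A \<delta> M) MoreThanM)"
    if \<delta>: "0 < \<delta>" "\<delta> \<le> 1 / 2" and I: "I \<in> instances P" for \<delta> M I
  proof (intro conjI impI)
    let ?n = "usize I" and ?k = "param I"
    obtain p l where l: "?n \<le> 2 ^ l" "l = 0 \<or> 2 ^ (l - 1) < ?n" and
      run: "runs (decision_oracle P I) I (A \<delta> M) (init I (universe I))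
       (total_time ?n ?k 0 (2 * l + 2) (R \<delta>) (budget (2 * l + 2) ?k M)) (R \<delta> * budget (2 * l + 2) ?k M) p"
      and exact: "card (witnesses P I) \<le> M \<Longrightarrow> measure_pmf.prob p {m. answer_of m = Exactly (card (witnesses P I))} \<ge> 1 - (1 / 2) ^ R \<delta>"
      and more: "\<And>m. M < card (witnesses P I) \<Longrightarrow> m \<in> set_pmf p \<Longrightarrow> answer_of m = MoreThanM"
      unfolding A_def by (rule runs_algorithm[OF search1[OF I], where R = "R \<delta>" and M = M and X = "universe I"]) blast
    show "always_outputs (decision_oracle P I) I (A \<delta> M) MoreThanM" if "M < card (witnesses P I)"
      using run more[OF that] by (rule always_outputsI)
    show "1 - \<delta> \<le> output_prob (decision_oracle P I) I (A \<delta> M) (Exactly (card (witnesses P I)))"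
      if "card (witnesses P I) \<le> M"
      using exact[OF that] R(1)[OF \<delta>] output_prob_ge[OF run, of "Exactly (card (witnesses P I))"] by linarith
    show "calls_at_most (decision_oracle P I) I (A \<delta> M)
            (2 powr f ?k * (log 2 (real ?n))\<^sup>2 * real M * log 2 (1 / \<delta>))" if "2 \<le> ?n \<and> 1 \<le> M"
    proof (rule calls_at_mostI[OF run])
      let ?L = "log 2 (real ?n)" and ?d = "log 2 (1 / \<delta>)"
      have n: "2 \<le> ?n" "1 \<le> M" using that by simp_all
      have "log 2 2 \<le> ?L" using n by (subst log_le_cancel_iff) auto
      then have L: "1 \<le> ?L" by simp
      have "real l \<le> ?L + 1"
      proof (cases l)
        case (Suc l')
        then have "real (2 ^ l') \<le> real ?n" using l(2) by (simp only: of_nat_le_iff) simp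
        then have "log 2 (2 ^ l') \<le> ?L" using n by (subst log_le_cancel_iff) auto
        then show ?thesis using Suc by (simp add: log_nat_power)
      qed (use L in simp)
      then have T: "real (2 * l + 2) \<le> 6 * ?L" using L by simp
      have "?L * 1 \<le> ?L * ?L" using L by (intro mult_left_mono) auto
      \<comment> \<open>The budget is linear in \<open>T\<close> and thus in the logarithm of
        \<open>n\<close>; passing to the square uses \<open>n \<ge> 2\<close>, which makes this
        logarithm at least 1.\<close>
      then have L2: "?L \<le> ?L\<^sup>2" by (simp add: power2_eq_square)
      with L have L3: "1 \<le> ?L\<^sup>2" by linarith
      have SM: "1 \<le> 16 ^ ?k * real M" using n mult_mono[of 1 "16 ^ ?k" 1 "real M"] by simp
      have "real (2 * l + 2) * (16 ^ ?k * real M) \<le> (6 * ?L\<^sup>2) * (16 ^ ?k * real M)"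
        using T L2 by (intro mult_right_mono) auto
      moreover have "1 * 1 \<le> ?L\<^sup>2 * (16 ^ ?k * real M)" using L3 SM by (intro mult_mono) auto
      moreover have B: "real (budget (2 * l + 2) ?k M) = 4 + 16 * (real (2 * l + 2) * (16 ^ ?k * real M))"
        by (simp add: budget_def algebra_simps)
      ultimately have "real (budget (2 * l + 2) ?k M) \<le> 128 * (?L\<^sup>2 * (16 ^ ?k * real M))"
        unfolding B by linarith
      then have "real (R \<delta>) * real (budget (2 * l + 2) ?k M) \<le> (2 * ?d) * (128 * (?L\<^sup>2 * (16 ^ ?k * real M)))"
        using R[OF \<delta>] by (intro mult_mono) auto
      also have "\<dots> = 2 powr f ?k * ?L\<^sup>2 * real M * ?d"
      proof -
        have "2 powr f ?k = 2 powr real (4 * ?k + 8)" by (simp add: f_def)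
        also have "\<dots> = 2 ^ (4 * ?k + 8)" by (rule powr_realpow) simp
        also have "\<dots> = 256 * 16 ^ ?k" by (simp add: power_add power_mult)
        finally show ?thesis by simp
      qed
      finally show "real (R \<delta> * budget (2 * l + 2) ?k M) \<le> 2 powr f ?k * ?L\<^sup>2 * real M * ?d" by simp
    qed
  qed
  moreover have "expected_time (subroutine D I) I (A \<delta> M)
            \<le> ennreal (2 powr h (param I) * real (g (param I)) * real (usize I) ^ (d + 2)
                         * real M * log 2 (1 / \<delta>))"
    if D: "solves_decision P D g d" and \<delta>: "0 < \<delta>" "\<delta> \<le> 1 / 2"
      and I: "I \<in> instances P" "2 \<le> usize I" and M: "1 \<le> M" for D g d \<delta> M I
  proof -
    let ?n = "usize I" and ?k = "param I" and ?d = "log 2 (1 / \<delta>)"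
    let ?Z = "32 ^ ?k * ?n ^ (d + 2) * g ?k * M"
    obtain p l where l: "?n \<le> 2 ^ l" "l = 0 \<or> 2 ^ (l - 1) < ?n" and
      run: "runs (subroutine D I) I (A \<delta> M) (init I (universe I))
       (total_time ?n ?k (g ?k * ?n ^ d) (2 * l + 2) (R \<delta>) (budget (2 * l + 2) ?k M)) (R \<delta> * budget (2 * l + 2) ?k M) p"
      unfolding A_def by (rule runs_algorithm[OF search2(1)[OF I D], where R = "R \<delta>" and M = M and X = "universe I"]) blast
    have "l \<le> ?n"
    proof (cases l)
      case (Suc l')
      have "l' < 2 ^ l'" by (rule less_exp)
      moreover have "2 ^ l' < ?n" using l(2) Suc by simp
      ultimately show ?thesis using Suc by linarith
    qed simp
    then have "total_time ?n ?k (g ?k * ?n ^ d) (2 * l + 2) (R \<delta>) (budget (2 * l + 2) ?k M) \<le> R \<delta> * (81000 * ?Z)"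
      (is "?t \<le> _")
      by (intro total_time_le I M search2(2)[OF I D] R(3)[OF \<delta>]) simp
    then have "real ?t \<le> real (R \<delta>) * (81000 * real ?Z)"
      by (metis of_nat_le_iff of_nat_mult of_nat_numeral)
    also have "\<dots> \<le> (2 * ?d) * (131072 * real ?Z)"
      using R[OF \<delta>] by (intro mult_mono) auto
    also have "\<dots> = 2 powr h ?k * real (g ?k) * real ?n ^ (d + 2) * real M * ?d"
    proof -
      have "2 powr h ?k = 2 powr real (5 * ?k + 18)" by (simp add: h_def)
      also have "\<dots> = 2 ^ (5 * ?k + 18)" by (rule powr_realpow) simp
      also have "\<dots> = 262144 * 32 ^ ?k" by (simp add: power_add power_mult)
      finally show ?thesis by simp
    qed
    finally have "ennreal (real ?t) \<le> ennreal (2 powr h ?k * real (g ?k) * real ?n ^ (d + 2) * real M * ?d)"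
      by (rule ennreal_leI)
    with expected_time_le[OF run] show ?thesis by (simp add: ennreal_of_nat_eq_real_of_nat)
  qed
  ultimately show ?thesis
    by (intro exI[of _ A] exI[of _ f] exI[of _ h]) blast
qed

end
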